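(* The $k$-\textsc{Equidomination} problem (instance: a graph $G$ and $k\in\mathbb{N}$; parameter: $k$; question: is $G$ $k$-equidominating?) admits a generalized kernel of size $\mathcal{O}(k^{3k+1})$ which is computable in polynomial time. Furthermore, there is an algorithm that solves the $k$-\textsc{Equidomination} problem in time $\mathcal{O}\left(nm^2+n^2+k^{6k^2+7k+1}\right)$ for a given graph on $n$ vertices and $m$ edges.
   Context: All graphs are finite, simple and undirected; $\mathbb{N}=\{1,2,3,\dots\}$. For a graph $G=(V,E)$, a set $D\subseteq V$ is dominating if every vertex is in $D$ or adjacent to a vertex of $D$; a minimal dominating set (mds) is a dominating set containing no other dominating set as a proper subset. An equidominating structure of $G$ is a pair $(w,t)$ with $t\in\mathbb{N}$ and $w\colon V\to\mathbb{N}$ such that for all $D\subseteq V$: $D$ is an mds iff $\sum_{v\in D}w(v)=t$. For $k\in\mathbb{N}$, $G$ is $k$-equidominating if it has an equidominating structure $(w,t)$ with $w\colon V\to\{1,\dots,k\}$. A generalized kernelization for a parameterized problem is a polynomial-time algorithm transforming each instance $(I,k)$ into an instance $(I',k')$ of a (possibly different, related) decision problem such that $(I,k)$ is a yes-instance iff $(I',k')$ is a yes-instance, the size of $I'$ is bounded by $g(k)$ for a computable function $g$, and $k'$ is bounded by a function of $k$; $I'$ is called a generalized kernel of size $g(k)$. Size is measured in number of vertices (elements). *)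

theory Defs
  imports
    Complex_Main
    "HOL-Library.Landau_Symbols"
    "HOL-Library.Log_Nat"
    "HOL-Computational_Algebra.Polynomial"
begin

section \<open>Equidominating graphs\<close>

definition simple_graph :: "'a set \<Rightarrow> 'a set set \<Rightarrow> bool" where
  "simple_graph V E \<longleftrightarrow> finite V \<and> (\<forall>e\<in>E. e \<subseteq> V \<and> card e = 2)"

definition dominating :: "'a set \<Rightarrow> 'a set set \<Rightarrow> 'a set \<Rightarrow> bool" where
  "dominating V E D \<longleftrightarrow> D \<subseteq> V \<and> (\<forall>v\<in>V. v \<in> D \<or> (\<exists>u\<in>D. {u, v} \<in> E))"

definition minimal_dominating :: "'a set \<Rightarrow> 'a set set \<Rightarrow> 'a set \<Rightarrow> bool" where
  "minimal_dominating V E D \<longleftrightarrow> dominating V E D \<and> \<not> (\<exists>D'. D' \<subset> D \<and> dominating V E D')"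

definition equidominating_structure ::
  "'a set \<Rightarrow> 'a set set \<Rightarrow> ('a \<Rightarrow> nat) \<Rightarrow> nat \<Rightarrow> bool" where
  "equidominating_structure V E w t \<longleftrightarrow>
     t \<ge> 1 \<and> (\<forall>v\<in>V. w v \<ge> 1) \<and>
     (\<forall>D. D \<subseteq> V \<longrightarrow> (minimal_dominating V E D \<longleftrightarrow> (\<Sum>v\<in>D. w v) = t))"

definition k_equidominating :: "nat \<Rightarrow> 'a set \<Rightarrow> 'a set set \<Rightarrow> bool" where
  "k_equidominating k V E \<longleftrightarrow>
     (\<exists>w t. equidominating_structure V E w t \<and> (\<forall>v\<in>V. w v \<in> {1..k}))"

section \<open>Random access machine\<close>

text \<open>
  A uniform-cost random access machine over unbounded natural numbers, presented as a structured
  programming language. The memory consists of arrays addressed by indices that may be computed;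
  a program names only finitely many arrays. The only arithmetic operations are addition and
  truncated subtraction: with unit-cost multiplication, polynomially many steps would no
  longer correspond to polynomial time on Turing machines.
\<close>

type_synonym store = "nat \<Rightarrow> nat \<Rightarrow> nat"

datatype expr = Const nat | Load nat expr | Plus expr expr | Minus expr expr

fun eval_expr :: "expr \<Rightarrow> store \<Rightarrow> nat" where
  "eval_expr (Const c) s = c"
| "eval_expr (Load a e) s = s a (eval_expr e s)"
| "eval_expr (Plus e1 e2) s = eval_expr e1 s + eval_expr e2 s"
| "eval_expr (Minus e1 e2) s = eval_expr e1 s - eval_expr e2 s"

fun expr_cost :: "expr \<Rightarrow> nat" where
  "expr_cost (Const c) = 1"
| "expr_cost (Load a e) = 1 + expr_cost e"
| "expr_cost (Plus e1 e2) = 1 + expr_cost e1 + expr_cost e2"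
| "expr_cost (Minus e1 e2) = 1 + expr_cost e1 + expr_cost e2"

text \<open>Tests succeed on nonzero values, so \<open>Minus e2 e1\<close> tests whether \<open>e1 < e2\<close>.\<close>

datatype com =
    Skip
  | Assign nat expr expr
  | Seq com com
  | Cond expr com com
  | Loop expr com

text \<open>\<open>exec c s t s'\<close>: started in \<open>s\<close>, the program \<open>c\<close> terminates in \<open>s'\<close> after time \<open>t\<close>.\<close>

inductive exec :: "com \<Rightarrow> store \<Rightarrow> nat \<Rightarrow> store \<Rightarrow> bool" where
  Skip: "exec Skip s 1 s"
| Assign: "exec (Assign a i e) s (1 + expr_cost i + expr_cost e)
             (s(a := (s a)(eval_expr i s := eval_expr e s)))"
| Seq: "exec c1 s1 t1 s2 \<Longrightarrow> exec c2 s2 t2 s3 \<Longrightarrow> exec (Seq c1 c2) s1 (t1 + t2) s3"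
| CondTrue: "eval_expr b s \<noteq> 0 \<Longrightarrow> exec c1 s t s' \<Longrightarrow> exec (Cond b c1 c2) s (1 + expr_cost b + t) s'"
| CondFalse: "eval_expr b s = 0 \<Longrightarrow> exec c2 s t s' \<Longrightarrow> exec (Cond b c1 c2) s (1 + expr_cost b + t) s'"
| LoopFalse: "eval_expr b s = 0 \<Longrightarrow> exec (Loop b c) s (1 + expr_cost b) s"
| LoopTrue: "eval_expr b s1 \<noteq> 0 \<Longrightarrow> exec c s1 t1 s2 \<Longrightarrow> exec (Loop b c) s2 t2 s3 \<Longrightarrow>
             exec (Loop b c) s1 (1 + expr_cost b + t1 + t2) s3"

definition computable :: "(nat \<Rightarrow> nat) \<Rightarrow> bool" where
  "computable f \<longleftrightarrow>
     (\<exists>c. \<forall>x. \<exists>t s. exec c (\<lambda>a i. if a = 0 \<and> i = 0 then x else 0) t s \<and> s 0 0 = f x)"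

section \<open>Parameterized problems\<close>

text \<open>
  An instance \<open>((n, F), k)\<close> consists of a set system \<open>F\<close> on the elements \<open>{..<n}\<close> and a parameter
  \<open>k\<close>; its size is the number \<open>n\<close> of elements. Graphs are the case where \<open>F\<close> is the edge set.
  General set systems also accommodate graphs with annotations.
\<close>

type_synonym param_problem = "((nat \<times> nat set set) \<times> nat) set"

definition graph_instance :: "nat \<Rightarrow> nat set set \<Rightarrow> nat \<Rightarrow> bool" where
  "graph_instance n E k \<longleftrightarrow> simple_graph {..<n} E \<and> k \<ge> 1"

definition k_Equidomination :: param_problem where
  "k_Equidomination = {((n, E), k). graph_instance n E k \<and> k_equidominating k {..<n} E}"

text \<open>Input: \<open>n\<close> and \<open>k\<close> in array 0 and the adjacency matrix in array 1, row by row.\<close>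

definition encode_graph :: "nat \<Rightarrow> nat set set \<Rightarrow> nat \<Rightarrow> store" where
  "encode_graph n E k = (\<lambda>a i.
     if a = 0 then (if i = 0 then n else if i = 1 then k else 0)
     else if a = 1 \<and> i < n * n \<and> {i div n, i mod n} \<in> E then 1 else 0)"

text \<open>The length of the input in bits: adjacency matrix and binary representation of \<open>k\<close>.\<close>

definition input_length :: "nat \<Rightarrow> nat \<Rightarrow> nat" where
  "input_length n k = n * n + floorlog 2 k"

text \<open>
  Output: array 0 holds the number of elements, the number of listed sets and the parameter;
  array 1 holds the incidence matrix of the sets, row by row.
\<close>

definition decode_instance :: "store \<Rightarrow> (nat \<times> nat set set) \<times> nat" where
  "decode_instance s =
     ((s 0 0, {{v. v < s 0 0 \<and> s 1 (j * s 0 0 + v) \<noteq> 0} |j. j < s 0 1}), s 0 2)"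

text \<open>
  \<open>c\<close> computes generalized kernels of size \<open>g k\<close> in polynomial time, for the graph problem \<open>P\<close>
  and with target problem \<open>Q\<close>.
\<close>

definition generalized_kernelization ::
  "param_problem \<Rightarrow> param_problem \<Rightarrow> com \<Rightarrow> (nat \<Rightarrow> nat) \<Rightarrow> bool" where
  "generalized_kernelization P Q c g \<longleftrightarrow>
     computable g \<and>
     (\<exists>(p :: nat poly) (h :: nat \<Rightarrow> nat). \<forall>n E k. graph_instance n E k \<longrightarrow>
        (\<exists>t s n' F k'. exec c (encode_graph n E k) t s \<and>
           t \<le> poly p (input_length n k) \<and>
           decode_instance s = ((n', F), k') \<and>
           (((n, E), k) \<in> P \<longleftrightarrow> ((n', F), k') \<in> Q) \<and>
           n' \<le> g k \<and> k' \<le> h k))"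

text \<open>
  \<open>c\<close> decides the graph problem \<open>P\<close>, and its running time on graphs with \<open>n\<close> vertices and \<open>m\<close>
  edges and parameter \<open>k\<close> is at most \<open>T n m k\<close>.
\<close>

definition solves_in_time ::
  "com \<Rightarrow> param_problem \<Rightarrow> (nat \<Rightarrow> nat \<Rightarrow> nat \<Rightarrow> nat) \<Rightarrow> bool" where
  "solves_in_time c P T \<longleftrightarrow>
     (\<forall>n E k. graph_instance n E k \<longrightarrow>
        (\<exists>t s. exec c (encode_graph n E k) t s \<and> t \<le> T n (card E) k \<and>
           s 0 0 = (if ((n, E), k) \<in> P then 1 else 0)))"

end

theory Submission
  imports Defs "HOL-Library.Nat_Bijection"
begin

text \<open>
  Domination is hitting all closed neighbourhoods, so only the minimal closed neighbourhoods matter.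
  Call two vertices twins if exchanging them preserves the minimal dominating sets (mds). Vertices of
  equal weight are twins, hence a \<open>k\<close>-equidominating graph has at most \<open>k\<close> twin classes,
  and whether a set is an mds depends only on how many vertices it takes from each class.

  All but \<open>3 k\<^sup>4\<close> isolated vertices may be deleted. Afterwards the target is at most \<open>10 k\<^sup>6\<close>:
  the largest weight class \<open>A\<close> contains \<open>0\<close>, \<open>1\<close>, \<open>2\<close> or all of its elements in an mds, because
  any other count would force more distinct closed neighbourhoods than there are vertices. If the counts
  \<open>1\<close> or \<open>2\<close> occur, exchanging other vertices for elements of \<open>A\<close> bounds the mds in question. Otherwise
  every mds contains \<open>A\<close>, so \<open>A\<close> consists of isolated vertices.

  With the target bounded by \<open>T\<close>, twin classes may be truncated to \<open>T + 1\<close> vertices, and it remains to try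
  for every weight a class and a multiplicity, and for each such choice all vectors of counts. This takes
  time \<open>k\<close> to the power \<open>O(k)\<close>, plus \<open>n\<^sup>2\<close> and the third power of the number of nonisolated vertices,
  which is at most \<open>4 n m\<^sup>2\<close>.

  The kernel is the hypergraph of closed neighbourhoods if \<open>n \<le> k ^ k\<close>. For larger \<open>n\<close> the running
  time of the solver is polynomial in \<open>n\<close>, so the instance is solved and replaced by a trivial one.
\<close>

section \<open>A language of bounded loops and its compilation\<close>

text \<open>Isolated vertices are the obstacle to a target polynomial in \<open>k\<close>: each lies
  in every mds and adds to the target. More than \<open>2 * k ^ 4\<close> of them put over
  \<open>2 * k ^ 3\<close> into one weight class, which outweighs all nonisolated vertices together,
  so further isolated vertices can be given that weight without creating new sets of the right sum;
  \<open>3 * k ^ 4\<close> is a convenient number above this threshold, and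
  \<open>10 * k ^ 6\<close> follows from it. Truncating the classes raises a second question: the
  weights found on the kept vertices must extend to the dropped ones. Keeping one vertex more than
  an mds can take from a class allows an exchange that forces a single weight on every class with
  dropped vertices. Finally, the search multiplies an exponential in \<open>k\<close> by the square
  of the vertex number, whereas the time bound is a sum; the product is separated by the inequality
  between geometric and arithmetic mean, which only raises the exponential in \<open>k\<close> to a
  constant power. That power remains of the form \<open>k\<close> to the \<open>O(k)\<close> and is
  far below the permitted exponent, quadratic in \<open>k\<close>.\<close>

text \<open>
  The bound of a sum or loop is the content of cell \<open>0\<close> of an array. Since programs never write to the
  arrays that bound their loops, the cost of a program depends only on these contents at the start.
\<close>

datatype hx = Cn nat | Vr nat | Ld nat hx | Pl hx hx | Mi hx hx | Ite hx hx hx | Sm nat nat hx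

fun heval :: "hx \<Rightarrow> (nat \<Rightarrow> nat) \<Rightarrow> store \<Rightarrow> nat" where
  "heval (Cn c) \<rho> s = c"
| "heval (Vr x) \<rho> s = \<rho> x"
| "heval (Ld a e) \<rho> s = s a (heval e \<rho> s)"
| "heval (Pl e f) \<rho> s = heval e \<rho> s + heval f \<rho> s"
| "heval (Mi e f) \<rho> s = heval e \<rho> s - heval f \<rho> s"
| "heval (Ite e f g) \<rho> s = (if heval e \<rho> s \<noteq> 0 then heval f \<rho> s else heval g \<rho> s)"
| "heval (Sm x a e) \<rho> s = (\<Sum>i<s a 0. heval e (\<rho>(x := i)) s)"

fun xreads :: "hx \<Rightarrow> nat set" where
  "xreads (Cn c) = {}"
| "xreads (Vr x) = {}"
| "xreads (Ld a e) = insert a (xreads e)"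
| "xreads (Pl e f) = xreads e \<union> xreads f"
| "xreads (Mi e f) = xreads e \<union> xreads f"
| "xreads (Ite e f g) = xreads e \<union> xreads f \<union> xreads g"
| "xreads (Sm x a e) = insert a (xreads e)"

fun xbounds :: "hx \<Rightarrow> nat set" where
  "xbounds (Cn c) = {}"
| "xbounds (Vr x) = {}"
| "xbounds (Ld a e) = xbounds e"
| "xbounds (Pl e f) = xbounds e \<union> xbounds f"
| "xbounds (Mi e f) = xbounds e \<union> xbounds f"
| "xbounds (Ite e f g) = xbounds e \<union> xbounds f \<union> xbounds g"
| "xbounds (Sm x a e) = insert a (xbounds e)"

text \<open>Both branches of a conditional are charged, so the bound depends on nothing but the loop
  bounds \<open>\<beta>\<close>. In a sum, 19 pays for one pass (test 6, addition 7, increment 6)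
  and 12 for the initialisations and the last test.\<close>

fun xcost :: "hx \<Rightarrow> (nat \<Rightarrow> nat) \<Rightarrow> nat" where
  "xcost (Cn c) \<beta> = 3"
| "xcost (Vr x) \<beta> = 4"
| "xcost (Ld a e) \<beta> = xcost e \<beta> + 5"
| "xcost (Pl e f) \<beta> = xcost e \<beta> + xcost f \<beta> + 7"
| "xcost (Mi e f) \<beta> = xcost e \<beta> + xcost f \<beta> + 7"
| "xcost (Ite e f g) \<beta> = xcost e \<beta> + xcost f \<beta> + xcost g \<beta> + 3"
| "xcost (Sm x a e) \<beta> = \<beta> a * (xcost e \<beta> + 19) + 12"

text \<open>The coefficient of the polynomial bound in \<open>xcost_le\<close>; 31 is 19 + 12, the
  overheads of a sum.\<close>

fun xsize :: "hx \<Rightarrow> nat" where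
  "xsize (Cn c) = 3"
| "xsize (Vr x) = 4"
| "xsize (Ld a e) = xsize e + 5"
| "xsize (Pl e f) = xsize e + xsize f + 7"
| "xsize (Mi e f) = xsize e + xsize f + 7"
| "xsize (Ite e f g) = xsize e + xsize f + xsize g + 3"
| "xsize (Sm x a e) = xsize e + 31"

fun xdepth :: "hx \<Rightarrow> nat" where
  "xdepth (Cn c) = 0"
| "xdepth (Vr x) = 0"
| "xdepth (Ld a e) = xdepth e"
| "xdepth (Pl e f) = max (xdepth e) (xdepth f)"
| "xdepth (Mi e f) = max (xdepth e) (xdepth f)"
| "xdepth (Ite e f g) = max (xdepth e) (max (xdepth f) (xdepth g))"
| "xdepth (Sm x a e) = Suc (xdepth e)"

abbreviation reg :: "nat \<Rightarrow> expr" where "reg a \<equiv> Load a (Const 0)"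

text \<open>
  Programs use the arrays below 100. The compiled code puts the value of an expression into cell \<open>0\<close>
  of array \<open>N\<close> and uses the arrays from \<open>N\<close> on as scratch space; \<open>r\<close> maps the bound variables to
  the arrays that hold their values.
\<close>

fun xcompile :: "hx \<Rightarrow> (nat \<Rightarrow> nat) \<Rightarrow> nat \<Rightarrow> com" where
  "xcompile (Cn c) r N = Assign N (Const 0) (Const c)"
| "xcompile (Vr x) r N = Assign N (Const 0) (reg (r x))"
| "xcompile (Ld a e) r N = Seq (xcompile e r N) (Assign N (Const 0) (Load a (reg N)))"
| "xcompile (Pl e f) r N = Seq (xcompile e r N) (Seq (xcompile f r (N + 1))
     (Assign N (Const 0) (Plus (reg N) (reg (N + 1)))))"
| "xcompile (Mi e f) r N = Seq (xcompile e r N) (Seq (xcompile f r (N + 1))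
     (Assign N (Const 0) (Minus (reg N) (reg (N + 1)))))"
| "xcompile (Ite e f g) r N = Seq (xcompile e r N) (Cond (reg N) (xcompile f r N) (xcompile g r N))"
| "xcompile (Sm x a e) r N = Seq (Assign N (Const 0) (Const 0)) (Seq (Assign (N + 1) (Const 0) (Const 0))
     (Loop (Minus (reg a) (reg (N + 1)))
       (Seq (xcompile e (r(x := N + 1)) (N + 2))
         (Seq (Assign N (Const 0) (Plus (reg N) (reg (N + 2))))
              (Assign (N + 1) (Const 0) (Plus (reg (N + 1)) (Const 1)))))))"

lemma heval_cong:
  "(\<And>a. a \<in> xreads e \<Longrightarrow> s a = s' a) \<Longrightarrow> heval e \<rho> s = heval e \<rho> s'"
  by (induction e arbitrary: \<rho>) auto

lemma power_bound_mono:
  fixes a m X :: nat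
  assumes "a \<le> m * Suc X ^ i" "i \<le> j"
  shows "a \<le> m * Suc X ^ j"
  by (rule order_trans[OF assms(1) mult_le_mono2[OF power_increasing[OF assms(2)]]]) simp

lemma add_bound:
  fixes a b c m n P :: nat
  assumes "a \<le> m * P" "b \<le> n * P" "1 \<le> P"
  shows "a + b + c \<le> (m + n + c) * P"
proof -
  have "c * 1 \<le> c * P" using assms(3) by (rule mult_le_mono2)
  then have "c \<le> c * P" by simp
  with assms(1,2) show ?thesis unfolding distrib_right by linarith
qed

text \<open>A loop raises the degree by one: its \<open>b \<le> X\<close> passes supply one more
  factor \<open>Suc X\<close>, and the overheads \<open>c\<close> per pass and \<open>e\<close> in
  total go into the coefficient.\<close>

lemma loop_bound:
  fixes a b m X :: nat
  assumes "a \<le> m * Suc X ^ d" "b \<le> X" "c + e \<le> k"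
  shows "b * (a + c) + e \<le> (m + k) * Suc X ^ Suc d"
proof -
  let ?P = "Suc X ^ d"
  have P: "1 \<le> ?P" by simp
  have "a + c \<le> (m + c) * ?P" using add_bound[OF assms(1) _ P, of 0 0 c] by simp
  then have "b * (a + c) \<le> X * ((m + c) * ?P)" using assms(2) by (rule mult_le_mono[rotated])
  moreover have "e \<le> e * (Suc X * ?P)" using P by (cases "Suc X * ?P") auto
  moreover have "X * ((m + c) * ?P) \<le> (m + c) * (Suc X * ?P)" by (simp add: algebra_simps)
  ultimately have "b * (a + c) + e \<le> (m + c) * (Suc X * ?P) + e * (Suc X * ?P)" by linarith
  also have "\<dots> = (m + (c + e)) * (Suc X * ?P)" by (simp add: algebra_simps)
  also have "\<dots> \<le> (m + k) * (Suc X * ?P)" using assms(3) by (intro mult_right_mono) auto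
  finally show ?thesis by simp
qed

lemma xcost_le:
  assumes "\<And>a. a \<in> xbounds e \<Longrightarrow> \<beta> a \<le> X"
  shows "xcost e \<beta> \<le> xsize e * Suc X ^ xdepth e"
  using assms
proof (induction e)
  case (Ld a e)
  then have "xcost e \<beta> \<le> xsize e * Suc X ^ xdepth e" by simp
  from add_bound[OF this, of 0 0 5] show ?case by simp
next
  case (Pl e f)
  then have "xcost e \<beta> \<le> xsize e * Suc X ^ xdepth e" "xcost f \<beta> \<le> xsize f * Suc X ^ xdepth f"
    by simp_all
  then have "xcost e \<beta> \<le> xsize e * Suc X ^ xdepth (Pl e f)" "xcost f \<beta> \<le> xsize f * Suc X ^ xdepth (Pl e f)"
    by (auto elim!: power_bound_mono)
  from add_bound[OF this, of 7] show ?case by simp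
next
  case (Mi e f)
  then have "xcost e \<beta> \<le> xsize e * Suc X ^ xdepth e" "xcost f \<beta> \<le> xsize f * Suc X ^ xdepth f"
    by simp_all
  then have "xcost e \<beta> \<le> xsize e * Suc X ^ xdepth (Mi e f)" "xcost f \<beta> \<le> xsize f * Suc X ^ xdepth (Mi e f)"
    by (auto elim!: power_bound_mono)
  from add_bound[OF this, of 7] show ?case by simp
next
  case (Ite e f g)
  let ?d = "xdepth (Ite e f g)"
  have "xcost e \<beta> \<le> xsize e * Suc X ^ xdepth e" "xcost f \<beta> \<le> xsize f * Suc X ^ xdepth f"
     "xcost g \<beta> \<le> xsize g * Suc X ^ xdepth g"
    using Ite by simp_all
  then have b: "xcost e \<beta> \<le> xsize e * Suc X ^ ?d" "xcost f \<beta> \<le> xsize f * Suc X ^ ?d"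
    "xcost g \<beta> \<le> xsize g * Suc X ^ ?d"
    by (auto elim!: power_bound_mono)
  have "xcost e \<beta> + xcost f \<beta> \<le> (xsize e + xsize f) * Suc X ^ ?d"
    using add_bound[OF b(1,2), of 0] by simp
  from add_bound[OF this b(3), of 3] show ?case by simp
next
  case (Sm x a e)
  then have "xcost e \<beta> \<le> xsize e * Suc X ^ xdepth e" "\<beta> a \<le> X" by simp_all
  from loop_bound[OF this, of 19 12 31] show ?case by simp
qed auto

lemma exec_Assign_reg:
  "exec (Assign a (Const 0) e) s (2 + expr_cost e) (s(a := (s a)(0 := eval_expr e s)))"
  using exec.Assign[of a "Const 0" e s] by simp

text \<open>Intermediate results survive because code compiled for \<open>N\<close> changes no array
  below \<open>N\<close>. The store \<open>\<sigma>\<close> is separated from \<open>s\<close>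
  because only the program arrays have a meaning; scratch arrays differ from one call to the
  next.\<close>

lemma xcompile_correct:
  assumes "xreads e \<subseteq> {..<100}" "100 \<le> N" "\<And>x. r x < N" "\<And>x. s (r x) 0 = \<rho> x"
    "\<And>a. a < 100 \<Longrightarrow> s a = \<sigma> a" "\<And>a. a \<in> xbounds e \<Longrightarrow> \<sigma> a 0 = \<beta> a"
  shows "\<exists>t s'. exec (xcompile e r N) s t s' \<and> t \<le> xcost e \<beta> \<and> s' N 0 = heval e \<rho> \<sigma> \<and>
    (\<forall>a<N. s' a = s a)"
  using assms
proof (induction e arbitrary: r N s \<rho>)
  case (Cn c)
  show ?case unfolding xcompile.simps by (intro exI conjI, rule exec_Assign_reg) auto
next
  case (Vr x)
  show ?case unfolding xcompile.simps by (intro exI conjI, rule exec_Assign_reg) (use Vr in auto)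
next
  case (Ld a e)
  from Ld.IH[of N r s \<rho>] Ld.prems obtain t s' where 1: "exec (xcompile e r N) s t s'"
    "t \<le> xcost e \<beta>" "s' N 0 = heval e \<rho> \<sigma>" "\<forall>a<N. s' a = s a" by auto
  show ?case
    unfolding xcompile.simps
    by (intro exI conjI, rule exec.Seq[OF 1(1) exec_Assign_reg]) (use 1 Ld.prems in auto)
next
  case (Pl e f)
  from Pl.IH(1)[of N r s \<rho>] Pl.prems obtain t s' where 1: "exec (xcompile e r N) s t s'"
    "t \<le> xcost e \<beta>" "s' N 0 = heval e \<rho> \<sigma>" "\<forall>a<N. s' a = s a" by auto
  from Pl.IH(2)[of "N + 1" r s' \<rho>] Pl.prems 1 obtain u s'' where 2: "exec (xcompile f r (N + 1)) s' u s''"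
    "u \<le> xcost f \<beta>" "s'' (N + 1) 0 = heval f \<rho> \<sigma>" "\<forall>a<N + 1. s'' a = s' a"
    by (fastforce simp: less_Suc_eq)
  show ?case
    unfolding xcompile.simps
    by (intro exI conjI, rule exec.Seq[OF 1(1) exec.Seq[OF 2(1) exec_Assign_reg]]) (use 1 2 Pl.prems in auto)
next
  case (Mi e f)
  from Mi.IH(1)[of N r s \<rho>] Mi.prems obtain t s' where 1: "exec (xcompile e r N) s t s'"
    "t \<le> xcost e \<beta>" "s' N 0 = heval e \<rho> \<sigma>" "\<forall>a<N. s' a = s a" by auto
  from Mi.IH(2)[of "N + 1" r s' \<rho>] Mi.prems 1 obtain u s'' where 2: "exec (xcompile f r (N + 1)) s' u s''"
    "u \<le> xcost f \<beta>" "s'' (N + 1) 0 = heval f \<rho> \<sigma>" "\<forall>a<N + 1. s'' a = s' a"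
    by (fastforce simp: less_Suc_eq)
  show ?case
    unfolding xcompile.simps
    by (intro exI conjI, rule exec.Seq[OF 1(1) exec.Seq[OF 2(1) exec_Assign_reg]]) (use 1 2 Mi.prems in auto)
next
  case (Ite e f g)
  from Ite.IH(1)[of N r s \<rho>] Ite.prems obtain t s' where 1: "exec (xcompile e r N) s t s'"
    "t \<le> xcost e \<beta>" "s' N 0 = heval e \<rho> \<sigma>" "\<forall>a<N. s' a = s a" by auto
  have pre: "\<And>x. s' (r x) 0 = \<rho> x" "\<And>a. a < 100 \<Longrightarrow> s' a = \<sigma> a"
    using 1 Ite.prems by auto
  show ?case
  proof (cases "heval e \<rho> \<sigma> = 0")
    case True
    from Ite.IH(3)[of N r s' \<rho>] Ite.prems pre obtain u s'' where 2: "exec (xcompile g r N) s' u s''"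
      "u \<le> xcost g \<beta>" "s'' N 0 = heval g \<rho> \<sigma>" "\<forall>a<N. s'' a = s' a" by auto
    show ?thesis unfolding xcompile.simps
      by (intro exI conjI, rule exec.Seq[OF 1(1) exec.CondFalse[OF _ 2(1)]]) (use 1 2 True in auto)
  next
    case False
    from Ite.IH(2)[of N r s' \<rho>] Ite.prems pre obtain u s'' where 2: "exec (xcompile f r N) s' u s''"
      "u \<le> xcost f \<beta>" "s'' N 0 = heval f \<rho> \<sigma>" "\<forall>a<N. s'' a = s' a" by auto
    show ?thesis unfolding xcompile.simps
      by (intro exI conjI, rule exec.Seq[OF 1(1) exec.CondTrue[OF _ 2(1)]]) (use 1 2 False in auto)
  qed
next
  case (Sm x a e)
  define n where "n = \<sigma> a 0"
  have a: "a < 100" and n: "\<beta> a = n" using Sm.prems by (auto simp: n_def)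
  define body where "body = Seq (xcompile e (r(x := N + 1)) (N + 2))
         (Seq (Assign N (Const 0) (Plus (reg N) (reg (N + 2))))
              (Assign (N + 1) (Const 0) (Plus (reg (N + 1)) (Const 1))))"
  have step: "\<exists>t s'. exec body s1 t s' \<and> t \<le> xcost e \<beta> + 13 \<and>
      s' N 0 = s1 N 0 + heval e (\<rho>(x := i)) \<sigma> \<and> s' (N + 1) 0 = i + 1 \<and> (\<forall>a<N. s' a = s1 a)"
    if s1: "\<forall>a<N. s1 a = s a" "s1 (N + 1) 0 = i" for s1 i
  proof -
    have "r y < N + 2" for y using Sm.prems(3)[of y] by simp
    moreover have "s1 (r y) 0 = \<rho> y" for y using Sm.prems(3,4)[of y] s1 by simp
    moreover have "\<And>a. a < 100 \<Longrightarrow> s1 a = \<sigma> a" using s1 Sm.prems by simp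
    ultimately have "\<exists>t s'. exec (xcompile e (r(x := N + 1)) (N + 2)) s1 t s' \<and> t \<le> xcost e \<beta> \<and>
      s' (N + 2) 0 = heval e (\<rho>(x := i)) \<sigma> \<and> (\<forall>a<N+2. s' a = s1 a)"
      using Sm.prems(1,2,6) s1(2) by (intro Sm.IH) auto
    then obtain t s' where 1: "exec (xcompile e (r(x := N + 1)) (N + 2)) s1 t s'" "t \<le> xcost e \<beta>"
      "s' (N + 2) 0 = heval e (\<rho>(x := i)) \<sigma>" "\<forall>a<N+2. s' a = s1 a" by blast
    show ?thesis unfolding body_def
      by (intro exI conjI, rule exec.Seq[OF 1(1) exec.Seq[OF exec_Assign_reg exec_Assign_reg]])
        (use 1 s1 in auto)
  qed
  \<comment> \<open>\<open>j\<close> counts the passes still to come, so the induction starts at the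
    last test and the sum runs over the final \<open>j\<close> indices.\<close>
  have loop: "\<exists>t s'. exec (Loop (Minus (reg a) (reg (N + 1))) body) s1 t s' \<and> t \<le> j * (xcost e \<beta> + 19) + 6 \<and>
      s' N 0 = s1 N 0 + (\<Sum>i=n - j..<n. heval e (\<rho>(x := i)) \<sigma>) \<and> (\<forall>a<N. s' a = s a)"
    if "\<forall>a<N. s1 a = s a" "s1 (N + 1) 0 = n - j" "j \<le> n" for s1 j
    using that
  proof (induction j arbitrary: s1)
    case 0
    have "s1 a 0 = n" using 0 a Sm.prems by (simp add: n_def)
    with 0 have "eval_expr (Minus (reg a) (reg (N + 1))) s1 = 0" by simp
    from exec.LoopFalse[OF this, of body] show ?case
      by (intro exI conjI) (assumption, use 0 in auto)
  next
    case (Suc j)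
    have sa: "s1 a 0 = n" using Suc.prems a Sm.prems by (simp add: n_def)
    from step[OF Suc.prems(1,2)] obtain t s' where 1: "exec body s1 t s'" "t \<le> xcost e \<beta> + 13"
      "s' N 0 = s1 N 0 + heval e (\<rho>(x := n - Suc j)) \<sigma>" "s' (N + 1) 0 = n - Suc j + 1" "\<forall>a<N. s' a = s1 a"
      by blast
    have "n - Suc j + 1 = n - j" using Suc.prems by simp
    then have "\<exists>u s''. exec (Loop (Minus (reg a) (reg (N + 1))) body) s' u s'' \<and> u \<le> j * (xcost e \<beta> + 19) + 6 \<and>
      s'' N 0 = s' N 0 + (\<Sum>i=n - j..<n. heval e (\<rho>(x := i)) \<sigma>) \<and> (\<forall>a<N. s'' a = s a)"
      using 1 Suc.prems by (intro Suc.IH) simp_all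
    then obtain u s'' where
      2: "exec (Loop (Minus (reg a) (reg (N + 1))) body) s' u s''" "u \<le> j * (xcost e \<beta> + 19) + 6"
      "s'' N 0 = s' N 0 + (\<Sum>i=n - j..<n. heval e (\<rho>(x := i)) \<sigma>)" "\<forall>a<N. s'' a = s a"
      by blast
    have "{n - Suc j..<n} = insert (n - Suc j) {n - j..<n}" using Suc.prems by auto
    then have "(\<Sum>i=n - Suc j..<n. heval e (\<rho>(x := i)) \<sigma>) =
      heval e (\<rho>(x := n - Suc j)) \<sigma> + (\<Sum>i=n - j..<n. heval e (\<rho>(x := i)) \<sigma>)"
      using Suc.prems by simp
    note sum = this
    show ?case
      by (intro exI conjI, rule exec.LoopTrue[OF _ 1(1) 2(1)]) (use sum sa Suc.prems 1 2 in \<open>auto simp del: fun_upd_apply\<close>)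
  qed
  define s1 where "s1 = s(N := (s N)(0 := 0))"
  define s2 where "s2 = s1(N + 1 := (s1 (N + 1))(0 := 0))"
  obtain t s' where 3: "exec (Loop (Minus (reg a) (reg (N + 1))) body) s2 t s'" "t \<le> n * (xcost e \<beta> + 19) + 6"
      "s' N 0 = s2 N 0 + (\<Sum>i=n - n..<n. heval e (\<rho>(x := i)) \<sigma>)" "\<forall>a<N. s' a = s a"
    using loop[of s2 n] by (auto simp: s1_def s2_def)
  have e1: "exec (Assign N (Const 0) (Const 0)) s 3 s1"
    using exec_Assign_reg[of N "Const 0" s] by (simp add: s1_def)
  have e2: "exec (Assign (N + 1) (Const 0) (Const 0)) s1 3 s2"
    using exec_Assign_reg[of "N + 1" "Const 0" s1] by (simp add: s2_def)
  show ?case unfolding xcompile.simps body_def[symmetric]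
    by (intro exI conjI, rule exec.Seq[OF e1 exec.Seq[OF e2 3(1)]])
      (use 3 n in \<open>auto simp: s1_def s2_def n_def[symmetric] atLeast0LessThan\<close>)
qed

section \<open>Programs with bounded loops and their compilation\<close>

datatype hc = As nat hx hx | Sq hc hc | IfC hx hc hc | For nat nat hc

primrec forloop :: "(nat \<Rightarrow> 's \<Rightarrow> 's) \<Rightarrow> nat \<Rightarrow> 's \<Rightarrow> 's" where
  "forloop f 0 s = s"
| "forloop f (Suc n) s = f n (forloop f n s)"

fun hrun :: "hc \<Rightarrow> (nat \<Rightarrow> nat) \<Rightarrow> store \<Rightarrow> store" where
  "hrun (As a i e) \<rho> s = s(a := (s a)(heval i \<rho> s := heval e \<rho> s))"
| "hrun (Sq c d) \<rho> s = hrun d \<rho> (hrun c \<rho> s)"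
| "hrun (IfC e c d) \<rho> s = (if heval e \<rho> s \<noteq> 0 then hrun c \<rho> s else hrun d \<rho> s)"
| "hrun (For x a c) \<rho> s = forloop (\<lambda>i. hrun c (\<rho>(x := i))) (s a 0) s"

fun creads :: "hc \<Rightarrow> nat set" where
  "creads (As a i e) = insert a (xreads i \<union> xreads e)"
| "creads (Sq c d) = creads c \<union> creads d"
| "creads (IfC e c d) = xreads e \<union> creads c \<union> creads d"
| "creads (For x a c) = insert a (creads c)"

fun cbounds :: "hc \<Rightarrow> nat set" where
  "cbounds (As a i e) = xbounds i \<union> xbounds e"
| "cbounds (Sq c d) = cbounds c \<union> cbounds d"
| "cbounds (IfC e c d) = xbounds e \<union> cbounds c \<union> cbounds d"
| "cbounds (For x a c) = insert a (cbounds c)"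

fun cwrites :: "hc \<Rightarrow> nat set" where
  "cwrites (As a i e) = {a}"
| "cwrites (Sq c d) = cwrites c \<union> cwrites d"
| "cwrites (IfC e c d) = cwrites c \<union> cwrites d"
| "cwrites (For x a c) = cwrites c"

fun ccost :: "hc \<Rightarrow> (nat \<Rightarrow> nat) \<Rightarrow> nat" where
  "ccost (As a i e) \<beta> = xcost i \<beta> + xcost e \<beta> + 5"
| "ccost (Sq c d) \<beta> = ccost c \<beta> + ccost d \<beta>"
| "ccost (IfC e c d) \<beta> = xcost e \<beta> + ccost c \<beta> + ccost d \<beta> + 3"
| "ccost (For x a c) \<beta> = \<beta> a * (ccost c \<beta> + 12) + 9"

fun csize :: "hc \<Rightarrow> nat" where
  "csize (As a i e) = xsize i + xsize e + 5"
| "csize (Sq c d) = csize c + csize d"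
| "csize (IfC e c d) = xsize e + csize c + csize d + 3"
| "csize (For x a c) = csize c + 21"

fun cdepth :: "hc \<Rightarrow> nat" where
  "cdepth (As a i e) = max (xdepth i) (xdepth e)"
| "cdepth (Sq c d) = max (cdepth c) (cdepth d)"
| "cdepth (IfC e c d) = max (xdepth e) (max (cdepth c) (cdepth d))"
| "cdepth (For x a c) = Suc (cdepth c)"

fun ccompile :: "hc \<Rightarrow> (nat \<Rightarrow> nat) \<Rightarrow> nat \<Rightarrow> com" where
  "ccompile (As a i e) r N = Seq (xcompile i r N) (Seq (xcompile e r (N + 1)) (Assign a (reg N) (reg (N + 1))))"
| "ccompile (Sq c d) r N = Seq (ccompile c r N) (ccompile d r N)"
| "ccompile (IfC e c d) r N = Seq (xcompile e r N) (Cond (reg N) (ccompile c r N) (ccompile d r N))"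
| "ccompile (For x a c) r N = Seq (Assign N (Const 0) (Const 0))
     (Loop (Minus (reg a) (reg N)) (Seq (ccompile c (r(x := N)) (N + 1))
       (Assign N (Const 0) (Plus (reg N) (Const 1)))))"

lemma forloop_invariant:
  assumes "P 0 s" "\<And>i s. i < n \<Longrightarrow> P i s \<Longrightarrow> P (Suc i) (f i s)"
  shows "P n (forloop f n s)"
proof -
  have "P i (forloop f i s)" if "i \<le> n" for i
    using that by (induction i) (auto intro: assms)
  then show ?thesis by simp
qed

lemma hrun_frame: "a \<notin> cwrites c \<Longrightarrow> hrun c \<rho> s a = s a"
proof (induction c arbitrary: \<rho> s)
  case (For x b c)
  then have "forloop (\<lambda>i. hrun c (\<rho>(x := i))) n s a = s a" for n by (induction n) auto
  then show ?case by simp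
qed auto

lemma ccost_le:
  assumes "\<And>a. a \<in> cbounds c \<Longrightarrow> \<beta> a \<le> X"
  shows "ccost c \<beta> \<le> csize c * Suc X ^ cdepth c"
  using assms
proof (induction c)
  case (As a i e)
  then have "xcost i \<beta> \<le> xsize i * Suc X ^ xdepth i" "xcost e \<beta> \<le> xsize e * Suc X ^ xdepth e"
    by (simp_all add: xcost_le)
  then have "xcost i \<beta> \<le> xsize i * Suc X ^ cdepth (As a i e)" "xcost e \<beta> \<le> xsize e * Suc X ^ cdepth (As a i e)"
    by (auto elim!: power_bound_mono)
  from add_bound[OF this, of 5] show ?case by simp
next
  case (Sq e f)
  then have "ccost e \<beta> \<le> csize e * Suc X ^ cdepth e" "ccost f \<beta> \<le> csize f * Suc X ^ cdepth f"
    by simp_all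
  then have "ccost e \<beta> \<le> csize e * Suc X ^ cdepth (Sq e f)" "ccost f \<beta> \<le> csize f * Suc X ^ cdepth (Sq e f)"
    by (auto elim!: power_bound_mono)
  from add_bound[OF this, of 0] show ?case by simp
next
  case (IfC e f g)
  let ?d = "cdepth (IfC e f g)"
  have "xcost e \<beta> \<le> xsize e * Suc X ^ xdepth e" "ccost f \<beta> \<le> csize f * Suc X ^ cdepth f"
     "ccost g \<beta> \<le> csize g * Suc X ^ cdepth g"
    using IfC by (simp_all add: xcost_le)
  then have b: "xcost e \<beta> \<le> xsize e * Suc X ^ ?d" "ccost f \<beta> \<le> csize f * Suc X ^ ?d"
    "ccost g \<beta> \<le> csize g * Suc X ^ ?d"
    by (auto elim!: power_bound_mono)
  have "xcost e \<beta> + ccost f \<beta> \<le> (xsize e + csize f) * Suc X ^ ?d"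
    using add_bound[OF b(1,2), of 0] by simp
  from add_bound[OF this b(3), of 3] show ?case by simp
next
  case (For x a c)
  then have "ccost c \<beta> \<le> csize c * Suc X ^ cdepth c" "\<beta> a \<le> X" by simp_all
  from loop_bound[OF this, of 12 9 21] show ?case by simp
qed

text \<open>A loop keeps its counter in array \<open>N\<close> and compiles its body from
  \<open>N + 1\<close> on. Disjointness of \<open>cbounds\<close> and \<open>cwrites\<close> keeps
  \<open>\<beta>\<close>, read off the initial store, valid in every pass and after every preceding
  command.\<close>

lemma ccompile_correct:
  assumes "creads c \<subseteq> {..<100}" "cbounds c \<inter> cwrites c = {}" "100 \<le> N"
    "\<And>x. 100 \<le> r x \<and> r x < N" "\<And>x. s (r x) 0 = \<rho> x"
    "\<And>a. a < 100 \<Longrightarrow> s a = \<sigma> a" "\<And>a. a \<in> cbounds c \<Longrightarrow> \<sigma> a 0 = \<beta> a"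
  shows "\<exists>t s'. exec (ccompile c r N) s t s' \<and> t \<le> ccost c \<beta> \<and>
    (\<forall>a<100. s' a = hrun c \<rho> \<sigma> a) \<and> (\<forall>a. 100 \<le> a \<longrightarrow> a < N \<longrightarrow> s' a = s a)"
  using assms
proof (induction c arbitrary: r N s \<rho> \<sigma>)
  case (As a i e)
  have "\<And>x. r x < N" using As.prems by blast
  with xcompile_correct[of i N r s \<rho> \<sigma> \<beta>] As.prems obtain t s' where 1: "exec (xcompile i r N) s t s'"
    "t \<le> xcost i \<beta>" "s' N 0 = heval i \<rho> \<sigma>" "\<forall>a<N. s' a = s a" by auto
  with xcompile_correct[of e "N + 1" r s' \<rho> \<sigma> \<beta>] As.prems \<open>\<And>x. r x < N\<close>
  obtain u s'' where 2: "exec (xcompile e r (N + 1)) s' u s''"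
    "u \<le> xcost e \<beta>" "s'' (N + 1) 0 = heval e \<rho> \<sigma>" "\<forall>a<N + 1. s'' a = s' a" 
    by (fastforce simp: less_Suc_eq)
  have a: "a < 100" using As.prems by auto
  show ?case
    unfolding ccompile.simps
    by (intro exI conjI, rule exec.Seq[OF 1(1) exec.Seq[OF 2(1) exec.Assign]]) (use 1 2 As.prems a in auto)
next
  case (Sq c d)
  from Sq.IH(1)[of N r s \<rho> \<sigma>] Sq.prems obtain t s' where 1: "exec (ccompile c r N) s t s'" "t \<le> ccost c \<beta>"
    "\<forall>a<100. s' a = hrun c \<rho> \<sigma> a" "\<forall>a. 100 \<le> a \<longrightarrow> a < N \<longrightarrow> s' a = s a" by auto
  have "hrun c \<rho> \<sigma> a 0 = \<beta> a" if "a \<in> cbounds d" for a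
  proof -
    have "a \<notin> cwrites c" using Sq.prems(2) that by auto
    then show ?thesis using Sq.prems(7)[of a] that by (simp add: hrun_frame)
  qed
  with Sq.IH(2)[of N r s' \<rho> "hrun c \<rho> \<sigma>"] Sq.prems 1 obtain u s'' where
    2: "exec (ccompile d r N) s' u s''" "u \<le> ccost d \<beta>"
    "\<forall>a<100. s'' a = hrun d \<rho> (hrun c \<rho> \<sigma>) a" "\<forall>a. 100 \<le> a \<longrightarrow> a < N \<longrightarrow> s'' a = s' a" by auto
  show ?case unfolding ccompile.simps
    by (intro exI conjI, rule exec.Seq[OF 1(1) 2(1)]) (use 1 2 in auto)
next
  case (IfC e c d)
  have "\<And>x. r x < N" using IfC.prems by blast
  with xcompile_correct[of e N r s \<rho> \<sigma> \<beta>] IfC.prems obtain t s' where 1: "exec (xcompile e r N) s t s'"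
    "t \<le> xcost e \<beta>" "s' N 0 = heval e \<rho> \<sigma>" "\<forall>a<N. s' a = s a" by auto
  have pre: "\<And>x. s' (r x) 0 = \<rho> x" "\<And>a. a < 100 \<Longrightarrow> s' a = \<sigma> a"
    using 1 IfC.prems by auto
  show ?case
  proof (cases "heval e \<rho> \<sigma> = 0")
    case True
    from IfC.IH(2)[of N r s' \<rho> \<sigma>] IfC.prems pre obtain u s'' where 2: "exec (ccompile d r N) s' u s''" "u \<le> ccost d \<beta>"
      "\<forall>a<100. s'' a = hrun d \<rho> \<sigma> a" "\<forall>a. 100 \<le> a \<longrightarrow> a < N \<longrightarrow> s'' a = s' a" by auto
    show ?thesis unfolding ccompile.simps
      by (intro exI conjI, rule exec.Seq[OF 1(1) exec.CondFalse[OF _ 2(1)]]) (use 1 2 True in auto)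
  next
    case False
    from IfC.IH(1)[of N r s' \<rho> \<sigma>] IfC.prems pre obtain u s'' where 2: "exec (ccompile c r N) s' u s''" "u \<le> ccost c \<beta>"
      "\<forall>a<100. s'' a = hrun c \<rho> \<sigma> a" "\<forall>a. 100 \<le> a \<longrightarrow> a < N \<longrightarrow> s'' a = s' a" by auto
    show ?thesis unfolding ccompile.simps
      by (intro exI conjI, rule exec.Seq[OF 1(1) exec.CondTrue[OF _ 2(1)]]) (use 1 2 False in auto)
  qed
next
  case (For x a c)
  define n where "n = \<sigma> a 0"
  have a: "a < 100" and n: "\<beta> a = n" and aw: "a \<notin> cwrites c" using For.prems by (auto simp: n_def)
  define f where "f = (\<lambda>i. hrun c (\<rho>(x := i)))"
  define body where "body = Seq (ccompile c (r(x := N)) (N + 1)) (Assign N (Const 0) (Plus (reg N) (Const 1)))"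
  have inv: "forloop f i \<sigma> b = \<sigma> b" if "b \<notin> cwrites c" for i b
    by (induction i) (auto simp: f_def hrun_frame[OF that])
  have step: "\<exists>t s'. exec body s1 t s' \<and> t \<le> ccost c \<beta> + 6 \<and> s' N 0 = i + 1 \<and>
      (\<forall>a<100. s' a = forloop f (Suc i) \<sigma> a) \<and> (\<forall>a. 100 \<le> a \<longrightarrow> a < N \<longrightarrow> s' a = s a)"
    if s1: "\<forall>a<100. s1 a = forloop f i \<sigma> a" "\<forall>a. 100 \<le> a \<longrightarrow> a < N \<longrightarrow> s1 a = s a" "s1 N 0 = i" for s1 i
  proof -
    have "100 \<le> (r(x := N)) y \<and> (r(x := N)) y < N + 1" for y
      using For.prems(3) For.prems(4)[of y] by simp
    moreover have "s1 ((r(x := N)) y) 0 = (\<rho>(x := i)) y" for y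
      using For.prems(4,5)[of y] s1 by simp
    moreover have "\<And>a. a \<in> cbounds c \<Longrightarrow> forloop f i \<sigma> a 0 = \<beta> a"
    proof -
      fix b assume b: "b \<in> cbounds c"
      then have "b \<notin> cwrites c" using For.prems(2) by auto
      then show "forloop f i \<sigma> b 0 = \<beta> b" using For.prems(7)[of b] b by (simp add: inv)
    qed
    ultimately have "\<exists>t s'. exec (ccompile c (r(x := N)) (N + 1)) s1 t s' \<and> t \<le> ccost c \<beta> \<and>
      (\<forall>a<100. s' a = hrun c (\<rho>(x := i)) (forloop f i \<sigma>) a) \<and> (\<forall>a. 100 \<le> a \<longrightarrow> a < N + 1 \<longrightarrow> s' a = s1 a)"
    proof (intro For.IH)
      show "creads c \<subseteq> {..<100}" "cbounds c \<inter> cwrites c = {}" "100 \<le> N + 1"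
        using For.prems(1-3) by auto
    qed (use s1 in simp_all)
    then obtain t s' where 1: "exec (ccompile c (r(x := N)) (N + 1)) s1 t s'" "t \<le> ccost c \<beta>"
      "\<forall>a<100. s' a = hrun c (\<rho>(x := i)) (forloop f i \<sigma>) a" "\<forall>a. 100 \<le> a \<longrightarrow> a < N + 1 \<longrightarrow> s' a = s1 a"
      by blast
    show ?thesis unfolding body_def
      by (intro exI conjI, rule exec.Seq[OF 1(1) exec_Assign_reg]) (use 1 s1 For.prems(3) in \<open>auto simp: f_def\<close>)
  qed
  have loop: "\<exists>t s'. exec (Loop (Minus (reg a) (reg N)) body) s1 t s' \<and> t \<le> j * (ccost c \<beta> + 12) + 6 \<and>
      (\<forall>a<100. s' a = forloop f n \<sigma> a) \<and> (\<forall>a. 100 \<le> a \<longrightarrow> a < N \<longrightarrow> s' a = s a)"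
    if "\<forall>a<100. s1 a = forloop f (n - j) \<sigma> a" "\<forall>a. 100 \<le> a \<longrightarrow> a < N \<longrightarrow> s1 a = s a" "s1 N 0 = n - j" "j \<le> n" for s1 j
    using that
  proof (induction j arbitrary: s1)
    case 0
    have "s1 a 0 = n" using 0 a inv[OF aw] by (simp add: n_def)
    with 0 have "eval_expr (Minus (reg a) (reg N)) s1 = 0" by simp
    from exec.LoopFalse[OF this, of body] show ?case
      by (intro exI conjI) (assumption, use 0 in auto)
  next
    case (Suc j)
    have sa: "s1 a 0 = n" using Suc.prems a inv[OF aw] by (simp add: n_def)
    from step[OF Suc.prems(1,2,3)] obtain t s' where 1: "exec body s1 t s'" "t \<le> ccost c \<beta> + 6"
      "s' N 0 = n - Suc j + 1" "\<forall>a<100. s' a = forloop f (Suc (n - Suc j)) \<sigma> a"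
      "\<forall>a. 100 \<le> a \<longrightarrow> a < N \<longrightarrow> s' a = s a"
      by blast
    have "Suc (n - Suc j) = n - j" using Suc.prems by simp
    then have "\<exists>u s''. exec (Loop (Minus (reg a) (reg N)) body) s' u s'' \<and> u \<le> j * (ccost c \<beta> + 12) + 6 \<and>
      (\<forall>a<100. s'' a = forloop f n \<sigma> a) \<and> (\<forall>a. 100 \<le> a \<longrightarrow> a < N \<longrightarrow> s'' a = s a)"
      using 1 Suc.prems(4) by (intro Suc.IH) (simp_all del: forloop.simps)
    then obtain u s'' where
      2: "exec (Loop (Minus (reg a) (reg N)) body) s' u s''" "u \<le> j * (ccost c \<beta> + 12) + 6"
      "\<forall>a<100. s'' a = forloop f n \<sigma> a" "\<forall>a. 100 \<le> a \<longrightarrow> a < N \<longrightarrow> s'' a = s a"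
      by blast
    show ?case
      by (intro exI conjI, rule exec.LoopTrue[OF _ 1(1) 2(1)]) (use sa Suc.prems 1 2 in auto)
  qed
  define s1 where "s1 = s(N := (s N)(0 := 0))"
  obtain t s' where 3: "exec (Loop (Minus (reg a) (reg N)) body) s1 t s'" "t \<le> n * (ccost c \<beta> + 12) + 6"
      "\<forall>a<100. s' a = forloop f n \<sigma> a" "\<forall>a. 100 \<le> a \<longrightarrow> a < N \<longrightarrow> s' a = s a"
    using loop[of s1 n] For.prems by (auto simp: s1_def)
  have e1: "exec (Assign N (Const 0) (Const 0)) s 3 s1"
    using exec_Assign_reg[of N "Const 0" s] by (simp add: s1_def)
  show ?case unfolding ccompile.simps body_def[symmetric]
    by (intro exI conjI, rule exec.Seq[OF e1 3(1)])
      (use 3 n in \<open>auto simp: f_def n_def[symmetric]\<close>)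
qed

section \<open>Minimal dominating sets and twins\<close>

definition hit :: "'a set \<Rightarrow> ('a \<Rightarrow> 'a set) \<Rightarrow> 'a set \<Rightarrow> bool" where
  "hit V N D \<longleftrightarrow> (\<forall>v\<in>V. N v \<inter> D \<noteq> {})"

text \<open>Minimality is expressed by private neighbourhoods, which is the form that all exchange
  arguments and the program need; \<open>mds_iff_minimal\<close> gives the agreement with minimality
  under inclusion.\<close>

definition mds :: "'a set \<Rightarrow> ('a \<Rightarrow> 'a set) \<Rightarrow> 'a set \<Rightarrow> bool" where
  "mds V N D \<longleftrightarrow> D \<subseteq> V \<and> hit V N D \<and> (\<forall>u\<in>D. \<exists>v\<in>V. N v \<inter> D = {u})"

definition mds_structure ::
  "nat \<Rightarrow> 'a set \<Rightarrow> ('a \<Rightarrow> 'a set) \<Rightarrow> ('a \<Rightarrow> nat) \<Rightarrow> nat \<Rightarrow> bool" where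
  "mds_structure k V N w t \<longleftrightarrow> t \<ge> 1 \<and> (\<forall>v\<in>V. w v \<in> {1..k}) \<and>
     (\<forall>D. D \<subseteq> V \<longrightarrow> (mds V N D \<longleftrightarrow> sum w D = t))"

definition keq :: "nat \<Rightarrow> 'a set \<Rightarrow> ('a \<Rightarrow> 'a set) \<Rightarrow> bool" where
  "keq k V N \<longleftrightarrow> (\<exists>w t. mds_structure k V N w t)"

definition minimal_nbhd :: "'a set \<Rightarrow> ('a \<Rightarrow> 'a set) \<Rightarrow> 'a \<Rightarrow> bool" where
  "minimal_nbhd V N p \<longleftrightarrow> p \<in> V \<and> (\<forall>q\<in>V. N q \<subseteq> N p \<longrightarrow> N q = N p)"

text \<open>Phrased through mds rather than neighbourhoods, so that equal weights yield twins at
  once; \<open>twin_iff_swap\<close> supplies a form that can be computed.\<close>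

definition twin :: "'a set \<Rightarrow> ('a \<Rightarrow> 'a set) \<Rightarrow> 'a \<Rightarrow> 'a \<Rightarrow> bool" where
  "twin V N u v \<longleftrightarrow> (\<forall>D. u \<in> D \<longrightarrow> v \<notin> D \<longrightarrow> (mds V N D \<longleftrightarrow> mds V N (insert v (D - {u}))))"

locale neighbourhoods =
  fixes V :: "'a set" and N :: "'a \<Rightarrow> 'a set"
  assumes finite_V: "finite V"
    and N_subset: "v \<in> V \<Longrightarrow> N v \<subseteq> V"
    and N_refl: "v \<in> V \<Longrightarrow> v \<in> N v"
    and N_sym: "u \<in> V \<Longrightarrow> v \<in> V \<Longrightarrow> u \<in> N v \<Longrightarrow> v \<in> N u"
begin

section \<open>Private neighbourhoods and duality between mds and neighbourhoods\<close>

lemma finite_N: "v \<in> V \<Longrightarrow> finite (N v)"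
  using N_subset finite_V finite_subset by blast

lemma mdsD: "mds V N D \<Longrightarrow> D \<subseteq> V" "mds V N D \<Longrightarrow> v \<in> V \<Longrightarrow> N v \<inter> D \<noteq> {}"
  "mds V N D \<Longrightarrow> finite D"
  using finite_V by (auto simp: mds_def hit_def dest: finite_subset)

lemma mds_iff_minimal:
  "mds V N D \<longleftrightarrow> D \<subseteq> V \<and> hit V N D \<and> \<not> (\<exists>D'. D' \<subset> D \<and> hit V N D')"
proof (intro iffI conjI)
  assume m: "mds V N D"
  then show "D \<subseteq> V" "hit V N D" by (auto simp: mds_def)
  show "\<not> (\<exists>D'. D' \<subset> D \<and> hit V N D')"
  proof
    assume "\<exists>D'. D' \<subset> D \<and> hit V N D'"
    then obtain D' u where D': "D' \<subset> D" "hit V N D'" "u \<in> D" "u \<notin> D'" by blast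
    then have "\<exists>v\<in>V. N v \<inter> D = {u}" using m by (simp add: mds_def)
    then obtain v where "v \<in> V" "N v \<inter> D = {u}" by blast
    moreover have "N v \<inter> D' \<subseteq> N v \<inter> D" using D'(1) by blast
    ultimately have "N v \<inter> D' = {}" using D'(4) by auto
    then show False using D'(2) \<open>v \<in> V\<close> by (auto simp: hit_def)
  qed
next
  assume a: "D \<subseteq> V \<and> hit V N D \<and> \<not> (\<exists>D'. D' \<subset> D \<and> hit V N D')"
  have "\<exists>v\<in>V. N v \<inter> D = {u}" if "u \<in> D" for u
  proof -
    have "D - {u} \<subset> D" using that by blast
    then have "\<not> hit V N (D - {u})" using a by blast
    then obtain v where v: "v \<in> V" "N v \<inter> (D - {u}) = {}" by (auto simp: hit_def)
    moreover have "N v \<inter> D \<noteq> {}" using a v by (auto simp: hit_def)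
    ultimately have "N v \<inter> D = {u}" using that by auto
    then show ?thesis using v by blast
  qed
  then show "mds V N D" using a by (auto simp: mds_def)
qed

lemma hit_contains_mds:
  assumes "X \<subseteq> V" "hit V N X"
  shows "\<exists>D\<subseteq>X. mds V N D"
proof -
  let ?S = "{D. D \<subseteq> X \<and> hit V N D}"
  have "finite ?S" using assms finite_V by (auto intro: finite_subset[of _ "Pow X"] finite_subset)
  moreover have "X \<in> ?S" using assms by simp
  ultimately obtain D where "D \<in> ?S" "\<forall>B\<in>?S. B \<subseteq> D \<longrightarrow> D = B"
    using finite_has_minimal[of ?S] by blast
  then have "mds V N D" unfolding mds_iff_minimal using assms by blast
  then show ?thesis using \<open>D \<in> ?S\<close> by blast
qed

lemma hit_V: "hit V N V"
  using N_refl by (auto simp: hit_def)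

lemma exists_mds: "\<exists>D. mds V N D"
  using hit_contains_mds hit_V by blast

text \<open>Transversal duality: if no neighbourhood lies inside \<open>X\<close>, the complement of
  \<open>X\<close> hits all of them and contains an mds avoiding \<open>X\<close>.\<close>

lemma meets_all_mds_contains_nbhd:
  assumes "\<And>D. mds V N D \<Longrightarrow> D \<inter> X \<noteq> {}"
  shows "\<exists>v\<in>V. N v \<subseteq> X"
proof (rule ccontr)
  assume "\<not> ?thesis"
  then have "N v \<inter> (V - X) \<noteq> {}" if "v \<in> V" for v
    using N_subset[OF that] that by auto
  then have "hit V N (V - X)" by (simp add: hit_def)
  then obtain D where "D \<subseteq> V - X" "mds V N D" using hit_contains_mds[of "V - X"] by blast
  then show False using assms by blast
qed

lemma exists_minimal_nbhd:
  assumes "v \<in> V"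
  shows "\<exists>p. minimal_nbhd V N p \<and> N p \<subseteq> N v"
proof -
  let ?S = "N ` {p\<in>V. N p \<subseteq> N v}"
  have "finite ?S" "?S \<noteq> {}" using assms finite_V by auto
  from finite_has_minimal[OF this] obtain B where "B \<in> ?S" "\<forall>C\<in>?S. C \<subseteq> B \<longrightarrow> B = C"
    by (elim bexE)
  then obtain p where p: "p \<in> V" "N p \<subseteq> N v" "\<forall>C\<in>?S. C \<subseteq> N p \<longrightarrow> N p = C" by auto
  have "N q = N p" if "q \<in> V" "N q \<subseteq> N p" for q
  proof -
    have "N q \<in> ?S" using that p(2) by auto
    then show ?thesis using p(3) that(2) by auto
  qed
  then show ?thesis using p by (auto simp: minimal_nbhd_def)
qed

lemma minimal_nbhdD: "minimal_nbhd V N p \<Longrightarrow> p \<in> V"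
  "minimal_nbhd V N p \<Longrightarrow> q \<in> V \<Longrightarrow> N q \<subseteq> N p \<Longrightarrow> N q = N p"
  by (auto simp: minimal_nbhd_def)

lemma in_minimal_nbhd:
  assumes "v \<in> V"
  shows "\<exists>p. minimal_nbhd V N p \<and> v \<in> N p"
proof -
  obtain p where p: "minimal_nbhd V N p" "N p \<subseteq> N v" using exists_minimal_nbhd[OF assms] by blast
  then have "p \<in> N v" using N_refl minimal_nbhdD(1) by blast
  then have "v \<in> N p" using N_sym p minimal_nbhdD(1) assms by blast
  then show ?thesis using p by blast
qed

text \<open>By minimality no neighbourhood fits into \<open>N p - {u}\<close>, so removing this set
  from \<open>V\<close> still leaves a hitting set; an mds inside it can meet \<open>N p\<close>
  only in \<open>u\<close>.\<close>

lemma minimal_nbhd_private: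
  assumes "minimal_nbhd V N p" "u \<in> N p"
  shows "\<exists>D. mds V N D \<and> D \<inter> N p = {u}"
proof -
  have "hit V N (V - (N p - {u}))"
    unfolding hit_def
  proof
    fix q assume q: "q \<in> V"
    show "N q \<inter> (V - (N p - {u})) \<noteq> {}"
    proof
      assume "N q \<inter> (V - (N p - {u})) = {}"
      then have "N q \<subseteq> N p - {u}" using N_subset[OF q] by blast
      then show False using minimal_nbhdD(2)[OF assms(1) q] assms(2) by blast
    qed
  qed
  then obtain D where D: "D \<subseteq> V - (N p - {u})" "mds V N D" using hit_contains_mds[of "V - (N p - {u})"] by blast
  then have "D \<inter> N p \<noteq> {}" using mdsD(2) minimal_nbhdD(1)[OF assms(1)] by blast
  then have "D \<inter> N p = {u}" using D by blast
  then show ?thesis using D by blast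
qed

lemma in_some_mds: "v \<in> V \<Longrightarrow> \<exists>D. mds V N D \<and> v \<in> D"
  using in_minimal_nbhd minimal_nbhd_private by blast

text \<open>A minimal neighbourhood inside a private one must still be hit, hence in the same single
  vertex.\<close>

lemma mds_private_minimal:
  assumes "mds V N D" "u \<in> D"
  shows "\<exists>p. minimal_nbhd V N p \<and> N p \<inter> D = {u}"
proof -
  obtain v where v: "v \<in> V" "N v \<inter> D = {u}" using assms by (auto simp: mds_def)
  obtain p where p: "minimal_nbhd V N p" "N p \<subseteq> N v" using exists_minimal_nbhd v by blast
  then have "N p \<inter> D \<noteq> {}" using mdsD(2)[OF assms(1)] minimal_nbhdD(1) by blast
  then have "N p \<inter> D = {u}" using p v by auto
  then show ?thesis using p by auto
qed

lemma hit_iff_minimal: "hit V N D \<longleftrightarrow> (\<forall>p. minimal_nbhd V N p \<longrightarrow> N p \<inter> D \<noteq> {})"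
  using exists_minimal_nbhd minimal_nbhdD(1) unfolding hit_def by blast

text \<open>Let \<open>N q\<close> be private to \<open>p\<close>. Symmetry puts \<open>q\<close>
  into \<open>N p\<close>, hence into \<open>D\<close>; as \<open>q\<close> lies in its own
  neighbourhood, it must be \<open>p\<close>.\<close>

lemma mds_contains_nbhd:
  assumes "mds V N D" "p \<in> V" "N p \<subseteq> D"
  shows "N p = {p}"
proof -
  have "p \<in> D" using assms N_refl by blast
  then obtain q where q: "q \<in> V" "N q \<inter> D = {p}" using assms(1) by (auto simp: mds_def)
  then have "q \<in> N p" using N_sym assms(2) by blast
  then have "q \<in> N q \<inter> D" using assms(3) N_refl q by blast
  then have "q = p" using q by blast
  then show ?thesis using q assms(3) by blast
qed

lemma in_all_mds_isolated:
  assumes "\<And>D. mds V N D \<Longrightarrow> v \<in> D"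
  shows "v \<in> V \<and> N v = {v}"
proof -
  obtain u where "u \<in> V" "N u \<subseteq> {v}" using meets_all_mds_contains_nbhd[of "{v}"] assms by blast
  then show ?thesis using N_refl by blast
qed

lemma isolated_in_mds: "v \<in> V \<Longrightarrow> N v = {v} \<Longrightarrow> mds V N D \<Longrightarrow> v \<in> D"
  using mdsD(2)[of D v] by auto

section \<open>Twins as an equivalence and their description by exchanged neighbourhoods\<close>

lemma twin_sym: "twin V N u v \<Longrightarrow> twin V N v u"
  unfolding twin_def
proof (intro allI impI)
  fix D assume t: "\<forall>D. u \<in> D \<longrightarrow> v \<notin> D \<longrightarrow> (mds V N D \<longleftrightarrow> mds V N (insert v (D - {u})))" and D: "v \<in> D" "u \<notin> D"
  have "insert v (insert u (D - {v}) - {u}) = D" using D by blast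
  then show "mds V N D \<longleftrightarrow> mds V N (insert u (D - {v}))" using t[rule_format, of "insert u (D - {v})"] D by auto
qed

lemma twin_refl: "twin V N u u" by (simp add: twin_def)

text \<open>The definition only trades a member for a nonmember. Hence \<open>v\<close> is traded
  for \<open>x\<close> first if \<open>v\<close> is in \<open>D\<close>, and \<open>u\<close> for
  \<open>v\<close> first otherwise.\<close>

lemma twin_trans:
  assumes "twin V N u v" "twin V N v x"
  shows "twin V N u x"
  unfolding twin_def
proof (intro allI impI)
  fix D assume D: "u \<in> D" "x \<notin> D"
  note t1 = assms(1)[unfolded twin_def, rule_format] and t2 = assms(2)[unfolded twin_def, rule_format]
  show "mds V N D \<longleftrightarrow> mds V N (insert x (D - {u}))"
  proof (cases "v \<in> D")
    case False
    then have "v \<noteq> u" using D by auto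
    then have "mds V N D \<longleftrightarrow> mds V N (insert v (D - {u}))" using t1 D False by blast
    also have "\<dots> \<longleftrightarrow> mds V N (insert x (insert v (D - {u}) - {v}))"
    proof (cases "x = v")
      case True
      then show ?thesis using False by simp
    next
      case xv: False
      then show ?thesis using D by (intro t2) auto
    qed
    also have "insert x (insert v (D - {u}) - {v}) = insert x (D - {u})" using False D by auto
    finally show ?thesis .
  next
    case True
    have "mds V N D \<longleftrightarrow> mds V N (insert x (D - {v}))" using t2 D True by blast
    also have "\<dots> \<longleftrightarrow> mds V N (insert x (D - {u}))"
    proof (cases "u = v")
      case False
      then have "mds V N (insert x (D - {v})) \<longleftrightarrow> mds V N (insert v (insert x (D - {v}) - {u}))"
        using D True by (intro t1) auto
      also have "insert v (insert x (D - {v}) - {u}) = insert x (D - {u})" using False D True by auto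
      finally show ?thesis .
    qed simp
    finally show ?thesis .
  qed
qed

lemma twinD: "twin V N u v \<Longrightarrow> mds V N D \<Longrightarrow> u \<in> D \<Longrightarrow> v \<notin> D \<Longrightarrow> mds V N (insert v (D - {u}))"
  by (auto simp: twin_def)

text \<open>An mds avoiding the swapped set would contain \<open>u\<close> but not \<open>v\<close>,
  and exchanging them would leave \<open>N p\<close> unhit. So every mds meets the swapped set,
  which by duality contains a minimal neighbourhood; swapping back and minimality of
  \<open>N p\<close> turn the inclusion into equality.\<close>

lemma minimal_nbhd_swap:
  assumes tw: "twin V N u v" and V: "u \<in> V" "v \<in> V" and p: "minimal_nbhd V N p" "u \<in> N p" "v \<notin> N p"
  shows "\<exists>q. minimal_nbhd V N q \<and> N q = insert v (N p - {u})"
proof -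
  have *: "\<exists>q. minimal_nbhd V N q \<and> N q \<subseteq> insert v (N p - {u})"
    if tw: "twin V N u v" and V: "u \<in> V" "v \<in> V" and p: "minimal_nbhd V N p" "u \<in> N p" "v \<notin> N p" for u v p
  proof -
    have "D \<inter> insert v (N p - {u}) \<noteq> {}" if D: "mds V N D" for D
    proof
      assume e: "D \<inter> insert v (N p - {u}) = {}"
      moreover have "N p \<inter> D \<noteq> {}" using mdsD(2)[OF D minimal_nbhdD(1)[OF p(1)]] .
      ultimately have "u \<in> D" "v \<notin> D" by auto
      then have "mds V N (insert v (D - {u}))" using twinD tw D by blast
      then have "N p \<inter> insert v (D - {u}) \<noteq> {}" using mdsD(2) minimal_nbhdD(1)[OF p(1)] by blast
      then show False using e p by blast
    qed
    then obtain r where r: "r \<in> V" "N r \<subseteq> insert v (N p - {u})"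
      using meets_all_mds_contains_nbhd[of "insert v (N p - {u})"] by blast
    then show ?thesis using exists_minimal_nbhd[OF r(1)] by blast
  qed
  obtain q where q: "minimal_nbhd V N q" "N q \<subseteq> insert v (N p - {u})" using * assms by blast
  have "v \<in> N q"
  proof (rule ccontr)
    assume "v \<notin> N q"
    then have "N q \<subseteq> N p - {u}" using q by blast
    then show False using minimal_nbhdD(2)[OF p(1)] minimal_nbhdD(1)[OF q(1)] p(2) by blast
  qed
  moreover have "u \<notin> N q" using q p by auto
  ultimately obtain r where r: "minimal_nbhd V N r" "N r \<subseteq> insert u (N q - {v})"
    using *[OF twin_sym[OF tw] V(2,1) q(1)] by blast
  have "insert u (N q - {v}) \<subseteq> N p" using q p by auto
  then have "N r \<subseteq> N p" using r by blast
  then have "N r = N p" using minimal_nbhdD(2)[OF p(1) minimal_nbhdD(1)[OF r(1)]] by blast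
  then have "N p \<subseteq> insert u (N q - {v})" using r by blast
  then have "insert v (N p - {u}) \<subseteq> N q" using \<open>v \<in> N q\<close> by blast
  then show ?thesis using q by blast
qed

text \<open>This replaces the quantifier over all sets \<open>D\<close> by one over neighbourhoods,
  which a program can test. For the converse, a minimal neighbourhood witnessing a failure or a
  private vertex is carried over to the exchanged set, swapped where necessary.\<close>

lemma twin_iff_swap:
  assumes V: "u \<in> V" "v \<in> V"
  shows "twin V N u v \<longleftrightarrow> (\<forall>p. minimal_nbhd V N p \<longrightarrow>
    (u \<in> N p \<longrightarrow> v \<notin> N p \<longrightarrow> (\<exists>q. minimal_nbhd V N q \<and> N q = insert v (N p - {u}))) \<and>
    (v \<in> N p \<longrightarrow> u \<notin> N p \<longrightarrow> (\<exists>q. minimal_nbhd V N q \<and> N q = insert u (N p - {v}))))"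
    (is "_ \<longleftrightarrow> ?R")
proof
  assume "twin V N u v"
  then show ?R using minimal_nbhd_swap twin_sym V by metis
next
  assume R: ?R
  have *: "mds V N (insert v (D - {u}))"
    if sw: "\<And>p. minimal_nbhd V N p \<Longrightarrow> u \<in> N p \<Longrightarrow> v \<notin> N p \<Longrightarrow> \<exists>q. minimal_nbhd V N q \<and> N q = insert v (N p - {u})"
      "\<And>p. minimal_nbhd V N p \<Longrightarrow> v \<in> N p \<Longrightarrow> u \<notin> N p \<Longrightarrow> \<exists>q. minimal_nbhd V N q \<and> N q = insert u (N p - {v})"
      and v: "v \<in> V" and D: "mds V N D" "u \<in> D" "v \<notin> D" for u v D
  proof -
    let ?D = "insert v (D - {u})"
    have "u \<noteq> v" using D by auto
    have "N p \<inter> ?D \<noteq> {}" if p: "minimal_nbhd V N p" for p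
    proof
      assume e: "N p \<inter> ?D = {}"
      moreover have ne: "N p \<inter> D \<noteq> {}" using mdsD(2)[OF D(1) minimal_nbhdD(1)[OF p]] .
      ultimately have "u \<in> N p" "v \<notin> N p" by auto
      from sw(1)[OF p this] obtain q where q: "minimal_nbhd V N q" "N q = insert v (N p - {u})" by blast
      have "N q \<inter> D = {}" using q e D by auto
      then show False using mdsD(2)[OF D(1) minimal_nbhdD(1)[OF q(1)]] by blast
    qed
    then have "hit V N ?D" using hit_iff_minimal by blast
    moreover have "\<exists>q. minimal_nbhd V N q \<and> N q \<inter> ?D = {z}" if z: "z \<in> ?D" for z
    proof (cases "z = v")
      case True
      obtain p where p: "minimal_nbhd V N p" "N p \<inter> D = {u}" using mds_private_minimal D by blast
      show ?thesis
      proof (cases "v \<in> N p")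
        case True
        then have "N p \<inter> ?D = {z}" using p \<open>z = v\<close> by auto
        then show ?thesis using p by blast
      next
        case False
        obtain q where q: "minimal_nbhd V N q" "N q = insert v (N p - {u})" using sw(1)[OF p(1)] p False by blast
        then have "N q \<inter> ?D = {z}" using p \<open>z = v\<close> by auto
        then show ?thesis using q by blast
      qed
    next
      case False
      then have z: "z \<in> D" "z \<noteq> u" using z by auto
      then obtain p where p: "minimal_nbhd V N p" "N p \<inter> D = {z}" using mds_private_minimal[OF D(1) z(1)] by blast
      have u: "u \<notin> N p"
      proof
        assume "u \<in> N p"
        then have "u \<in> {z}" using D(2) unfolding p(2)[symmetric] by simp
        then show False using z(2) by simp
      qed
      show ?thesis
      proof (cases "v \<in> N p")
        case True
        obtain q where q: "minimal_nbhd V N q" "N q = insert u (N p - {v})" using sw(2)[OF p(1)] u True by blast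
        then have "N q \<inter> ?D = {z}" using p z D(3) \<open>z \<noteq> v\<close> \<open>u \<noteq> v\<close> by auto
        then show ?thesis using q by blast
      next
        case False
        then have "N p \<inter> ?D = {z}" using p z by auto
        then show ?thesis using p by blast
      qed
    qed
    ultimately show ?thesis using mdsD(1)[OF D(1)] v minimal_nbhdD(1) unfolding mds_def by blast
  qed
  show "twin V N u v" unfolding twin_def
  proof (intro allI impI iffI)
    fix D assume D: "u \<in> D" "v \<notin> D"
    { assume "mds V N D"
      then show "mds V N (insert v (D - {u}))" using R V D by (intro *) auto
    next
      assume m: "mds V N (insert v (D - {u}))"
      have "insert u (insert v (D - {u}) - {v}) = D" "u \<noteq> v" using D by auto
      moreover have "mds V N (insert u (insert v (D - {u}) - {v}))" using R V D \<open>u \<noteq> v\<close> by (intro *[OF _ _ _ m]) auto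
      ultimately show "mds V N D" by simp
    }
  qed
qed

text \<open>The exchange leaves the weight of the set unchanged, and the weight alone decides
  whether it is an mds.\<close>

lemma structure_twin:
  assumes "mds_structure k V N w t" "u \<in> V" "v \<in> V" "w u = w v"
  shows "twin V N u v"
  unfolding twin_def
proof (intro allI impI)
  fix D assume D: "u \<in> D" "v \<notin> D"
  show "mds V N D \<longleftrightarrow> mds V N (insert v (D - {u}))"
  proof (cases "D \<subseteq> V")
    case True
    then have f: "finite D" using finite_V finite_subset by blast
    have "sum w (insert v (D - {u})) = sum w D"
      using D f assms(4) by (simp add: sum.remove)
    moreover have "insert v (D - {u}) \<subseteq> V" using True assms by blast
    ultimately show ?thesis using assms(1) True by (auto simp: mds_structure_def)
  next
    case False
    then have "\<not> insert v (D - {u}) \<subseteq> V" using assms(2) by blast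
    then show ?thesis using False mdsD(1) by blast
  qed
qed

lemma mds_swap_sets:
  assumes "mds_structure k V N w t" "mds V N D" "X \<subseteq> D" "Y \<subseteq> V" "Y \<inter> D = {}" "sum w X = sum w Y"
  shows "mds V N (D - X \<union> Y)"
proof -
  have f: "finite D" "finite X" "finite Y"
    using mdsD(3)[OF assms(2)] finite_subset[OF assms(3)] finite_subset[OF assms(4) finite_V] by auto
  have "sum w (D - X \<union> Y) = sum w (D - X) + sum w Y" using f assms by (intro sum.union_disjoint) auto
  also have "\<dots> = sum w D" using f assms(3,6) sum.subset_diff[of X D w] by simp
  finally have "sum w (D - X \<union> Y) = sum w D" .
  moreover have "D \<subseteq> V" using mdsD(1)[OF assms(2)] .
  moreover from this have "sum w D = t" using assms(1,2) unfolding mds_structure_def by blast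
  moreover have "D - X \<union> Y \<subseteq> V" using assms(4) \<open>D \<subseteq> V\<close> by blast
  ultimately show ?thesis using assms(1) by (auto simp: mds_structure_def)
qed

end

section \<open>Bounding the target and removing isolated vertices\<close>

text \<open>Binomial coefficients increase up to the middle; beyond it, symmetry replaces
  \<open>m\<close> by \<open>s - m\<close>, which is still at least 2.\<close>

lemma choose_two_le:
  assumes "2 \<le> m" "m + 2 \<le> s"
  shows "s choose 2 \<le> s choose m"
proof (cases "2 * m \<le> s")
  case True
  then show ?thesis using assms binomial_mono[of 2 m s] by simp
next
  case False
  then have "s choose 2 \<le> s choose (s - m)" using assms by (intro binomial_mono) auto
  then show ?thesis using assms binomial_symmetric[of m s] by simp
qed

context neighbourhoods
begin

lemma structureD:
  assumes "mds_structure k V N w t"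
  shows "v \<in> V \<Longrightarrow> 1 \<le> w v" "v \<in> V \<Longrightarrow> w v \<le> k" "1 \<le> t"
    "D \<subseteq> V \<Longrightarrow> mds V N D \<longleftrightarrow> sum w D = t" "mds V N D \<Longrightarrow> sum w D = t"
  using assms mdsD(1)[of D] unfolding mds_structure_def by auto

lemma sum_weight_class: "X \<subseteq> {v \<in> U. w v = b} \<Longrightarrow> sum w X = card X * (b :: nat)"
  by (subst sum.cong[of X X w "\<lambda>_. b"]) auto

lemma card_le_classes:
  fixes w :: "'a \<Rightarrow> nat"
  assumes "finite X" "\<And>v. v \<in> X \<Longrightarrow> w v \<in> {1..k}" "\<And>b. b \<in> {1..k} \<Longrightarrow> card {v \<in> X. w v = b} \<le> m"
  shows "card X \<le> k * m"
proof -
  have "X = (\<Union>b\<in>{1..k}. {v \<in> X. w v = b})" using assms(2) by auto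
  then have "card X \<le> (\<Sum>b\<in>{1..k}. card {v \<in> X. w v = b})"
    using card_UN_le[of "{1..k}" "\<lambda>b. {v \<in> X. w v = b}"] by simp
  also have "\<dots> \<le> k * m" using sum_bounded_above[of "{1..k}" _ m] assms(3) by simp
  finally show ?thesis .
qed

lemma sum_weight_le:
  assumes "mds_structure k V N w t" "X \<subseteq> V"
  shows "sum w X \<le> k * card X"
  using sum_bounded_above[of X w k] structureD(2)[OF assms(1)] assms(2) by (auto simp: mult.commute)

text \<open>
  If some mds contains \<open>x\<close> elements of \<open>A\<close>, where \<open>3 \<le> x < s\<close>, then the complements in \<open>A\<close> of the
  closed neighbourhoods include all \<open>x - 1\<close>-subsets of \<open>A\<close>.
\<close>

lemma no_middle:
  assumes st: "mds_structure k V N w t" and A: "A = {v \<in> V. w v = a}" and s: "s = card A" "card V \<le> k * s" "2 * k + 2 \<le> s"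
    and D: "mds V N D" "3 \<le> card (D \<inter> A)"
  shows "card (D \<inter> A) = s"
proof (rule ccontr)
  assume ne: "card (D \<inter> A) \<noteq> s"
  define x where "x = card (D \<inter> A)"
  have fA: "finite A" using A finite_V by simp
  have xs: "x < s" using ne s(1) card_mono[OF fA, of "D \<inter> A"] by (simp add: x_def)
  define R where "R = D - A"
  \<comment> \<open>All vertices of \<open>A\<close> weigh the same, so \<open>R\<close> completed
    by any \<open>x\<close> of them has the weight of \<open>D\<close>.\<close>
  have swap: "mds V N (R \<union> X)" if "X \<subseteq> A" "card X = x" for X
  proof -
    have f: "finite D" "finite X" using mdsD(3)[OF D(1)] finite_subset[OF that(1) fA] by auto
    have R: "R \<union> X \<subseteq> V" using mdsD(1)[OF D(1)] that A by (auto simp: R_def)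
    have "sum w (R \<union> X) = sum w R + sum w X" using f that by (intro sum.union_disjoint) (auto simp: R_def)
    also have "sum w X = sum w (D \<inter> A)"
      using sum_weight_class[of X V w a] sum_weight_class[of "D \<inter> A" V w a] that A by (auto simp: x_def)
    also have "sum w R + sum w (D \<inter> A) = sum w D"
      using f sum.Int_Diff[of D w A] by (simp add: R_def)
    finally show ?thesis using structureD(4)[OF st R] structureD(5)[OF st D(1)] by simp
  qed
  \<comment> \<open>A private neighbourhood of \<open>u\<close> in
    \<open>R \<union> insert u C\<close> misses \<open>R\<close> and \<open>C\<close>. It must still
    hit \<open>R \<union> insert v C\<close> for every other \<open>v\<close>, so it contains all of
    \<open>A - C\<close>.\<close>
  have ex: "\<exists>p\<in>V. A - N p = C" if C: "C \<subseteq> A" "card C = x - 1" for C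
  proof -
    have "card C < card A" using C xs s by simp
    then have "\<exists>u. u \<in> A - C" using C by (metis DiffI less_irrefl subsetI subset_antisym)
    then obtain u where u: "u \<in> A" "u \<notin> C" by auto
    have fC: "finite C" using C fA finite_subset by blast
    have x1: "x \<ge> 1" using D(2) by (simp add: x_def)
    have m: "mds V N (R \<union> insert u C)" using C u fC x1 by (intro swap) auto
    have "u \<in> R \<union> insert u C" by simp
    then obtain p where p: "p \<in> V" "N p \<inter> (R \<union> insert u C) = {u}" using m by (auto simp: mds_def)
    have "v \<in> N p" if v: "v \<in> A" "v \<notin> C" for v
    proof -
      have "mds V N (R \<union> insert v C)" using C v fC x1 by (intro swap) auto
      then have "N p \<inter> (R \<union> insert v C) \<noteq> {}" using mdsD(2) p(1) by auto
      moreover have "N p \<inter> R = {}" "N p \<inter> C = {}" using p(2) u by (auto simp: R_def)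
      ultimately show ?thesis by auto
    qed
    moreover have "c \<notin> N p" if "c \<in> C" for c
    proof
      assume "c \<in> N p"
      then have "c \<in> {u}" using that unfolding p(2)[symmetric] by simp
      then show False using that u by simp
    qed
    ultimately have "A - N p = C" using C by auto
    then show ?thesis using p(1) by blast
  qed
  have "{C. C \<subseteq> A \<and> card C = x - 1} \<subseteq> (\<lambda>p. A - N p) ` V"
  proof
    fix C assume "C \<in> {C. C \<subseteq> A \<and> card C = x - 1}"
    then obtain p where "p \<in> V" "A - N p = C" using ex[of C] by auto
    then show "C \<in> (\<lambda>p. A - N p) ` V" by auto
  qed
  then have "card {C. C \<subseteq> A \<and> card C = x - 1} \<le> card V"
    using finite_V by (meson card_image_le card_mono finite_imageI le_trans)
  then have "s choose (x - 1) \<le> k * s" using n_subsets[OF fA, of "x - 1"] s by simp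
  moreover have "s choose 2 \<le> s choose (x - 1)"
    using xs D(2) unfolding x_def[symmetric] by (intro choose_two_le) auto
  ultimately have "s choose 2 \<le> k * s" by linarith
  \<comment> \<open>The binomial coefficient is an integer division by 2, whence the
    \<open>+ 1\<close> in the next inequality.\<close>
  moreover have "s * (s - 1) \<ge> s * (2 * k + 1)" using s by (intro mult_le_mono) auto
  ultimately have "s * (2 * k + 1) \<le> 2 * (k * s) + 1" unfolding choose_two by linarith
  then show False using s(3) by (simp add: algebra_simps)
qed

lemma largest_class:
  assumes st: "mds_structure k V N w t" and "1 \<le> k"
  obtains a where "a \<in> {1..k}" "card V \<le> k * card {v \<in> V. w v = a}"
proof -
  let ?f = "\<lambda>b. card {v \<in> V. w v = b}"
  have "Max (?f ` {1..k}) \<in> ?f ` {1..k}" using assms(2) by (intro Max_in) auto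
  then obtain a where a: "a \<in> {1..k}" "?f a = Max (?f ` {1..k})" by auto
  have "?f b \<le> ?f a" if "b \<in> {1..k}" for b using a that by simp
  then have "card V \<le> k * ?f a"
    using structureD(1,2)[OF st] by (intro card_le_classes[of V w]) (auto simp: finite_V)
  then show ?thesis using a that by blast
qed

lemma target_le:
  assumes st: "mds_structure k V N w t" and k: "1 \<le> k" and J: "card {v \<in> V. N v = {v}} \<le> J"
  shows "t \<le> k * k * (J + k ^ 3 + 3 * k + 3)"
proof -
  obtain a where a: "a \<in> {1..k}" "card V \<le> k * card {v \<in> V. w v = a}"
    using largest_class[OF st k] by blast
  define A where "A = {v \<in> V. w v = a}"
  define s where "s = card A"
  have fA: "finite A" "A \<subseteq> V" using finite_V by (auto simp: A_def)
  have Vs: "card V \<le> k * s" using a by (simp add: s_def A_def)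
  have wr: "\<And>v. v \<in> V \<Longrightarrow> w v \<in> {1..k}" using structureD(1,2)[OF st] by simp
  show ?thesis
  proof (cases "s \<le> J + k ^ 3 + 3 * k + 3")
    case True
    obtain D where D: "mds V N D" using exists_mds by blast
    have "t = sum w D" using structureD(5)[OF st D] by simp
    also have "\<dots> \<le> k * card D" using sum_weight_le[OF st] mdsD(1)[OF D] .
    also have "\<dots> \<le> k * (k * s)" using card_mono[OF finite_V mdsD(1)[OF D]] Vs by (intro mult_left_mono) auto
    also have "\<dots> \<le> k * (k * (J + k ^ 3 + 3 * k + 3))" using True by (intro mult_left_mono) auto
    finally show ?thesis by (simp add: mult.assoc)
  next
    case False
    \<comment> \<open>\<open>s\<close> now exceeds three quantities at once: \<open>J\<close> for
      the isolated vertices, \<open>k ^ 3\<close> for the weight outside an mds, and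
      \<open>3 * k + 2\<close> for the counts after an exchange.\<close>
    then have s: "J + k ^ 3 + 3 * k + 3 < s" by simp
    have mid: "card (D \<inter> A) = s" if "mds V N D" "3 \<le> card (D \<inter> A)" for D
      using no_middle[OF st A_def s_def Vs _ that] s by simp
    show ?thesis
    proof (cases "\<exists>D. mds V N D \<and> 1 \<le> card (D \<inter> A) \<and> card (D \<inter> A) \<le> 2")
      case True
      then obtain D where D: "mds V N D" "1 \<le> card (D \<inter> A)" "card (D \<inter> A) \<le> 2" by blast
      have fD: "finite D" using mdsD(3)[OF D(1)] .
      \<comment> \<open>Otherwise \<open>3 * a\<close> vertices of weight \<open>b\<close> could be
        traded for \<open>3 * b\<close> of weight \<open>a\<close>, bringing the count in
        \<open>A\<close> to a value between 4 and \<open>3 * k + 2\<close>, which \<open>mid\<close>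
        forbids. The factor 3 lifts the count above 2.\<close>
      have cl: "card {v \<in> D. w v = b} \<le> 3 * k" if b: "b \<in> {1..k}" for b
      proof (cases "b = a")
        case True
        have "{v \<in> D. w v = b} = D \<inter> A" using mdsD(1)[OF D(1)] True by (auto simp: A_def)
        then show ?thesis using D k by simp
      next
        case False
        have "card {v \<in> D. w v = b} < 3 * a"
        proof (rule ccontr)
          assume "\<not> ?thesis"
          then have "3 * a \<le> card {v \<in> D. w v = b}" by simp
          then obtain X where X: "X \<subseteq> {v \<in> D. w v = b}" "card X = 3 * a"
            by (meson obtain_subset_with_card_n)
          have "card (A - D) = s - card (D \<inter> A)"
            using fA fD by (simp add: s_def card_Diff_subset_Int Int_commute)
          moreover have "card (D \<inter> A) + 3 * b \<le> s" using D(3) s b by (intro order_trans[OF _ less_imp_le[OF s]]) auto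
          ultimately have "3 * b \<le> card (A - D)" by simp
          then obtain Y where Y: "Y \<subseteq> A - D" "card Y = 3 * b"
            by (meson obtain_subset_with_card_n)
          have "Y \<subseteq> {v \<in> V. w v = a}" using Y by (auto simp: A_def)
          from sum_weight_class[OF this] have "sum w X = sum w Y"
            using sum_weight_class[OF X(1)] X(2) Y(2) by simp
          then have m: "mds V N (D - X \<union> Y)" using X Y fA by (intro mds_swap_sets[OF st D(1)]) auto
          have "(D - X \<union> Y) \<inter> A = (D \<inter> A) \<union> Y" using X Y False by (auto simp: A_def)
          moreover have "card ((D \<inter> A) \<union> Y) = card (D \<inter> A) + card Y"
            using Y fD fA finite_subset[of Y A] by (intro card_Un_disjoint) auto
          ultimately have "card ((D - X \<union> Y) \<inter> A) = card (D \<inter> A) + 3 * b" using Y by simp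
          then show False using mid[OF m] D s b by simp
        qed
        then show ?thesis using a by simp
      qed
      have "card D \<le> k * (3 * k)" using fD wr mdsD(1)[OF D(1)] cl by (intro card_le_classes[of D w]) auto
      then have "t \<le> k * (k * (3 * k))"
        using sum_weight_le[OF st mdsD(1)[OF D(1)]] structureD(5)[OF st D(1)]
        by (meson le_trans mult_le_mono2 eq_imp_le)
      also have "\<dots> \<le> k * (k * (J + k ^ 3 + 3 * k + 3))" by (intro mult_left_mono) auto
      finally show ?thesis by (simp add: mult.assoc)
    next
      case False
      have "A \<noteq> {}" using s s_def by auto
      then obtain v where v: "v \<in> A" by auto
      then obtain D where D: "mds V N D" "v \<in> D" using in_some_mds[of v] fA by auto
      have fD: "finite D" using mdsD(3)[OF D(1)] .
      have "card (D \<inter> A) \<noteq> 0" using D v fD by auto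
      then have "card (D \<inter> A) = s" using False D mid[OF D(1)] by (metis One_nat_def Suc_leI gr0I not_less_eq_eq numeral_2_eq_2 numeral_3_eq_3)
      then have AD: "A \<subseteq> D" using fA card_subset_eq[of A "D \<inter> A"] by (auto simp: s_def)
      \<comment> \<open>The exchange now goes the other way: giving up \<open>b\<close> vertices of
        \<open>A\<close> for \<open>a\<close> outside vertices of weight \<open>b\<close> would
        leave \<open>s - b\<close> in \<open>A\<close>, which is at least 3 but not all.\<close>
      have cl: "card {v \<in> V - D. w v = b} \<le> k" if b: "b \<in> {1..k}" for b
      proof (rule ccontr)
        assume "\<not> ?thesis"
        then have "a \<le> card {v \<in> V - D. w v = b}" using a by simp
        then obtain Y where Y: "Y \<subseteq> {v \<in> V - D. w v = b}" "card Y = a"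
          by (meson obtain_subset_with_card_n)
        have "b \<le> card A" using s b by (simp add: s_def)
        then obtain X where X: "X \<subseteq> A" "card X = b"
          by (meson obtain_subset_with_card_n)
        have "Y \<subseteq> {v \<in> V. w v = b}" using Y by auto
        from sum_weight_class[OF this] have "sum w X = sum w Y"
          using sum_weight_class[of X V w a] X Y by (auto simp: A_def)
        then have m: "mds V N (D - X \<union> Y)" using X Y AD by (intro mds_swap_sets[OF st D(1)]) auto
        show False
        proof (cases "b = a")
          case True
          then have "Y \<subseteq> A - D" using Y by (auto simp: A_def)
          then have "Y = {}" using AD by auto
          then show False using Y(2) a by simp
        next
          case ba: False
          then have "(D - X \<union> Y) \<inter> A = A - X" using AD Y by (auto simp: A_def)
          then have "card ((D - X \<union> Y) \<inter> A) = s - b"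
            using X fA finite_subset[of X A] by (simp add: card_Diff_subset s_def)
          moreover have "b + 3 \<le> s" using b by (intro order_trans[OF _ less_imp_le[OF s]]) auto
          ultimately have c: "3 \<le> card ((D - X \<union> Y) \<inter> A)" "card ((D - X \<union> Y) \<inter> A) \<noteq> s"
            using b unfolding atLeastAtMost_iff by linarith+
          show False using mid[OF m c(1)] c(2) by contradiction
        qed
      qed
      have "card (V - D) \<le> k * k"
        using wr cl finite_V by (intro card_le_classes[of _ w]) auto
      then have "k * card (V - D) \<le> k * (k * k)" by (rule mult_le_mono2)
      moreover have "sum w (V - D) \<le> k * card (V - D)" by (rule sum_weight_le[OF st]) auto
      ultimately have "sum w (V - D) \<le> k * (k * k)" by (rule order_trans[rotated])
      then have wVD: "sum w (V - D) \<le> k ^ 3" by (simp add: power3_eq_cube mult.assoc)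
      \<comment> \<open>An mds disjoint from \<open>A\<close> would have to replace the weight of
        \<open>A\<close>, at least \<open>s > k ^ 3\<close>, by vertices outside \<open>D\<close>,
        which weigh at most \<open>k ^ 3\<close> together.\<close>
      have all: "A \<subseteq> D2" if D2: "mds V N D2" for D2
      proof (cases "card (D2 \<inter> A) = 0")
        case True
        have fD2: "finite D2" using mdsD(3)[OF D2] .
        then have e: "D2 \<inter> A = {}" using True by auto
        have "sum w D2 = sum w (D2 \<inter> D) + sum w (D2 - D)" using fD2 by (simp add: sum.Int_Diff[of D2 w D])
        moreover have "sum w (D2 - D) \<le> sum w (V - D)" using mdsD(1)[OF D2] finite_V by (intro sum_mono2) auto
        moreover have "sum w (D2 \<inter> D) + sum w A = sum w (D2 \<inter> D \<union> A)"
          using fD2 fA e by (intro sum.union_disjoint[symmetric]) auto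
        moreover have "sum w (D2 \<inter> D \<union> A) \<le> sum w D" using fD AD by (intro sum_mono2) auto
        moreover have "sum w A = s * a" using sum_weight_class[of A V w a] by (simp add: A_def s_def)
        moreover have "s * 1 \<le> s * a" using a by (intro mult_le_mono2) simp
        ultimately have "s \<le> k ^ 3" using structureD(5)[OF st D(1)] structureD(5)[OF st D2] wVD by linarith
        then show ?thesis using s by simp
      next
        case c: False
        then have "card (D2 \<inter> A) = s" using False D2 mid[OF D2] by (metis One_nat_def Suc_leI gr0I not_less_eq_eq numeral_2_eq_2 numeral_3_eq_3)
        then show ?thesis using fA card_subset_eq[of A "D2 \<inter> A"] by (auto simp: s_def)
      qed
      have "A \<subseteq> {v \<in> V. N v = {v}}" using all in_all_mds_isolated by fastforce
      then have "s \<le> J" using J card_mono[of "{v \<in> V. N v = {v}}" A] finite_V by (simp add: s_def)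
      then show ?thesis using s by simp
    qed
  qed
qed

text \<open>Trading isolated vertices of weight \<open>a\<close> for vertices outside an mds would
  lose isolated vertices, so fewer than \<open>a\<close> vertices of each weight lie outside any
  mds. Two mds that share only isolated vertices then bound all nonisolated vertices by the union of
  the two complements.\<close>

lemma many_isolated:
  assumes st: "mds_structure k V N w t" and I: "I = {v \<in> V. N v = {v}}" and card: "card I > 2 * k ^ 4"
  shows "sum w (V - I) \<le> 2 * k ^ 3" and "\<exists>a\<in>{1..k}. card {v \<in> I. w v = a} > 2 * k ^ 3"
proof -
  have wr: "\<And>v. v \<in> V \<Longrightarrow> w v \<in> {1..k}" using structureD(1,2)[OF st] by simp
  have fI: "finite I" "I \<subseteq> V" using I finite_V by auto
  show ex: "\<exists>a\<in>{1..k}. card {v \<in> I. w v = a} > 2 * k ^ 3"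
  proof (rule ccontr)
    assume "\<not> ?thesis"
    then have "card I \<le> k * (2 * k ^ 3)" using fI wr by (intro card_le_classes[of I w]) (auto simp: not_less)
    also have "k * (2 * k ^ 3) = 2 * k ^ 4" by (simp add: power_numeral_reduce)
    finally show False using card by simp
  qed
  then obtain a where a: "a \<in> {1..k}" "card {v \<in> I. w v = a} > 2 * k ^ 3" by blast
  have k: "1 \<le> k" using a by simp
  have ID: "I \<subseteq> D" if "mds V N D" for D using isolated_in_mds[OF _ _ that] I by auto
  have cd: "card (V - D) \<le> k * k" if D: "mds V N D" for D
  proof -
    have "card {v \<in> V - D. w v = b} \<le> k" if b: "b \<in> {1..k}" for b
    proof (rule ccontr)
      assume "\<not> ?thesis"
      then have "a \<le> card {v \<in> V - D. w v = b}" using a by simp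
      then obtain Y where Y: "Y \<subseteq> {v \<in> V - D. w v = b}" "card Y = a"
        by (meson obtain_subset_with_card_n)
      have "k \<le> k ^ 3" using k by (simp add: self_le_power)
      then have "b \<le> card {v \<in> I. w v = a}" using a b by simp
      then obtain X where X: "X \<subseteq> {v \<in> I. w v = a}" "card X = b"
        by (meson obtain_subset_with_card_n)
      have XD: "X \<subseteq> I" "X \<subseteq> D" using X ID[OF D] by auto
      have "Y \<subseteq> {v \<in> V. w v = b}" using Y by auto
      from sum_weight_class[OF this] have "sum w X = sum w Y"
        using sum_weight_class[OF X(1)] X(2) Y(2) by simp
      then have m: "mds V N (D - X \<union> Y)" using XD Y by (intro mds_swap_sets[OF st D(1)]) auto
      have "X \<noteq> {}" using X b by auto
      then obtain x where "x \<in> X" by auto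
      then have "x \<in> D - X \<union> Y" using ID[OF m] XD by auto
      then show False using \<open>x \<in> X\<close> XD Y by auto
    qed
    then show ?thesis using wr finite_V by (intro card_le_classes[of _ w]) auto
  qed
  obtain D where D: "mds V N D" using exists_mds by blast
  \<comment> \<open>An mds contains a whole neighbourhood only at an isolated vertex; hence the
    complement of \<open>D\<close> hits all the others and yields the second mds.\<close>
  have "hit V N (I \<union> (V - D))" unfolding hit_def
  proof
    fix v assume v: "v \<in> V"
    show "N v \<inter> (I \<union> (V - D)) \<noteq> {}"
    proof
      assume e: "N v \<inter> (I \<union> (V - D)) = {}"
      then have "N v \<subseteq> D" using N_subset[OF v] by auto
      then have "N v = {v}" using mds_contains_nbhd[OF D v] by simp
      then have "v \<in> N v \<inter> I" using v I by simp
      then show False using e by auto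
    qed
  qed
  then obtain D' where D': "D' \<subseteq> I \<union> (V - D)" "mds V N D'"
    using hit_contains_mds[of "I \<union> (V - D)"] fI by auto
  have "V - I \<subseteq> (V - D) \<union> (V - D')" using D' by auto
  then have "card (V - I) \<le> card ((V - D) \<union> (V - D'))" using finite_V by (intro card_mono) auto
  also have "\<dots> \<le> card (V - D) + card (V - D')" by (rule card_Un_le)
  also have "\<dots> \<le> 2 * (k * k)" using cd[OF D] cd[OF D'(2)] by simp
  finally have "k * card (V - I) \<le> k * (2 * (k * k))" by (rule mult_le_mono2)
  moreover have "sum w (V - I) \<le> k * card (V - I)" by (rule sum_weight_le[OF st]) auto
  ultimately have "sum w (V - I) \<le> k * (2 * (k * k))" by (rule order_trans[rotated])
  then show "sum w (V - I) \<le> 2 * k ^ 3" by (simp add: power3_eq_cube)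
qed

section \<open>Deleting and restoring isolated vertices\<close>

context
  fixes I1 K
  assumes I1: "I1 \<subseteq> V" "\<And>v. v \<in> I1 \<Longrightarrow> N v = {v}" and K: "K = V - I1"
begin

lemma N_subset_K: "v \<in> K \<Longrightarrow> N v \<subseteq> K"
proof
  fix u assume a: "v \<in> K" "u \<in> N v"
  then have "u \<in> V" "v \<in> N u" using N_subset N_sym K by (blast, metis DiffD1 N_subset N_sym subsetD)
  then show "u \<in> K" using I1 a K by (metis DiffD2 DiffI singletonD)
qed

lemma neighbourhoods_K: "neighbourhoods K N"
  using finite_V N_refl N_sym N_subset_K unfolding K by unfold_locales auto

lemma mds_remove_isolated:
  "mds V N D \<longleftrightarrow> I1 \<subseteq> D \<and> mds K N (D - I1)"
proof -
  have i: "N v \<inter> X = N v \<inter> (X - I1)" if "v \<in> K" for v X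
    using N_subset_K[OF that] K by auto
  have V: "V = I1 \<union> K" using I1 K by auto
  have "hit V N D \<longleftrightarrow> I1 \<subseteq> D \<and> hit K N (D - I1)"
    unfolding hit_def V using i[of _ D] I1(2) by (auto simp: ball_Un)
  moreover have "(\<forall>u\<in>D. \<exists>v\<in>V. N v \<inter> D = {u}) \<longleftrightarrow> (\<forall>u\<in>D - I1. \<exists>v\<in>K. N v \<inter> (D - I1) = {u})"
    if h: "I1 \<subseteq> D"
  proof
    assume l: "\<forall>u\<in>D. \<exists>v\<in>V. N v \<inter> D = {u}"
    show "\<forall>u\<in>D - I1. \<exists>v\<in>K. N v \<inter> (D - I1) = {u}"
    proof
      fix u assume u: "u \<in> D - I1"
      then obtain v where v: "v \<in> V" "N v \<inter> D = {u}" using l by auto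
      then have "v \<in> K" using I1(2)[of v] u V by auto
      then show "\<exists>v\<in>K. N v \<inter> (D - I1) = {u}" using i[of v D] v by auto
    qed
  next
    assume r: "\<forall>u\<in>D - I1. \<exists>v\<in>K. N v \<inter> (D - I1) = {u}"
    show "\<forall>u\<in>D. \<exists>v\<in>V. N v \<inter> D = {u}"
    proof
      fix u assume u: "u \<in> D"
      show "\<exists>v\<in>V. N v \<inter> D = {u}"
      proof (cases "u \<in> I1")
        case True
        then show ?thesis using I1 u by (intro bexI[of _ u]) auto
      next
        case False
        then obtain v where "v \<in> K" "N v \<inter> (D - I1) = {u}" using r u by auto
        then show ?thesis using i[of v D] V by (intro bexI[of _ v]) auto
      qed
    qed
  qed
  moreover have "D \<subseteq> V \<longleftrightarrow> D - I1 \<subseteq> K" using V I1 by auto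
  ultimately show ?thesis unfolding mds_def by blast
qed

text \<open>The target drops by the weight of \<open>I1\<close>. The isolated vertex
  \<open>i\<close> that remains lies in every mds and keeps the new target positive.\<close>

lemma keq_remove_isolated:
  assumes ke: "keq k V N" and i: "i \<in> K" "N i = {i}"
  shows "keq k K N"
proof -
  obtain w t where st: "mds_structure k V N w t" using ke by (auto simp: keq_def)
  have fI: "finite I1" using I1 finite_V finite_subset by blast
  interpret K: neighbourhoods K N by (rule neighbourhoods_K)
  have eq: "mds K N D \<longleftrightarrow> sum w D + sum w I1 = t" if "D \<subseteq> K" for D
  proof -
    have "finite D" using that K finite_V finite_subset by blast
    then have "sum w (D \<union> I1) = sum w D + sum w I1" using that K fI by (intro sum.union_disjoint) auto
    moreover have "D \<union> I1 - I1 = D" "D \<union> I1 \<subseteq> V" using that K I1 by auto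
    ultimately show ?thesis using structureD(4)[OF st, of "D \<union> I1"] mds_remove_isolated[of "D \<union> I1"] by simp
  qed
  obtain M where M: "mds K N M" using K.exists_mds by blast
  have "i \<in> M" using K.isolated_in_mds[OF i M] .
  then have "w i \<le> sum w M" using K.mdsD(3)[OF M] by (simp add: member_le_sum)
  moreover have "1 \<le> w i" using structureD(1)[OF st] i K by simp
  moreover have "sum w M + sum w I1 = t" using eq[OF K.mdsD(1)[OF M]] M by simp
  ultimately have t: "t - sum w I1 \<ge> 1" by simp
  have "mds_structure k K N w (t - sum w I1)"
    unfolding mds_structure_def
  proof (intro conjI allI impI ballI)
    show "1 \<le> t - sum w I1" by fact
    show "w v \<in> {1..k}" if "v \<in> K" for v using structureD(1,2)[OF st, of v] that K by simp
    show "mds K N D \<longleftrightarrow> sum w D = t - sum w I1" if "D \<subseteq> K" for D using eq[OF that] t by auto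
  qed
  then show ?thesis by (auto simp: keq_def)
qed

text \<open>The new vertices receive a weight \<open>a\<close> shared by more than
  \<open>2 * k ^ 3\<close> old isolated vertices, and the target grows accordingly. The danger is a
  set that omits \<open>j\<close> new vertices and makes up for \<open>a * j\<close> elsewhere; it
  is excluded by comparing \<open>j\<close> with the number of its vertices in
  \<open>A\<close>.\<close>

lemma keq_add_isolated:
  assumes ke: "keq k K N" and card: "card {v \<in> K. N v = {v}} > 2 * k ^ 4"
  shows "keq k V N"
proof -
  obtain w t where st: "mds_structure k K N w t" using ke by (auto simp: keq_def)
  have fI: "finite I1" using I1 finite_V finite_subset by blast
  interpret K: neighbourhoods K N by (rule neighbourhoods_K)
  define I where "I = {v \<in> K. N v = {v}}"
  define R where "R = K - I"
  have R: "sum w R \<le> 2 * k ^ 3" using K.many_isolated(1)[OF st I_def] card by (simp add: I_def R_def)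
  obtain a where a: "a \<in> {1..k}" "card {v \<in> I. w v = a} > 2 * k ^ 3"
    using K.many_isolated(2)[OF st I_def] card by (auto simp: I_def)
  define A where "A = {v \<in> I. w v = a}"
  have fin: "finite I" "finite A" "I \<subseteq> K" "A \<subseteq> I" using K.finite_V by (auto simp: I_def A_def)
  have ID: "I \<subseteq> D" if "mds K N D" for D using K.isolated_in_mds[OF _ _ that] I_def by auto
  obtain M where M: "mds K N M" using K.exists_mds by blast
  define w' where "w' = (\<lambda>v. if v \<in> I1 then a else w v)"
  define t' where "t' = t + a * card I1"
  have "mds V N D \<longleftrightarrow> sum w' D = t'" if D: "D \<subseteq> V" for D
  proof -
    define D1 where "D1 = D - I1"
    define j where "j = card (I1 - D)"
    have fD: "finite D" "finite D1" "D1 \<subseteq> K" using D finite_V finite_subset by (auto simp: D1_def K)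
    have "sum w' D = sum w' (D \<inter> I1) + sum w' D1" using sum.Int_Diff[OF fD(1), of w' I1] by (simp add: D1_def)
    also have "sum w' (D \<inter> I1) = a * card (D \<inter> I1)" by (simp add: w'_def)
    also have "sum w' D1 = sum w D1" by (intro sum.cong) (auto simp: w'_def D1_def)
    finally have sw: "sum w' D = a * card (D \<inter> I1) + sum w D1" .
    have "card I1 = card (D \<inter> I1) + j"
      using fI card_Int_Diff[of I1 D] by (simp add: j_def Int_commute)
    then have cI: "a * card I1 = a * card (D \<inter> I1) + a * j" by (simp add: distrib_left)
    have "I1 \<subseteq> D \<longleftrightarrow> j = 0" using fI by (auto simp: j_def)
    moreover have "mds K N D1 \<longleftrightarrow> sum w D1 = t" using K.structureD(4)[OF st fD(3)] .
    moreover have "j = 0" if e: "sum w D1 = t + a * j"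
    proof (rule ccontr)
      assume j: "j \<noteq> 0"
      define q where "q = card (D1 \<inter> A)"
      show False
      proof (cases "j \<le> q")
        case True
        \<comment> \<open>Dropping \<open>j\<close> vertices of \<open>A\<close> restores the weight
          \<open>t\<close>, so the rest would be an mds that lacks isolated vertices.\<close>
        then obtain X where X: "X \<subseteq> D1 \<inter> A" "card X = j"
          unfolding q_def by (meson obtain_subset_with_card_n)
        have sX: "sum w X = j * a" using X K.sum_weight_class[of X I w a] by (auto simp: A_def)
        have "X \<subseteq> D1" using X by auto
        then have "sum w D1 = sum w (D1 - X) + sum w X" using fD(2) by (rule sum.subset_diff)
        then have "sum w (D1 - X) = t" using sX e by simp
        then have "mds K N (D1 - X)" using K.structureD(4)[OF st, of "D1 - X"] fD by auto
        then have "I \<subseteq> D1 - X" by (rule ID)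
        then have "X = {}" using X fin by auto
        then show False using X j by simp
      next
        case False
        have "sum w D1 = sum w (D1 \<inter> I) + sum w (D1 - I)" using fD(2) by (simp add: sum.Int_Diff[of D1 w I])
        moreover have "sum w (D1 - I) \<le> sum w R" using fD K.finite_V by (intro sum_mono2) (auto simp: R_def)
        moreover have "sum w (D1 \<inter> I \<union> (A - D1)) = sum w (D1 \<inter> I) + sum w (A - D1)"
          using fD fin by (intro sum.union_disjoint) auto
        moreover have "sum w (D1 \<inter> I \<union> (A - D1)) \<le> sum w M"
          using ID[OF M] fin K.mdsD(3)[OF M] by (intro sum_mono2) auto
        moreover have "sum w M = t" using K.structureD(5)[OF st M] .
        moreover have "sum w (A - D1) = card (A - D1) * a"
          using K.sum_weight_class[of "A - D1" I w a] by (auto simp: A_def)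
        ultimately have "a * j + card (A - D1) * a \<le> 2 * k ^ 3" using e R by linarith
        moreover have "card A = q + card (A - D1)" using fin card_Int_Diff[of A D1] by (simp add: q_def Int_commute)
        ultimately have "a * (j + (card A - q)) \<le> 2 * k ^ 3" by (simp add: algebra_simps)
        moreover have "1 * (j + (card A - q)) \<le> a * (j + (card A - q))" using a by (intro mult_le_mono1) simp
        moreover have "card A \<le> j + (card A - q)" using False by simp
        ultimately have "card A \<le> 2 * k ^ 3" by (metis le_trans mult_1)
        then show False using a by (simp add: A_def)
      qed
    qed
    ultimately show ?thesis using sw cI unfolding mds_remove_isolated[of D] D1_def[symmetric] t'_def by fastforce
  qed
  moreover have "w' v \<in> {1..k}" if "v \<in> V" for v
    using K.structureD(1,2)[OF st, of v] that a by (auto simp: w'_def K)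
  moreover have "1 \<le> t'" using K.structureD(3)[OF st] by (simp add: t'_def)
  ultimately have "mds_structure k V N w' t'" by (simp add: mds_structure_def)
  then show ?thesis by (auto simp: keq_def)
qed

end

end

section \<open>A finite search criterion\<close>

lemma rank_bij_betw:
  fixes C :: "nat set"
  assumes "finite C"
  shows "bij_betw (\<lambda>u. card {x \<in> C. x < u}) C {..<card C}"
proof -
  let ?r = "\<lambda>u. card {x \<in> C. x < u}"
  have lt: "?r u < ?r v" if "u \<in> C" "u < v" for u v
    using that assms by (intro psubset_card_mono) auto
  have "inj_on ?r C"
  proof (rule inj_onI)
    fix u v assume "u \<in> C" "v \<in> C" "?r u = ?r v"
    then show "u = v" using lt[of u v] lt[of v u] by (cases u v rule: linorder_cases) auto
  qed
  moreover have "?r ` C \<subseteq> {..<card C}"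
    using assms by (auto intro!: psubset_card_mono)
  ultimately show ?thesis
    unfolding bij_betw_def using card_image[of ?r C] card_subset_eq[of "{..<card C}" "?r ` C"] by simp
qed

lemma card_rank_less:
  fixes C :: "nat set"
  assumes "finite C" "y \<le> card C"
  shows "card {u \<in> C. card {x \<in> C. x < u} < y} = y"
proof -
  let ?r = "\<lambda>u. card {x \<in> C. x < u}"
  have b: "bij_betw ?r C {..<card C}" using rank_bij_betw[OF assms(1)] .
  have "?r ` {u \<in> C. ?r u < y} = {..<y}"
  proof
    show "{..<y} \<subseteq> ?r ` {u \<in> C. ?r u < y}"
    proof
      fix j assume j: "j \<in> {..<y}"
      then have "j \<in> ?r ` C" using b assms(2) unfolding bij_betw_def by auto
      then obtain u where "u \<in> C" "j = ?r u" by blast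
      then show "j \<in> ?r ` {u \<in> C. ?r u < y}" using j by blast
    qed
  qed auto
  moreover have "inj_on ?r {u \<in> C. ?r u < y}" using b unfolding bij_betw_def by (auto intro: inj_on_subset)
  ultimately show ?thesis using card_image by fastforce
qed

lemma partition_with_cards:
  assumes "finite B" "finite C" "card C = sum m B"
  shows "\<exists>f. (\<forall>v\<in>C. f v \<in> B) \<and> (\<forall>b\<in>B. card {v \<in> C. f v = b} = m b)"
  using assms
proof (induction B arbitrary: C rule: finite_induct)
  case (insert b B)
  then have "m b \<le> card C" by simp
  then obtain X where X: "X \<subseteq> C" "card X = m b" by (meson obtain_subset_with_card_n)
  then have "card (C - X) = sum m B" using insert finite_subset[of X C] by (simp add: card_Diff_subset)
  then obtain f where f: "\<forall>v\<in>C - X. f v \<in> B" "\<forall>b\<in>B. card {v \<in> C - X. f v = b} = m b"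
    using insert.IH[of "C - X"] insert.prems by auto
  let ?f = "\<lambda>v. if v \<in> X then b else f v"
  have "{v \<in> C. ?f v = b} = X" using X f(1) insert.hyps by auto
  moreover have "{v \<in> C. ?f v = c} = {v \<in> C - X. f v = c}" if "c \<in> B" for c using that insert.hyps by auto
  ultimately have "\<forall>c\<in>insert b B. card {v \<in> C. ?f v = c} = m c" using f(2) X(2) by simp
  moreover have "\<forall>v\<in>C. ?f v \<in> insert b B" using f(1) by auto
  ultimately show ?case by (intro exI[of _ ?f] conjI)
qed auto

section \<open>Twin classes and codes of weight functions\<close>

definition twin_class :: "'a set \<Rightarrow> ('a \<Rightarrow> 'a set) \<Rightarrow> 'a \<Rightarrow> 'a set" where
  "twin_class V N v = {u \<in> V. twin V N u v}"

definition twin_rank :: "nat set \<Rightarrow> (nat \<Rightarrow> nat set) \<Rightarrow> nat \<Rightarrow> nat" where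
  "twin_rank V N v = card {u \<in> V. u < v \<and> twin V N u v}"

text \<open>This condition caps at \<open>T\<close> the number of vertices that an mds takes from
  one class, in a form that is checked on minimal neighbourhoods without enumerating mds.\<close>

definition twins_bounded :: "'a set \<Rightarrow> ('a \<Rightarrow> 'a set) \<Rightarrow> nat \<Rightarrow> bool" where
  "twins_bounded V N T \<longleftrightarrow> (\<forall>p u. minimal_nbhd V N p \<longrightarrow> u \<in> N p \<longrightarrow>
     card {z \<in> V. twin V N u z \<and> z \<notin> N p} < T)"

text \<open>
  A code assigns to the weight \<open>b + 1\<close> the twin class \<open>c b\<close> and its number \<open>m b\<close> of occurrences among
  the first \<open>T + 1\<close> members of that class; \<open>x b\<close> counts how many of these a set takes.
\<close>

definition code_ok :: "nat set \<Rightarrow> (nat \<Rightarrow> nat set) \<Rightarrow> (nat \<Rightarrow> nat) \<Rightarrow> nat \<Rightarrow> nat \<Rightarrow>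
    (nat \<Rightarrow> nat) \<Rightarrow> (nat \<Rightarrow> nat) \<Rightarrow> nat \<Rightarrow> bool" where
  "code_ok V N cl k T c m t \<longleftrightarrow>
     (\<forall>v\<in>V. (\<Sum>b<k. if c b = cl v then m b else 0) = min (T + 1) (card (twin_class V N v))) \<and>
     (\<forall>x. (\<forall>b<k. x b \<le> m b) \<longrightarrow>
       (mds V N {v \<in> V. twin_rank V N v < (\<Sum>b<k. if c b = cl v then x b else 0)} \<longleftrightarrow>
        (\<Sum>b<k. (b + 1) * x b) = t))"

text \<open>\<open>cl_less\<close> compares class numbers with the number of classes, as there is
  one vertex of rank 0 per class; with at most \<open>k \<le> T\<close> classes they become digits
  below \<open>T + 2\<close>.\<close>

locale index_neighbourhoods = neighbourhoods V N for V :: "nat set" and N +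
  fixes cl :: "nat \<Rightarrow> nat" and k T :: nat
  assumes cl: "u \<in> V \<Longrightarrow> v \<in> V \<Longrightarrow> cl u = cl v \<longleftrightarrow> twin V N u v"
    and cl_less: "v \<in> V \<Longrightarrow> cl v < card {u \<in> V. twin_rank V N u = 0}"
    and k: "1 \<le> k" "k \<le> T"
begin

abbreviation "C v \<equiv> twin_class V N v"
abbreviation "rk v \<equiv> twin_rank V N v"

lemma C_eq: "v \<in> V \<Longrightarrow> C v = {u \<in> V. cl u = cl v}"
  using cl by (auto simp: twin_class_def)

lemma finite_C: "finite (C v)" using finite_V by (simp add: twin_class_def)

lemma rk_eq:
  assumes "u \<in> V" "v \<in> V" "cl u = cl v"
  shows "rk u = card {x \<in> C v. x < u}"
proof -
  have "twin V N x u \<longleftrightarrow> cl x = cl u" if "x \<in> V" for x using cl[OF that assms(1)] by simp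
  then have "{x \<in> V. x < u \<and> twin V N x u} = {x \<in> C v. x < u}"
    unfolding C_eq[OF assms(2)] using assms(3) by auto
  then show ?thesis by (simp add: twin_rank_def)
qed

lemma card_rk_less:
  assumes "v \<in> V" "y \<le> card (C v)"
  shows "card {u \<in> C v. rk u < y} = y"
proof -
  have "{u \<in> C v. rk u < y} = {u \<in> C v. card {x \<in> C v. x < u} < y}"
    using rk_eq[OF _ assms(1)] C_eq[OF assms(1)] by auto
  then show ?thesis using card_rank_less[OF finite_C assms(2)] by simp
qed

lemma rk_less_card:
  assumes "v \<in> V"
  shows "rk v < card (C v)"
proof -
  have "v \<in> C v" using assms C_eq by simp
  moreover have "rk v = card {x \<in> C v. x < v}" using rk_eq[OF assms assms] by simp
  ultimately show ?thesis using finite_C by (auto intro!: psubset_card_mono)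
qed

text \<open>If the sets differ, some \<open>u\<close> in \<open>D - D'\<close> has a twin in
  \<open>D' - D\<close> by equality of the counts, and exchanging the two shrinks
  \<open>D - D'\<close>.\<close>

lemma class_counts_mds:
  assumes "mds V N D" "D' \<subseteq> V" "\<And>v. v \<in> V \<Longrightarrow> card (D \<inter> C v) = card (D' \<inter> C v)"
  shows "mds V N D'"
  using assms
proof (induction "card (D - D')" arbitrary: D rule: less_induct)
  case less
  have fin: "finite D" "finite D'" "D \<subseteq> V" using mdsD(1,3)[OF less.prems(1)] less.prems(2) finite_V finite_subset by auto
  show ?case
  proof (cases "D - D' = {}")
    case True
    have "v \<in> D" if v: "v \<in> D'" for v
    proof -
      have vV: "v \<in> V" using v less.prems(2) by auto
      have "D \<inter> C v = D' \<inter> C v"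
        using True less.prems(3)[OF vV] fin by (intro card_subset_eq) auto
      moreover have "v \<in> C v" using vV C_eq by simp
      ultimately show ?thesis using v by auto
    qed
    then have "D = D'" using True by auto
    then show ?thesis using less.prems by simp
  next
    case False
    then obtain u where u: "u \<in> D" "u \<notin> D'" by auto
    then have uV: "u \<in> V" using fin by auto
    have uC: "u \<in> C u" using uV C_eq by simp
    have "\<not> D' \<inter> C u \<subseteq> D \<inter> C u"
    proof
      assume s: "D' \<inter> C u \<subseteq> D \<inter> C u"
      then have "D' \<inter> C u = D \<inter> C u" using less.prems(3)[OF uV] fin by (intro card_subset_eq) auto
      then show False using u uC by auto
    qed
    then obtain v where v: "v \<in> D'" "v \<in> C u" "v \<notin> D" by auto
    have vV: "v \<in> V" "cl v = cl u" using v C_eq[OF uV] by auto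
    let ?D = "insert v (D - {u})"
    have m: "mds V N ?D" using twinD[of u v D] cl[of u v] vV uV u v less.prems(1) by simp
    have "card (?D \<inter> C x) = card (D' \<inter> C x)" if x: "x \<in> V" for x
    proof (cases "cl x = cl u")
      case True
      then have "?D \<inter> C x = insert v (D \<inter> C x - {u})" "u \<in> D \<inter> C x" using vV uV u C_eq[OF x] by auto
      then have "card (?D \<inter> C x) = card (D \<inter> C x)" using fin v card_Suc_Diff1[of "D \<inter> C x" u] by simp
      then show ?thesis using less.prems(3)[OF x] by simp
    next
      case False
      then have "?D \<inter> C x = D \<inter> C x" using vV u C_eq[OF x] by auto
      then show ?thesis using less.prems(3)[OF x] by simp
    qed
    moreover have "?D - D' \<subset> D - D'" using u v by auto
    then have "card (?D - D') < card (D - D')" using fin by (intro psubset_card_mono) auto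
    ultimately show ?thesis using less.hyps[of ?D] m less.prems(2) by blast
  qed
qed

lemma class_counts_mds_iff:
  assumes "D \<subseteq> V" "D' \<subseteq> V" "\<And>v. v \<in> V \<Longrightarrow> card (D \<inter> C v) = card (D' \<inter> C v)"
  shows "mds V N D \<longleftrightarrow> mds V N D'"
  using class_counts_mds[of D D'] class_counts_mds[of D' D] assms by auto

lemma card_eq_sum_weights:
  fixes w :: "nat \<Rightarrow> nat"
  assumes "finite X" "\<And>v. v \<in> X \<Longrightarrow> w v \<in> {1..k}"
  shows "card X = (\<Sum>b<k. card {u \<in> X. w u = b + 1})"
    and "sum w X = (\<Sum>b<k. (b + 1) * card {u \<in> X. w u = b + 1})"
proof -
  have im: "(\<lambda>u. w u - 1) ` X \<subseteq> {..<k}" using assms(2) by force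
  have e: "{u \<in> X. w u - 1 = b} = {u \<in> X. w u = b + 1}" for b using assms(2) by force
  have "(\<Sum>b<k. sum h {u \<in> X. w u = b + 1}) = sum h X" for h :: "nat \<Rightarrow> nat"
    using sum.group[OF assms(1) finite_lessThan im, of h] unfolding e .
  from this[of "\<lambda>_. 1"] this[of w] show "card X = (\<Sum>b<k. card {u \<in> X. w u = b + 1})"
    "sum w X = (\<Sum>b<k. (b + 1) * card {u \<in> X. w u = b + 1})" by (simp_all add: mult.commute)
qed

lemma class_count_eq:
  fixes w :: "nat \<Rightarrow> nat"
  assumes "X \<subseteq> V" "\<And>v. v \<in> X \<Longrightarrow> w v \<in> {1..k}" "\<And>u b. u \<in> X \<Longrightarrow> w u = b + 1 \<Longrightarrow> c b = cl u" "v \<in> V"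
  shows "(\<Sum>b<k. if c b = cl v then card {u \<in> X. w u = b + 1} else 0) = card (X \<inter> C v)"
proof -
  have fX: "finite (X \<inter> C v)" using finite_C by simp
  have "card (X \<inter> C v) = (\<Sum>b<k. card {u \<in> X \<inter> C v. w u = b + 1})"
    using assms(2) fX by (intro card_eq_sum_weights(1)) auto
  also have "\<dots> = (\<Sum>b<k. if c b = cl v then card {u \<in> X. w u = b + 1} else 0)"
  proof (intro sum.cong refl)
    fix b
    have "{u \<in> X \<inter> C v. w u = b + 1} = (if c b = cl v then {u \<in> X. w u = b + 1} else {})"
      using assms(1,3) C_eq[OF assms(4)] by auto
    then show "card {u \<in> X \<inter> C v. w u = b + 1} = (if c b = cl v then card {u \<in> X. w u = b + 1} else 0)"
      by simp
  qed
  finally show ?thesis by simp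
qed

text \<open>One vertex more is kept than an mds can take from a class. Equality of two kept weights
  is derived from an mds containing only one of the two vertices, and this needs the extra
  one.\<close>

definition "V' = {v \<in> V. rk v < T + 1}"

lemma V'_subset: "V' \<subseteq> V" by (auto simp: V'_def)

lemma card_V'_class: "v \<in> V \<Longrightarrow> card (V' \<inter> C v) = min (T + 1) (card (C v))"
proof -
  assume v: "v \<in> V"
  have "V' \<inter> C v = {u \<in> C v. rk u < T + 1}" using C_eq[OF v] by (auto simp: V'_def)
  also have "\<dots> = {u \<in> C v. rk u < min (T + 1) (card (C v))}"
  proof -
    have "rk u < card (C v)" if "u \<in> C v" for u
    proof -
      have "C u = C v" "u \<in> V" using that v C_eq by auto
      then show ?thesis using rk_less_card[of u] by simp
    qed
    then show ?thesis by auto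
  qed
  finally show ?thesis using card_rk_less[OF v, of "min (T + 1) (card (C v))"] by simp
qed

lemma prefix_class_counts:
  assumes "v \<in> V" "y (cl v) \<le> card (C v)"
  shows "card ({u \<in> V. rk u < y (cl u)} \<inter> C v) = y (cl v)"
proof -
  have "{u \<in> V. rk u < y (cl u)} \<inter> C v = {u \<in> C v. rk u < y (cl v)}" using C_eq[OF assms(1)] by auto
  then show ?thesis using card_rk_less[OF assms] by simp
qed

text \<open>Take an mds that meets \<open>N p\<close> only in \<open>u\<close>. Trading
  \<open>u\<close> for a twin outside \<open>N p\<close> would leave \<open>N p\<close> unhit, so
  all these twins lie in the mds besides \<open>u\<close>, and its size is at most its
  weight.\<close>

lemma structure_twins_bounded:
  assumes st: "mds_structure k V N w t" and t: "t \<le> T"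
  shows "twins_bounded V N T"
  unfolding twins_bounded_def
proof (intro allI impI)
  fix p u assume p: "minimal_nbhd V N p" "u \<in> N p"
  obtain D where D: "mds V N D" "D \<inter> N p = {u}" using minimal_nbhd_private[OF p] by blast
  let ?Z = "{z \<in> V. twin V N u z \<and> z \<notin> N p}"
  have uD: "u \<in> D" using D by auto
  have "z \<in> D" if z: "z \<in> ?Z" for z
  proof (rule ccontr)
    assume "z \<notin> D"
    then have m: "mds V N (insert z (D - {u}))" using twinD[of u z D] z D(1) uD by simp
    have "N p \<inter> insert z (D - {u}) = {}"
    proof -
      have "N p \<inter> (D - {u}) = {}" using D(2) by auto
      then show ?thesis using z by auto
    qed
    then show False using mdsD(2)[OF m minimal_nbhdD(1)[OF p(1)]] by simp
  qed
  then have "insert u ?Z \<subseteq> D" using uD by auto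
  then have "card (insert u ?Z) \<le> card D" using mdsD(3)[OF D(1)] by (intro card_mono)
  moreover have "card (insert u ?Z) = card ?Z + 1" using p finite_V by simp
  moreover have "card D \<le> sum w D"
    using sum_mono[of D "\<lambda>_. 1" w] structureD(1)[OF st] mdsD(1)[OF D(1)] by (auto simp: subset_iff)
  ultimately show "card ?Z < T" using structureD(5)[OF st D(1)] t by simp
qed

text \<open>Per weight, the code records the class and the number of kept vertices. Any choice of
  \<open>x b\<close> kept vertices of weight \<open>b + 1\<close> has the class counts of the prefix
  set in \<open>code_ok\<close>, so either both are mds or neither.\<close>

lemma structure_code:
  assumes st: "mds_structure k V N w t"
  shows "\<exists>c m. (\<forall>b<k. c b < T + 2 \<and> m b < T + 2) \<and> code_ok V N cl k T c m t"
proof -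
  have wr: "\<And>v. v \<in> V \<Longrightarrow> w v \<in> {1..k}" using structureD(1,2)[OF st] by simp
  have same: "cl u = cl v" if "u \<in> V" "v \<in> V" "w u = w v" for u v
    using structure_twin[OF st that] cl that by simp
  define c where "c = (\<lambda>b. if \<exists>v\<in>V. w v = b + 1 then cl (SOME v. v \<in> V \<and> w v = b + 1) else 0)"
  have c: "c b = cl u" if "u \<in> V" "w u = b + 1" for u b
  proof -
    have "\<exists>v. v \<in> V \<and> w v = b + 1" using that by blast
    then have "(SOME v. v \<in> V \<and> w v = b + 1) \<in> V \<and> w (SOME v. v \<in> V \<and> w v = b + 1) = b + 1" by (rule someI_ex)
    then have "cl (SOME v. v \<in> V \<and> w v = b + 1) = cl u" using that by (intro same) auto
    then show ?thesis using that by (auto simp: c_def)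
  qed
  \<comment> \<open>Vertices of rank 0 represent distinct classes and hence have distinct weights,
    so there are at most \<open>k\<close> classes.\<close>
  have "card {u \<in> V. rk u = 0} \<le> card {1..k}"
  proof (rule card_inj_on_le[of w])
    show "inj_on w {u \<in> V. rk u = 0}"
    proof (rule inj_onI)
      fix u v assume a: "u \<in> {u \<in> V. rk u = 0}" "v \<in> {u \<in> V. rk u = 0}" "w u = w v"
      then have "twin V N u v" "twin V N v u" using structure_twin[OF st] by auto
      moreover have "\<not> (x < y \<and> twin V N x y)" if "x \<in> V" "rk y = 0" for x y
        using that finite_V by (auto simp: twin_rank_def)
      ultimately have "\<not> u < v" "\<not> v < u" using a by auto
      then show "u = v" by simp
    qed
  qed (use wr in auto)
  then have "cl v < T + 2" if "v \<in> V" for v using cl_less[OF that] k by simp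
  then have cT: "c b < T + 2" for b
  proof (cases "\<exists>v\<in>V. w v = b + 1")
    case True
    then obtain v where "v \<in> V" "w v = b + 1" by blast
    then show ?thesis using c[of v b] \<open>\<And>v. v \<in> V \<Longrightarrow> cl v < T + 2\<close> by simp
  qed (simp add: c_def)
  define m where "m = (\<lambda>b. card {u \<in> V'. w u = b + 1})"
  have wr': "\<And>v. v \<in> V' \<Longrightarrow> w v \<in> {1..k}" and c': "\<And>u b. u \<in> V' \<Longrightarrow> w u = b + 1 \<Longrightarrow> c b = cl u"
    using wr c V'_subset by auto
  have fV': "finite V'" using finite_V V'_subset finite_subset by blast
  have sm: "(\<Sum>b<k. if c b = cl v then m b else 0) = min (T + 1) (card (C v))" if "v \<in> V" for v
    using class_count_eq[OF V'_subset, of w c v] wr' c' that card_V'_class[OF that] unfolding m_def by simp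
  have mT: "m b < T + 2" for b
  proof (cases "\<exists>v\<in>V'. w v = b + 1")
    case True
    then obtain v where v: "v \<in> V'" "w v = b + 1" by blast
    have vV: "v \<in> V" using v V'_subset by auto
    have "{u \<in> V'. w u = b + 1} \<subseteq> V' \<inter> C v"
    proof
      fix u assume u: "u \<in> {u \<in> V'. w u = b + 1}"
      then have uV: "u \<in> V" using V'_subset by auto
      have "cl u = cl v" using same[OF uV vV] u v by simp
      then show "u \<in> V' \<inter> C v" using u uV C_eq[OF vV] by simp
    qed
    then have "m b \<le> card (V' \<inter> C v)" using fV' by (auto simp: m_def intro: card_mono)
    then show ?thesis using card_V'_class[OF vV] by simp
  next
    case False
    then have e: "{u \<in> V'. w u = b + 1} = {}" by auto
    show ?thesis unfolding m_def e by simp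
  qed
  have "mds V N {v \<in> V. rk v < (\<Sum>b<k. if c b = cl v then x b else 0)} \<longleftrightarrow> (\<Sum>b<k. (b + 1) * x b) = t"
    if x: "\<forall>b<k. x b \<le> m b" for x
  proof -
    have "\<exists>X. X \<subseteq> {u \<in> V'. w u = b + 1} \<and> card X = x b" if "b < k" for b
      using x that unfolding m_def by (meson obtain_subset_with_card_n)
    then obtain X where X: "\<And>b. b < k \<Longrightarrow> X b \<subseteq> {u \<in> V'. w u = b + 1}" "\<And>b. b < k \<Longrightarrow> card (X b) = x b"
      by metis
    define D where "D = (\<Union>b<k. X b)"
    have DV: "D \<subseteq> V'" using X(1) by (auto simp: D_def)
    then have DV2: "D \<subseteq> V" "finite D" using V'_subset fV' finite_subset by auto
    have Db: "{u \<in> D. w u = b + 1} = X b" if "b < k" for b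
    proof
      show "{u \<in> D. w u = b + 1} \<subseteq> X b"
      proof
        fix u assume "u \<in> {u \<in> D. w u = b + 1}"
        then obtain b' where b': "b' < k" "u \<in> X b'" "w u = b + 1" by (auto simp: D_def)
        then have "w u = b' + 1" using X(1)[OF b'(1)] by auto
        then show "u \<in> X b" using b' by simp
      qed
      show "X b \<subseteq> {u \<in> D. w u = b + 1}" using X(1)[OF that] that by (auto simp: D_def)
    qed
    have wD: "\<And>v. v \<in> D \<Longrightarrow> w v \<in> {1..k}" and cD: "\<And>u b. u \<in> D \<Longrightarrow> w u = b + 1 \<Longrightarrow> c b = cl u"
      using wr c DV2 by auto
    have "card ({v \<in> V. rk v < (\<Sum>b<k. if c b = cl v then x b else 0)} \<inter> C v) = card (D \<inter> C v)" if v: "v \<in> V" for v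
    proof -
      have "(\<Sum>b<k. if c b = cl v then x b else 0) \<le> (\<Sum>b<k. if c b = cl v then m b else 0)"
        using x by (intro sum_mono) auto
      then have "(\<Sum>b<k. if c b = cl v then x b else 0) \<le> card (C v)" using sm[OF v] by simp
      then have "card ({v \<in> V. rk v < (\<Sum>b<k. if c b = cl v then x b else 0)} \<inter> C v)
        = (\<Sum>b<k. if c b = cl v then x b else 0)"
        using prefix_class_counts[OF v, of "\<lambda>i. \<Sum>b<k. if c b = i then x b else 0"] by simp
      also have "\<dots> = (\<Sum>b<k. if c b = cl v then card {u \<in> D. w u = b + 1} else 0)"
        using X(2) Db by (intro sum.cong) auto
      also have "\<dots> = card (D \<inter> C v)" by (rule class_count_eq[OF DV2(1) wD cD v])
      finally show ?thesis .
    qed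
    then have "mds V N {v \<in> V. rk v < (\<Sum>b<k. if c b = cl v then x b else 0)} \<longleftrightarrow> mds V N D"
      using DV2 by (intro class_counts_mds_iff) auto
    also have "\<dots> \<longleftrightarrow> sum w D = t" using structureD(4)[OF st DV2(1)] .
    also have "sum w D = (\<Sum>b<k. (b + 1) * card {u \<in> D. w u = b + 1})"
      by (rule card_eq_sum_weights(2)[OF DV2(2) wD])
    also have "\<dots> = (\<Sum>b<k. (b + 1) * x b)" using X(2) Db by (intro sum.cong) auto
    finally show ?thesis .
  qed
  then have "code_ok V N cl k T c m t" using sm unfolding code_ok_def by blast
  then show ?thesis using cT mT by blast
qed

text \<open>Each truncated class is divided among the weights according to \<open>m\<close>, which
  settles all subsets of \<open>V'\<close>. A class with dropped vertices then turns out to carry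
  one weight only, and the dropped vertices inherit it.\<close>

lemma code_structure:
  assumes tb: "twins_bounded V N T" and code: "code_ok V N cl k T c m t" and t: "1 \<le> t" "t \<le> T"
  shows "keq k V N"
proof -
  have fV': "finite V'" using finite_V V'_subset finite_subset by blast
  have sm: "(\<Sum>b<k. if c b = cl v then m b else 0) = card (V' \<inter> C v)" if "v \<in> V" for v
    using code card_V'_class[OF that] that by (simp add: code_ok_def)
  have part: "\<exists>f. (\<forall>v\<in>V' \<inter> C v0. f v \<in> {b. b < k \<and> c b = cl v0}) \<and>
      (\<forall>b\<in>{b. b < k \<and> c b = cl v0}. card {v \<in> V' \<inter> C v0. f v = b} = m b)" if "v0 \<in> V" for v0
  proof (rule partition_with_cards)
    have "(\<Sum>b<k. if c b = cl v0 then m b else 0) = sum m {b \<in> {..<k}. c b = cl v0}"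
      by (rule sum.inter_filter[symmetric]) simp
    then show "card (V' \<inter> C v0) = sum m {b. b < k \<and> c b = cl v0}" using sm[OF that] by simp
  qed (use fV' in auto)
  have "\<exists>f. \<forall>v\<in>V. cl v = i \<longrightarrow> (\<forall>u\<in>V' \<inter> C v. f u < k \<and> c (f u) = i) \<and>
      (\<forall>b. b < k \<longrightarrow> c b = i \<longrightarrow> card {u \<in> V' \<inter> C v. f u = b} = m b)" for i
  proof (cases "\<exists>v\<in>V. cl v = i")
    case True
    then obtain v0 where v0: "v0 \<in> V" "cl v0 = i" by blast
    then have Cv: "C v = C v0" if "v \<in> V" "cl v = i" for v using that by (simp add: C_eq)
    obtain f where f: "\<forall>v\<in>V' \<inter> C v0. f v \<in> {b. b < k \<and> c b = cl v0}"
      "\<forall>b\<in>{b. b < k \<and> c b = cl v0}. card {v \<in> V' \<inter> C v0. f v = b} = m b"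
      using part[OF v0(1)] by (elim exE conjE)
    show ?thesis
      by (intro exI[of _ f] ballI impI) (use f v0(2) in \<open>simp add: Cv\<close>)
  qed auto
  then obtain F where F: "\<And>v u. v \<in> V \<Longrightarrow> u \<in> V' \<inter> C v \<Longrightarrow> F (cl v) u < k \<and> c (F (cl v) u) = cl v"
    "\<And>v b. v \<in> V \<Longrightarrow> b < k \<Longrightarrow> c b = cl v \<Longrightarrow> card {u \<in> V' \<inter> C v. F (cl v) u = b} = m b"
    by metis
  define w' where "w' = (\<lambda>v. F (cl v) v + 1)"
  have inC: "v \<in> V' \<inter> C v" "v \<in> V" if "v \<in> V'" for v using that V'_subset C_eq by auto
  have wr': "w' v \<in> {1..k}" and c': "w' v = b + 1 \<Longrightarrow> c b = cl v" if "v \<in> V'" for v b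
    using F(1)[OF inC(2)[OF that] inC(1)[OF that]] by (auto simp: w'_def)
  have cw: "card {u \<in> V'. w' u = b + 1} = m b" if "b < k" "v \<in> V" "c b = cl v" for b v
  proof -
    have "{u \<in> V'. w' u = b + 1} = {u \<in> V' \<inter> C v. F (cl v) u = b}"
    proof (intro set_eqI iffI)
      fix u assume u: "u \<in> {u \<in> V'. w' u = b + 1}"
      then have "cl u = cl v" using c'[of u b] that(3) by simp
      then show "u \<in> {u \<in> V' \<inter> C v. F (cl v) u = b}" using u V'_subset that(2) by (auto simp: C_eq w'_def)
    next
      fix u assume "u \<in> {u \<in> V' \<inter> C v. F (cl v) u = b}"
      then show "u \<in> {u \<in> V'. w' u = b + 1}" using that(2) by (auto simp: C_eq w'_def)
    qed
    then show ?thesis using F(2)[OF that(2,1,3)] by simp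
  qed
  have st': "mds V N D \<longleftrightarrow> sum w' D = t" if D: "D \<subseteq> V'" for D
  proof -
    have D2: "D \<subseteq> V" "finite D" using D V'_subset fV' finite_subset by auto
    have wD: "\<And>v. v \<in> D \<Longrightarrow> w' v \<in> {1..k}" and cD: "\<And>u b. u \<in> D \<Longrightarrow> w' u = b + 1 \<Longrightarrow> c b = cl u"
      using wr' c' D by auto
    define x where "x = (\<lambda>b. card {u \<in> D. w' u = b + 1})"
    have "x b \<le> m b" if "b < k" for b
    proof (cases "\<exists>v\<in>D. w' v = b + 1")
      case True
      then obtain v where v: "v \<in> D" "w' v = b + 1" by blast
      have "x b \<le> card {u \<in> V'. w' u = b + 1}" unfolding x_def using D fV' by (intro card_mono) auto
      also have "\<dots> = m b" using v cD[OF v] D2 by (intro cw[OF that, of v]) auto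
      finally show ?thesis .
    next
      case False
      then have e: "{u \<in> D. w' u = b + 1} = {}" by auto
      show ?thesis unfolding x_def e by simp
    qed
    then have "mds V N {v \<in> V. rk v < (\<Sum>b<k. if c b = cl v then x b else 0)} \<longleftrightarrow> (\<Sum>b<k. (b + 1) * x b) = t"
      using code by (simp add: code_ok_def)
    also have "(\<Sum>b<k. (b + 1) * x b) = sum w' D"
      unfolding x_def by (rule card_eq_sum_weights(2)[OF D2(2) wD, symmetric])
    also have "mds V N {v \<in> V. rk v < (\<Sum>b<k. if c b = cl v then x b else 0)} \<longleftrightarrow> mds V N D"
    proof (intro class_counts_mds_iff)
      fix v assume v: "v \<in> V"
      have e: "(\<Sum>b<k. if c b = cl v then x b else 0) = card (D \<inter> C v)"
        unfolding x_def by (rule class_count_eq[OF D2(1) wD cD v])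
      moreover have "card (D \<inter> C v) \<le> card (C v)" using finite_C by (intro card_mono) auto
      ultimately show "card ({v \<in> V. rk v < (\<Sum>b<k. if c b = cl v then x b else 0)} \<inter> C v) = card (D \<inter> C v)"
        using prefix_class_counts[OF v, of "\<lambda>i. \<Sum>b<k. if c b = i then x b else 0"] by simp
    qed (use D2 in auto)
    finally show ?thesis .
  qed
  \<comment> \<open>The other members of \<open>D\<close> in the class of \<open>u\<close> avoid a
    private neighbourhood of \<open>u\<close>, so \<open>twins_bounded\<close> counts them;
    \<open>u\<close> itself is the one more that is still allowed.\<close>
  have small: "card (D \<inter> C v) \<le> T" if D: "mds V N D" and v: "v \<in> V" for D v
  proof (cases "D \<inter> C v = {}")
    case False
    then obtain u where u: "u \<in> D" "u \<in> C v" by auto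
    obtain p where p: "minimal_nbhd V N p" "N p \<inter> D = {u}" using mds_private_minimal[OF D u(1)] by blast
    have "u \<in> N p" using p by auto
    have uV: "u \<in> V" "cl u = cl v" using u C_eq[OF v] by auto
    have "D \<inter> C v - {u} \<subseteq> {z \<in> V. twin V N u z \<and> z \<notin> N p}"
    proof
      fix z assume z: "z \<in> D \<inter> C v - {u}"
      then have "z \<in> V" "cl u = cl z" using uV C_eq[OF v] by auto
      moreover have "z \<notin> N p"
      proof
        assume "z \<in> N p"
        then have "z \<in> N p \<inter> D" using z by simp
        then show False using z p by simp
      qed
      ultimately show "z \<in> {z \<in> V. twin V N u z \<and> z \<notin> N p}" using cl uV by simp
    qed
    then have "card (D \<inter> C v - {u}) \<le> card {z \<in> V. twin V N u z \<and> z \<notin> N p}"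
      using finite_V by (intro card_mono) auto
    also have "\<dots> < T" using tb p(1) \<open>u \<in> N p\<close> by (simp add: twins_bounded_def)
    finally show ?thesis using u finite_C by (simp add: card_Diff_singleton)
  qed simp
  have const: "w' v1 = w' v2" if v: "v1 \<in> V'" "v2 \<in> V'" "cl v1 = cl v2" and large: "T + 1 < card (C v1)" for v1 v2
  proof (cases "v1 = v2")
    case False
    have vV: "v1 \<in> V" "v2 \<in> V" using v V'_subset by auto
    obtain D where D: "mds V N D" "v1 \<in> D" using in_some_mds vV by blast
    define y where "y = card (D \<inter> C v1)"
    have "v1 \<in> D \<inter> C v1" using D vV C_eq by simp
    then have y: "1 \<le> y" "y \<le> T" using small[OF D(1) vV(1)] finite_C[of v1]
      by (auto simp: y_def Suc_le_eq card_gt_0_iff)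
    \<comment> \<open>Moving \<open>D\<close> to the lowest ranks of every class keeps the class
      counts and stays inside \<open>V'\<close>, as no count exceeds \<open>T\<close>.\<close>
    define E where "E = {u \<in> V. rk u < card (D \<inter> C u)}"
    have CE: "card (E \<inter> C v) = card (D \<inter> C v)" if "v \<in> V" for v
    proof -
      have "E \<inter> C v = {u \<in> C v. rk u < card (D \<inter> C v)}" using that by (auto simp: E_def C_eq)
      then show ?thesis using card_rk_less[OF that, of "card (D \<inter> C v)"] finite_C by (simp add: card_mono)
    qed
    have EV': "E \<subseteq> V'"
    proof
      fix u assume "u \<in> E"
      then show "u \<in> V'" using small[OF D(1), of u] by (auto simp: E_def V'_def)
    qed
    let ?S = "V' \<inter> C v1 - {v1, v2}"
    have "{v1, v2} \<subseteq> V' \<inter> C v1" using v vV C_eq by auto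
    then have "card ?S = card (V' \<inter> C v1) - card {v1, v2}" by (intro card_Diff_subset) auto
    \<comment> \<open>Here \<open>T + 1\<close> kept vertices are needed: besides \<open>v1\<close>
      and \<open>v2\<close>, \<open>T - 1\<close> remain, enough to complete \<open>v1\<close> to
      \<open>y \<le> T\<close> vertices without using \<open>v2\<close>.\<close>
    then have "y - 1 \<le> card ?S" using False y card_V'_class[OF vV(1)] large by simp
    then obtain Y where Y: "Y \<subseteq> ?S" "card Y = y - 1" by (meson obtain_subset_with_card_n)
    have "finite ?S" using fV' by simp
    then have fY: "finite Y" "v1 \<notin> Y" "v2 \<notin> Y" using Y(1) finite_subset[of Y ?S] by auto
    \<comment> \<open>\<open>G\<close> has the class counts of \<open>D\<close> and contains
      \<open>v1\<close> but not \<open>v2\<close>. Exchanging them gives a second mds inside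
      \<open>V'\<close>; both weigh \<open>t\<close>, so the two weights agree.\<close>
    define G where "G = (E - C v1) \<union> insert v1 Y"
    have GV: "G \<subseteq> V'" using EV' Y v by (auto simp: G_def)
    have G: "v1 \<in> G" "v2 \<notin> G" using fY False vV v C_eq[of v1] by (auto simp: G_def)
    have "card (G \<inter> C x) = card (D \<inter> C x)" if x: "x \<in> V" for x
    proof (cases "cl x = cl v1")
      case True
      then have "C x = C v1" using x vV by (simp add: C_eq)
      moreover have "G \<inter> C v1 = insert v1 Y" using Y vV C_eq[of v1] by (auto simp: G_def)
      ultimately show ?thesis using fY Y y by (simp add: y_def)
    next
      case False
      then have "G \<inter> C x = E \<inter> C x" using Y x vV by (auto simp: G_def C_eq)
      then show ?thesis using CE[OF x] by simp
    qed
    then have mG: "mds V N G" using D(1) GV V'_subset by (intro class_counts_mds[of D G]) auto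
    then have m2: "mds V N (insert v2 (G - {v1}))" using G cl[of v1 v2] vV v by (intro twinD) auto
    have fG: "finite G" using GV fV' finite_subset by blast
    have "sum w' (insert v2 (G - {v1})) = sum w' G"
      using st'[of G] st'[of "insert v2 (G - {v1})"] GV v mG m2 by auto
    moreover have "sum w' G = w' v1 + sum w' (G - {v1})" using G fG by (simp add: sum.remove)
    moreover have "sum w' (insert v2 (G - {v1})) = w' v2 + sum w' (G - {v1})" using G fG by simp
    ultimately show ?thesis by simp
  qed simp
  have ex0: "\<exists>u\<in>V'. cl u = cl v" if v: "v \<in> V" for v
  proof -
    have "v \<in> C v" using v C_eq by simp
    then have "card (C v) > 0" using finite_C by (auto simp: card_gt_0_iff)
    then have "V' \<inter> C v \<noteq> {}" using card_V'_class[OF v] by auto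
    then show ?thesis using v C_eq by auto
  qed
  define r where "r = (\<lambda>v. SOME u. u \<in> V' \<and> cl u = cl v)"
  have r: "r v \<in> V'" "cl (r v) = cl v" if "v \<in> V" for v
    using someI_ex[of "\<lambda>u. u \<in> V' \<and> cl u = cl v"] ex0[OF that] unfolding r_def by auto
  define w where "w = (\<lambda>v. if v \<in> V' then w' v else w' (r v))"
  have wr: "w v \<in> {1..k}" if "v \<in> V" for v using wr' r that by (auto simp: w_def)
  have large: "T + 1 < card (C v)" if "v \<in> V" "v \<notin> V'" for v
    using rk_less_card[OF that(1)] that by (auto simp: V'_def)
  have wc: "w u = w v" if "u \<in> V" "v \<in> V" "cl u = cl v" "T + 1 < card (C v)" for u v
  proof -
    have "C u = C v" using that by (simp add: C_eq)
    moreover have "r u = r v" using that by (simp add: r_def)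
    ultimately show ?thesis using const[of "r u" u] const[of "r v" v] r[of u] r[of v] that
      by (auto simp: w_def C_eq V'_def)
  qed
  have "mds V N D \<longleftrightarrow> sum w D = t" if D: "D \<subseteq> V" for D
  proof (cases "\<exists>v\<in>V. T < card (D \<inter> C v)")
    case True
    have fD: "finite D" using D finite_V finite_subset by blast
    \<comment> \<open>More than \<open>T\<close> vertices of one class exclude an mds by
      \<open>small\<close> and, all weights being positive, also the sum
      \<open>t \<le> T\<close>.\<close>
    obtain v where v: "v \<in> V" "T < card (D \<inter> C v)" using True by blast
    have "T < card D" using v(2) card_mono[OF fD, of "D \<inter> C v"] by simp
    also have "card D \<le> sum w D" using sum_mono[of D "\<lambda>_. 1" w] wr D by (auto simp: subset_iff)
    finally have "sum w D \<noteq> t" using t by simp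
    then show ?thesis using small v by fastforce
  next
    case False
    have fD: "finite D" using D finite_V finite_subset by blast
    \<comment> \<open>Only classes with dropped vertices are moved to low ranks, since their weight
      is constant; the others may carry several weights and are left alone.\<close>
    define E where "E = {u \<in> V. if T + 1 < card (C u) then rk u < card (D \<inter> C u) else u \<in> D}"
    have ECl: "E \<inter> C v = {u \<in> C v. rk u < card (D \<inter> C v)}" if "v \<in> V" "T + 1 < card (C v)" for v
      using that by (auto simp: E_def C_eq)
    have ECs: "E \<inter> C v = D \<inter> C v" if "v \<in> V" "\<not> T + 1 < card (C v)" for v
      using that by (auto simp: E_def C_eq)
    have CE: "card (E \<inter> C v) = card (D \<inter> C v)" if "v \<in> V" for v
    proof (cases "T + 1 < card (C v)")
      case True
      then show ?thesis using ECl[OF that True] card_rk_less[OF that, of "card (D \<inter> C v)"] finite_C by (simp add: card_mono)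
    qed (simp add: ECs that)
    have EV': "E \<subseteq> V'"
    proof
      fix u assume u: "u \<in> E"
      then have "card (D \<inter> C u) \<le> T" "u \<in> V" using False by (auto simp: E_def not_less)
      then show "u \<in> V'" using u rk_less_card[of u] by (auto simp: E_def V'_def split: if_splits)
    qed
    have "mds V N D \<longleftrightarrow> mds V N E" using CE D EV' V'_subset by (intro class_counts_mds_iff) auto
    also have "\<dots> \<longleftrightarrow> sum w' E = t" using st'[OF EV'] .
    also have "sum w' E = sum w E" using EV' by (intro sum.cong) (auto simp: w_def)
    also have "sum w E = sum w D"
    proof -
      have fE: "finite E" using EV' fV' finite_subset by blast
      have im: "cl ` E \<subseteq> cl ` V" "cl ` D \<subseteq> cl ` V" using D EV' V'_subset by auto
      have "sum w {u \<in> E. cl u = i} = sum w {u \<in> D. cl u = i}" if i: "i \<in> cl ` V" for i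
      proof -
        obtain v where v: "v \<in> V" "i = cl v" using i by blast
        have e: "{u \<in> E. cl u = i} = E \<inter> C v" "{u \<in> D. cl u = i} = D \<inter> C v"
          using v D EV' V'_subset by (auto simp: C_eq)
        show ?thesis
        proof (cases "T + 1 < card (C v)")
          case True
          have "sum w X = card X * w v" if "X \<subseteq> C v" for X
          proof -
            have "w u = w v" if "u \<in> X" for u using wc[of u v] that \<open>X \<subseteq> C v\<close> v True by (auto simp: C_eq)
            then show ?thesis using sum.cong[of X X w "\<lambda>_. w v"] by simp
          qed
          then show ?thesis unfolding e using CE[OF v(1)] by simp
        next
          case False
          then show ?thesis unfolding e using ECs[OF v(1)] by simp
        qed
      qed
      then have "(\<Sum>i\<in>cl ` V. sum w {u \<in> E. cl u = i}) = (\<Sum>i\<in>cl ` V. sum w {u \<in> D. cl u = i})"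
        by (rule sum.cong[OF refl])
      then show ?thesis using sum.group[OF fE _ im(1), of w] sum.group[OF fD _ im(2), of w] finite_V by simp
    qed
    finally show ?thesis .
  qed
  then have "mds_structure k V N w t" using wr t(1) unfolding mds_structure_def by blast
  then show ?thesis by (auto simp: keq_def)
qed

lemma keq_iff_code:
  assumes "\<And>w t. mds_structure k V N w t \<Longrightarrow> t \<le> T"
  shows "keq k V N \<longleftrightarrow> twins_bounded V N T \<and>
    (\<exists>c m t. (\<forall>b<k. c b < T + 2 \<and> m b < T + 2) \<and> 1 \<le> t \<and> t \<le> T \<and> code_ok V N cl k T c m t)"
proof
  assume "keq k V N"
  then obtain w t where st: "mds_structure k V N w t" by (auto simp: keq_def)
  obtain c m where "\<forall>b<k. c b < T + 2 \<and> m b < T + 2" "code_ok V N cl k T c m t"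
    using structure_code[OF st] by blast
  then show "twins_bounded V N T \<and>
    (\<exists>c m t. (\<forall>b<k. c b < T + 2 \<and> m b < T + 2) \<and> 1 \<le> t \<and> t \<le> T \<and> code_ok V N cl k T c m t)"
    using structure_twins_bounded[OF st] assms[OF st] structureD(3)[OF st] by blast
next
  assume "twins_bounded V N T \<and>
    (\<exists>c m t. (\<forall>b<k. c b < T + 2 \<and> m b < T + 2) \<and> 1 \<le> t \<and> t \<le> T \<and> code_ok V N cl k T c m t)"
  then obtain c m t where "twins_bounded V N T" "code_ok V N cl k T c m t" "1 \<le> t" "t \<le> T" by blast
  then show "keq k V N" by (rule code_structure)
qed

end

section \<open>Preprocessing of the graph\<close>

definition eNot :: "hx \<Rightarrow> hx" where "eNot a = Ite a (Cn 0) (Cn 1)"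
definition eAnd :: "hx \<Rightarrow> hx \<Rightarrow> hx" where "eAnd a b = Ite a (Ite b (Cn 1) (Cn 0)) (Cn 0)"
definition eOr :: "hx \<Rightarrow> hx \<Rightarrow> hx" where "eOr a b = Ite a (Cn 1) (Ite b (Cn 1) (Cn 0))"
definition eLt :: "hx \<Rightarrow> hx \<Rightarrow> hx" where "eLt a b = Ite (Mi b a) (Cn 1) (Cn 0)"
definition eEq :: "hx \<Rightarrow> hx \<Rightarrow> hx" where "eEq a b = Ite (Pl (Mi a b) (Mi b a)) (Cn 0) (Cn 1)"
definition eEx :: "nat \<Rightarrow> nat \<Rightarrow> hx \<Rightarrow> hx" where "eEx x a e = Ite (Sm x a e) (Cn 1) (Cn 0)"
definition eAll :: "nat \<Rightarrow> nat \<Rightarrow> hx \<Rightarrow> hx" where "eAll x a e = Ite (Sm x a (Ite e (Cn 0) (Cn 1))) (Cn 0) (Cn 1)"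
abbreviation Rg :: "nat \<Rightarrow> hx" where "Rg a \<equiv> Ld a (Cn 0)"

lemmas e_defs = eNot_def eAnd_def eOr_def eLt_def eEq_def eEx_def eAll_def

lemma heval_e [simp]:
  "heval (eNot a) \<rho> s = of_bool (heval a \<rho> s = 0)"
  "heval (eAnd a b) \<rho> s = of_bool (heval a \<rho> s \<noteq> 0 \<and> heval b \<rho> s \<noteq> 0)"
  "heval (eOr a b) \<rho> s = of_bool (heval a \<rho> s \<noteq> 0 \<or> heval b \<rho> s \<noteq> 0)"
  "heval (eLt a b) \<rho> s = of_bool (heval a \<rho> s < heval b \<rho> s)"
  "heval (eEq a b) \<rho> s = of_bool (heval a \<rho> s = heval b \<rho> s)"
  "heval (eEx x n e) \<rho> s = of_bool (\<exists>i<s n 0. heval e (\<rho>(x := i)) s \<noteq> 0)"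
  "heval (eAll x n e) \<rho> s = of_bool (\<forall>i<s n 0. heval e (\<rho>(x := i)) s \<noteq> 0)"
  by (auto simp: e_defs)

lemma xreads_e [simp]:
  "xreads (eNot a) = xreads a" "xreads (eAnd a b) = xreads a \<union> xreads b"
  "xreads (eOr a b) = xreads a \<union> xreads b" "xreads (eLt a b) = xreads a \<union> xreads b"
  "xreads (eEq a b) = xreads a \<union> xreads b" "xreads (eEx x n e) = insert n (xreads e)"
  "xreads (eAll x n e) = insert n (xreads e)"
  by (auto simp: e_defs)

lemma xbounds_e [simp]:
  "xbounds (eNot a) = xbounds a" "xbounds (eAnd a b) = xbounds a \<union> xbounds b"
  "xbounds (eOr a b) = xbounds a \<union> xbounds b" "xbounds (eLt a b) = xbounds a \<union> xbounds b"
  "xbounds (eEq a b) = xbounds a \<union> xbounds b" "xbounds (eEx x n e) = insert n (xbounds e)"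
  "xbounds (eAll x n e) = insert n (xbounds e)"
  by (auto simp: e_defs)

lemma xdepth_e [simp]:
  "xdepth (eNot a) = xdepth a" "xdepth (eAnd a b) = max (xdepth a) (xdepth b)"
  "xdepth (eOr a b) = max (xdepth a) (xdepth b)" "xdepth (eLt a b) = max (xdepth a) (xdepth b)"
  "xdepth (eEq a b) = max (xdepth a) (xdepth b)" "xdepth (eEx x n e) = Suc (xdepth e)"
  "xdepth (eAll x n e) = Suc (xdepth e)"
  by (auto simp: e_defs)

definition Tab :: "nat \<Rightarrow> nat \<Rightarrow> nat \<Rightarrow> hx \<Rightarrow> hc" where "Tab A x a e = For x a (As A (Vr x) e)"

lemma hrun_Tab:
  assumes "A \<notin> xreads e" "A \<noteq> a"
  shows "hrun (Tab A x a e) \<rho> s = s(A := \<lambda>j. if j < s a 0 then heval e (\<rho>(x := j)) s else s A j)"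
proof -
  have hv: "heval e r (s(A := f)) = heval e r s" for r f
    using assms(1) by (intro heval_cong) auto
  have "forloop (\<lambda>i. hrun (As A (Vr x) e) (\<rho>(x := i))) n s =
    s(A := \<lambda>j. if j < n then heval e (\<rho>(x := j)) s else s A j)" for n
  proof (induction n)
    case (Suc n)
    let ?f = "\<lambda>n j. if j < n then heval e (\<rho>(x := j)) s else s A j"
    have "forloop (\<lambda>i. hrun (As A (Vr x) e) (\<rho>(x := i))) (Suc n) s = hrun (As A (Vr x) e) (\<rho>(x := n)) (s(A := ?f n))"
      by (subst forloop.simps(2), rule arg_cong[OF Suc.IH])
    also have "\<dots> = s(A := (?f n)(n := heval e (\<rho>(x := n)) s))"
      by (simp only: hrun.simps heval.simps hv fun_upd_same fun_upd_upd)
    also have "(?f n)(n := heval e (\<rho>(x := n)) s) = ?f (Suc n)" by (auto simp: fun_eq_iff less_Suc_eq)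
    finally show ?case .
  qed simp
  then show ?thesis by (simp add: Tab_def)
qed

lemma hrun_Tab_frame: "b \<noteq> A \<Longrightarrow> hrun (Tab A x a e) \<rho> s b = s b"
  by (rule hrun_frame) (simp add: Tab_def)

lemma sum_of_bool_card: "(\<Sum>i<(n::nat). of_bool (P i)) = card {i. i < n \<and> P i}"
proof -
  have "(\<Sum>i<n. of_bool (P i)) = card ({..<n} \<inter> {i. P i})" by (simp add: sum_of_bool_eq)
  also have "{..<n} \<inter> {i. P i} = {i. i < n \<and> P i}" by auto
  finally show ?thesis .
qed

lemma keq_bij:
  assumes f: "bij_betw f V1 V2" and fin: "finite V1" and N1: "\<And>v. v \<in> V1 \<Longrightarrow> N1 v \<subseteq> V1"
    and N: "\<And>v. v \<in> V1 \<Longrightarrow> N2 (f v) = f ` N1 v"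
  shows "keq k V1 N1 \<longleftrightarrow> keq k V2 N2"
proof -
  have inj: "inj_on f V1" and im: "f ` V1 = V2" using f by (auto simp: bij_betw_def)
  have mds: "mds V1 N1 D \<longleftrightarrow> mds V2 N2 (f ` D)" if D: "D \<subseteq> V1" for D
  proof -
    have int: "N2 (f v) \<inter> f ` X = f ` (N1 v \<inter> X)" if "v \<in> V1" "X \<subseteq> V1" for v X
      using N N1 that inj by (metis inj_on_image_Int)
    have e: "f ` A = f ` B \<longleftrightarrow> A = B" if "A \<subseteq> V1" "B \<subseteq> V1" for A B
      using inj_on_image_eq_iff[OF inj that] .
    have "N1 v \<inter> D = {u} \<longleftrightarrow> N2 (f v) \<inter> f ` D = {f u}" if "v \<in> V1" "u \<in> D" for u v
      using int[OF that(1) D] e[of "N1 v \<inter> D" "{u}"] that D by auto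
    moreover have "N1 v \<inter> D = {} \<longleftrightarrow> N2 (f v) \<inter> f ` D = {}" if "v \<in> V1" for v
      using int[OF that D] by simp
    ultimately show ?thesis using D by (simp add: mds_def hit_def im[symmetric] image_mono)
  qed
  show ?thesis
  proof
    assume "keq k V2 N2"
    then obtain w t where w: "mds_structure k V2 N2 w t" by (auto simp: keq_def)
    have "mds V1 N1 D \<longleftrightarrow> sum (w \<circ> f) D = t" if D: "D \<subseteq> V1" for D
    proof -
      have "sum (w \<circ> f) D = sum w (f ` D)" using inj D by (metis inj_on_subset sum.reindex)
      moreover have "f ` D \<subseteq> V2" using D im by auto
      ultimately show ?thesis using mds[OF D] w by (simp add: mds_structure_def)
    qed
    then have "mds_structure k V1 N1 (w \<circ> f) t" using w im by (auto simp: mds_structure_def)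
    then show "keq k V1 N1" by (auto simp: keq_def)
  next
    assume "keq k V1 N1"
    then obtain w t where w: "mds_structure k V1 N1 w t" by (auto simp: keq_def)
    define g where "g = inv_into V1 f"
    have g: "g (f v) = v" if "v \<in> V1" for v using inj that by (simp add: g_def)
    have "mds V2 N2 D \<longleftrightarrow> sum (w \<circ> g) D = t" if D: "D \<subseteq> V2" for D
    proof -
      obtain D' where D': "D' \<subseteq> V1" "D = f ` D'" using D im by (metis subset_imageE)
      have "sum (w \<circ> g) D = sum (w \<circ> g \<circ> f) D'" unfolding D'(2) using inj D'(1) by (metis inj_on_subset sum.reindex comp_assoc)
      also have "\<dots> = sum w D'" using g D'(1) by (intro sum.cong) auto
      finally show ?thesis using mds[OF D'(1)] w D' by (simp add: mds_structure_def)
    qed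
    then have "mds_structure k V2 N2 (w \<circ> g) t" using w im g by (auto simp: mds_structure_def)
    then show "keq k V2 N2" by (auto simp: keq_def)
  qed
qed

text \<open>
  Scalars (cell \<open>0\<close>): 10 \<open>n\<close>, 11 \<open>k\<close>, 12 \<open>3 k\<^sup>4\<close>, 13 \<open>T = 10 k\<^sup>6\<close>, 14 \<open>B = T + 2\<close>, 15 \<open>2 k + 1\<close>,
  16 \<open>B ^ (2 k + 1)\<close>, 17 \<open>B ^ k\<close>, 18 number of selected vertices, 34 outcome of the twin bound test,
  39 number being split into digits, 42 current code passes, 43 some code passes.

  Tables: 20 row offsets of the adjacency matrix, 21 degrees, 22 index of a vertex among the selected ones,
  23 whether it is selected, 24 list of selected vertices, 25 powers of two, 26 minimality of closed
  neighbourhoods, 27 their codes, 28 set of codes of minimal ones, 30 number of smaller class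
  representatives, 31 class, 32 rank in the class, 33 truncated class size, 35 and 36 quotient and
  remainder modulo \<open>B\<close>, 37 code (classes, multiplicities, target), 38 counts, 40 the set described by
  the counts, 41 how often it hits each closed neighbourhood.
\<close>

definition Read_input :: hc where "Read_input = Sq (As 10 (Cn 0) (Ld 0 (Cn 0))) (As 11 (Cn 0) (Ld 0 (Cn 1)))"

text \<open>Without multiplication, \<open>c * k ^ i\<close> is computed by \<open>i\<close> nested
  sums; with \<open>i = 6\<close> this gives the depth 6 of \<open>Set_scalars\<close>.\<close>

fun eKpow :: "nat \<Rightarrow> nat \<Rightarrow> hx" where
  "eKpow 0 c = Cn c"
| "eKpow (Suc i) c = Sm 0 11 (eKpow i c)"

lemma heval_eKpow: "heval (eKpow i c) \<rho> s = s 11 0 ^ i * c"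
  by (induction i arbitrary: \<rho>) auto

definition Set_scalars :: hc where
  "Set_scalars = Sq (As 12 (Cn 0) (eKpow 4 3)) (Sq (As 13 (Cn 0) (eKpow 6 10))
    (Sq (As 14 (Cn 0) (Pl (Rg 13) (Cn 2))) (As 15 (Cn 0) (Pl (Pl (Rg 11) (Rg 11)) (Cn 1)))))"

lemma hrun_Set_scalars:
  assumes "\<sigma> = hrun Set_scalars \<rho> (hrun Read_input \<rho> s)" "s 0 0 = n" "s 0 1 = k"
  shows "\<sigma> 10 0 = n" "\<sigma> 11 0 = k" "\<sigma> 12 0 = 3 * k ^ 4" "\<sigma> 13 0 = 10 * k ^ 6"
    "\<sigma> 14 0 = 10 * k ^ 6 + 2" "\<sigma> 15 0 = 2 * k + 1" "a \<notin> {10..15} \<Longrightarrow> \<sigma> a = s a"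
  using assms(2,3) by (auto simp: assms(1) Read_input_def Set_scalars_def heval_eKpow)

definition Select_vertices :: hc where
  "Select_vertices = Sq (Tab 20 5 10 (Sm 3 10 (Vr 5)))
    (Sq (Tab 21 5 10 (Sm 4 10 (Ld 1 (Pl (Ld 20 (Vr 5)) (Vr 4)))))
    (Sq (Tab 23 5 10 (eOr (Ld 21 (Vr 5)) (eLt (Sm 4 10 (eAnd (eLt (Vr 4) (Vr 5)) (eNot (Ld 21 (Vr 4))))) (Rg 12))))
    (Sq (Tab 22 5 10 (Sm 4 10 (eAnd (eLt (Vr 4) (Vr 5)) (Ld 23 (Vr 4)))))
    (Sq (For 5 10 (As 24 (Ite (Ld 23 (Vr 5)) (Ld 22 (Vr 5)) (Rg 10)) (Vr 5)))
    (As 18 (Cn 0) (Sm 5 10 (Ld 23 (Vr 5))))))))"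

text \<open>Vertices outside \<open>K\<close> are all written to cell \<open>n\<close>, behind the
  \<open>card K\<close> cells of the list, so they overwrite no entry of it.\<close>

lemma scatter:
  fixes K :: "nat set"
  assumes K: "K \<subseteq> {..<n}" and pos: "\<And>v. v < n \<Longrightarrow> pos v = card {u \<in> K. u < v}"
    and F: "\<And>v f. v < n \<Longrightarrow> F v f = f((if v \<in> K then pos v else n) := v)"
    and f: "f = forloop F n f0"
  shows "bij_betw f {..<card K} K"
proof -
  have fK: "finite K" using K finite_subset by blast
  have b: "bij_betw pos K {..<card K}"
    using rank_bij_betw[OF fK] pos K by (subst bij_betw_cong[of K pos "\<lambda>v. card {u \<in> K. u < v}"]) auto
  have le: "card K \<le> n" using card_mono[OF finite_lessThan K] by simp
  have inv: "\<forall>v\<in>K. v < i \<longrightarrow> forloop F i f0 (pos v) = v" if "i \<le> n" for i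
    using that
  proof (induction i)
    case (Suc i)
    show ?case
    proof (intro ballI impI)
      fix v assume v: "v \<in> K" "v < Suc i"
      have pv: "pos v < card K" using b v by (auto simp: bij_betw_def)
      show "forloop F (Suc i) f0 (pos v) = v"
      proof (cases "v = i")
        case True
        then show ?thesis using v Suc.prems F[of i] by simp
      next
        case False
        then have "forloop F i f0 (pos v) = v" using Suc v by simp
        moreover have "pos v \<noteq> (if i \<in> K then pos i else n)"
          using False v b pv le by (auto simp: bij_betw_def inj_on_def)
        ultimately show ?thesis using Suc.prems F[of i] by simp
      qed
    qed
  qed simp
  then have "f (pos v) = v" if "v \<in> K" for v using that K f by auto
  moreover have "pos v < card K" if "v \<in> K" for v using b that by (auto simp: bij_betw_def)
  moreover have "a \<in> pos ` K" if "a < card K" for a using b that by (simp add: bij_betw_def)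
  ultimately show ?thesis by (intro bij_betw_byWitness[where f' = pos]) fastforce+
qed

lemma hrun_Select_vertices:
  fixes adj :: "nat \<Rightarrow> nat \<Rightarrow> bool"
  assumes \<sigma>: "\<sigma> = hrun Select_vertices \<rho> s" and n: "s 10 0 = n" and adj: "\<And>u v. u < n \<Longrightarrow> v < n \<Longrightarrow> s 1 (u * n + v) \<noteq> 0 \<longleftrightarrow> adj u v"
  defines "isol \<equiv> {v. v < n \<and> (\<forall>u<n. \<not> adj v u)}"
  defines "K \<equiv> {v. v < n \<and> (v \<notin> isol \<or> card {u \<in> isol. u < v} < s 12 0)}"
  shows "\<And>v. v < n \<Longrightarrow> \<sigma> 20 v = v * n" "\<sigma> 18 0 = card K" "bij_betw (\<sigma> 24) {..<card K} K"
    "\<And>a. a \<notin> {18,20,21,22,23,24} \<Longrightarrow> \<sigma> a = s a"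
proof -
  define s1 where "s1 = hrun (Tab 20 5 10 (Sm 3 10 (Vr 5))) \<rho> s"
  have s1: "\<And>v. v < n \<Longrightarrow> s1 20 v = v * n" "\<And>a. a \<noteq> 20 \<Longrightarrow> s1 a = s a"
    by (auto simp: s1_def hrun_Tab n)
  define s2 where "s2 = hrun (Tab 21 5 10 (Sm 4 10 (Ld 1 (Pl (Ld 20 (Vr 5)) (Vr 4))))) \<rho> s1"
  have s2: "\<And>v. v < n \<Longrightarrow> s2 21 v \<noteq> 0 \<longleftrightarrow> v \<notin> isol" "\<And>a. a \<noteq> 21 \<Longrightarrow> s2 a = s1 a"
    using adj by (auto simp: s2_def hrun_Tab n s1 isol_def)
  have s2z: "s2 21 v = 0 \<longleftrightarrow> (\<forall>u<n. \<not> adj v u)" if "v < n" for v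
    using s2(1)[OF that] that by (auto simp: isol_def)
  define s3 where "s3 = hrun (Tab 23 5 10 (eOr (Ld 21 (Vr 5)) (eLt (Sm 4 10 (eAnd (eLt (Vr 4) (Vr 5)) (eNot (Ld 21 (Vr 4))))) (Rg 12)))) \<rho> s2"
  have s3a: "s3 23 v = of_bool (v \<in> K)" if v: "v < n" for v
  proof -
    have "(\<Sum>i<n. of_bool (i < v \<and> s2 21 i = 0)) = card {i. i < n \<and> (i < v \<and> s2 21 i = 0)}"
      by (rule sum_of_bool_card)
    also have "{i. i < n \<and> (i < v \<and> s2 21 i = 0)} = {u \<in> isol. u < v}" using s2z by (auto simp: isol_def)
    finally have c: "(\<Sum>i<n. of_bool (i < v \<and> s2 21 i = 0)) = card {u \<in> isol. u < v}" .
    have "s3 23 v = of_bool (s2 21 v \<noteq> 0 \<or> (\<Sum>i<n. of_bool (i < v \<and> s2 21 i = 0)) < s 12 0)"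
      using v s2(2) by (simp add: s3_def hrun_Tab n s1)
    then show ?thesis unfolding c using v s2(1)[OF v] by (simp add: K_def)
  qed
  have s3b: "\<And>a. a \<noteq> 23 \<Longrightarrow> s3 a = s2 a" by (simp add: s3_def hrun_Tab_frame)
  define s4 where "s4 = hrun (Tab 22 5 10 (Sm 4 10 (eAnd (eLt (Vr 4) (Vr 5)) (Ld 23 (Vr 4))))) \<rho> s3"
  have s4a: "s4 22 v = card {u \<in> K. u < v}" if v: "v < n" for v
  proof -
    have "(\<Sum>i<n. of_bool (i < v \<and> s3 23 i \<noteq> 0)) = card {i. i < n \<and> (i < v \<and> s3 23 i \<noteq> 0)}"
      by (rule sum_of_bool_card)
    also have "{i. i < n \<and> (i < v \<and> s3 23 i \<noteq> 0)} = {u \<in> K. u < v}" using s3a by (auto simp: K_def)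
    finally show ?thesis using v by (simp add: s4_def hrun_Tab n s1 s2 s3b)
  qed
  have s4b: "\<And>a. a \<noteq> 22 \<Longrightarrow> s4 a = s3 a" by (simp add: s4_def hrun_Tab_frame)
  define s5 where "s5 = hrun (For 5 10 (As 24 (Ite (Ld 23 (Vr 5)) (Ld 22 (Vr 5)) (Rg 10)) (Vr 5))) \<rho> s4"
  have s5b: "\<And>a. a \<noteq> 24 \<Longrightarrow> s5 a = s4 a" unfolding s5_def by (rule hrun_frame) simp
  have n4: "s4 10 0 = n" by (simp add: s4b s3b s2 s1 n)
  define F where "F = (\<lambda>v f :: nat \<Rightarrow> nat. f((if s4 23 v \<noteq> 0 then s4 22 v else n) := v))"
  have "forloop (\<lambda>i. hrun (As 24 (Ite (Ld 23 (Vr 5)) (Ld 22 (Vr 5)) (Rg 10)) (Vr 5)) (\<rho>(5 := i))) m s4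
    = s4(24 := forloop F m (s4 24))" for m
    by (induction m) (auto simp: F_def n4 fun_eq_iff)
  then have s5a: "s5 24 = forloop F n (s4 24)" by (simp add: s5_def n4)
  have "bij_betw (s5 24) {..<card K} K"
  proof (rule scatter[of K n "s4 22" F])
    show "F v f = f((if v \<in> K then s4 22 v else n) := v)" if "v < n" for v f
      using s3a[OF that] by (simp add: F_def s4b)
  qed (auto simp: K_def s4a s5a)
  moreover have "\<sigma> = hrun (As 18 (Cn 0) (Sm 5 10 (Ld 23 (Vr 5)))) \<rho> s5"
    unfolding \<sigma> Select_vertices_def hrun.simps(2) s1_def[symmetric] s2_def[symmetric] s3_def[symmetric] s4_def[symmetric]
      s5_def[symmetric] ..
  then have \<sigma>5: "\<sigma> = s5(18 := (s5 18)(0 := \<Sum>v<n. s5 23 v))" by (simp add: s5b n4)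
  have "(\<Sum>v<n. s5 23 v) = card K"
  proof -
    have "(\<Sum>v<n. s5 23 v) = (\<Sum>v<n. of_bool (v \<in> K))" using s3a by (intro sum.cong) (auto simp: s5b s4b)
    also have "\<dots> = card {v. v < n \<and> v \<in> K}" by (rule sum_of_bool_card)
    also have "{v. v < n \<and> v \<in> K} = K" by (auto simp: K_def)
    finally show ?thesis .
  qed
  ultimately show "\<sigma> 18 0 = card K" "bij_betw (\<sigma> 24) {..<card K} K" by (simp_all add: \<sigma>5)
  show "\<sigma> 20 v = v * n" if "v < n" for v
    using that by (simp add: \<sigma>5 s5b s4b s3b s2 s1)
  show "\<sigma> a = s a" if "a \<notin> {18,20,21,22,23,24}" for a
    using that by (simp add: \<sigma>5 s5b s4b s3b s2 s1)
qed

definition Set_powers :: hc where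
  "Set_powers = Sq (As 16 (Cn 0) (Cn 1)) (Sq (For 7 15 (As 16 (Cn 0) (Sm 3 14 (Rg 16))))
    (Sq (As 17 (Cn 0) (Cn 1)) (For 7 11 (As 17 (Cn 0) (Sm 3 14 (Rg 17))))))"

lemma forloop_power:
  assumes "A \<noteq> 14"
  shows "forloop (\<lambda>i. hrun (As A (Cn 0) (Sm 3 14 (Rg A))) (\<rho>(x := i))) m (s(A := g(0 := 1)))
    = s(A := g(0 := s 14 0 ^ m))"
  using assms by (induction m) (auto simp: fun_eq_iff)

lemma hrun_Set_powers:
  assumes "\<sigma> = hrun Set_powers \<rho> s"
  shows "\<sigma> 16 0 = s 14 0 ^ s 15 0" "\<sigma> 17 0 = s 14 0 ^ s 11 0" "a \<notin> {16,17} \<Longrightarrow> \<sigma> a = s a"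
  by (auto simp: assms Set_powers_def forloop_power[unfolded One_nat_def])

section \<open>Computing the twin classes\<close>

definition twin_reps :: "nat set \<Rightarrow> (nat \<Rightarrow> nat set) \<Rightarrow> nat set" where
  "twin_reps V N = {u \<in> V. twin_rank V N u = 0}"

lemma twin_rep_unique:
  assumes nb: "neighbourhoods V N" and v: "v \<in> V"
  shows "\<exists>!u. u \<in> twin_reps V N \<and> twin V N u v"
proof -
  interpret neighbourhoods V N by fact
  let ?C = "{u \<in> V. twin V N u v}"
  have C: "finite ?C" "v \<in> ?C" using finite_V v twin_refl by auto
  then have ne: "?C \<noteq> {}" by blast
  have M: "Min ?C \<in> V" "twin V N (Min ?C) v" using Min_in[OF C(1) ne] by auto
  have "\<not> (x < Min ?C \<and> twin V N x (Min ?C))" if "x \<in> V" for x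
  proof
    assume x: "x < Min ?C \<and> twin V N x (Min ?C)"
    then have "x \<in> ?C" using that twin_trans M by blast
    then have "Min ?C \<le> x" using C(1) by simp
    then show False using x by simp
  qed
  then have "{u \<in> V. u < Min ?C \<and> twin V N u (Min ?C)} = {}" by auto
  then have "twin_rank V N (Min ?C) = 0" unfolding twin_rank_def by (simp only: card.empty)
  then have ex: "Min ?C \<in> twin_reps V N \<and> twin V N (Min ?C) v" using M by (simp add: twin_reps_def)
  have lt: "\<not> x < y" if "x \<in> twin_reps V N" "y \<in> twin_reps V N" "twin V N x v" "twin V N y v" for x y
  proof
    assume "x < y"
    moreover have "twin V N x y" using twin_trans twin_sym that by blast
    ultimately have "x \<in> {u \<in> V. u < y \<and> twin V N u y}" using that by (simp add: twin_reps_def)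
    moreover have "finite {u \<in> V. u < y \<and> twin V N u y}" using finite_V by simp
    ultimately have "twin_rank V N y \<noteq> 0" unfolding twin_rank_def by (metis card_0_eq empty_iff)
    then show False using that by (simp add: twin_reps_def)
  qed
  show ?thesis
  proof (intro ex1I)
    show "Min ?C \<in> twin_reps V N \<and> twin V N (Min ?C) v" by (rule ex)
    fix y assume "y \<in> twin_reps V N \<and> twin V N y v"
    then show "y = Min ?C" using lt[of y "Min ?C"] lt[of "Min ?C" y] ex by simp
  qed
qed

definition twin_rep :: "nat set \<Rightarrow> (nat \<Rightarrow> nat set) \<Rightarrow> nat \<Rightarrow> nat" where
  "twin_rep V N v = (THE u. u \<in> twin_reps V N \<and> twin V N u v)"

text \<open>Numbering the representatives consecutively keeps the numbers below the number of
  classes, as \<open>cl_less\<close> demands.\<close>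

definition twin_id :: "nat set \<Rightarrow> (nat \<Rightarrow> nat set) \<Rightarrow> nat \<Rightarrow> nat" where
  "twin_id V N v = card {u \<in> twin_reps V N. u < twin_rep V N v}"

lemma twin_rep:
  assumes "neighbourhoods V N" "v \<in> V"
  shows "twin_rep V N v \<in> twin_reps V N" "twin V N (twin_rep V N v) v"
    "u \<in> twin_reps V N \<Longrightarrow> twin V N u v \<Longrightarrow> u = twin_rep V N v"
  using theI'[OF twin_rep_unique[OF assms]] twin_rep_unique[OF assms] unfolding twin_rep_def by auto

lemma twin_id:
  assumes nb: "neighbourhoods V N" and uv: "u \<in> V" "v \<in> V"
  shows "twin_id V N u = twin_id V N v \<longleftrightarrow> twin V N u v" "twin_id V N v < card (twin_reps V N)"
proof -
  interpret neighbourhoods V N by fact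
  have fR: "finite (twin_reps V N)" using finite_V by (simp add: twin_reps_def)
  note b = rank_bij_betw[OF fR]
  show "twin_id V N v < card (twin_reps V N)"
    using b twin_rep(1)[OF nb uv(2)] by (auto simp: bij_betw_def twin_id_def)
  have "twin_id V N u = twin_id V N v \<longleftrightarrow> twin_rep V N u = twin_rep V N v"
    using b twin_rep(1)[OF nb] uv by (auto simp: bij_betw_def twin_id_def dest: inj_onD)
  also have "\<dots> \<longleftrightarrow> twin V N u v"
    using twin_rep[OF nb uv(1)] twin_rep[OF nb uv(2)] twin_trans twin_sym by metis
  finally show "twin_id V N u = twin_id V N v \<longleftrightarrow> twin V N u v" .
qed

definition eN :: "hx \<Rightarrow> hx \<Rightarrow> hx" where
  "eN a b = eOr (eEq a b) (Ld 1 (Pl (Ld 20 (Ld 24 a)) (Ld 24 b)))"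

text \<open>From here on vertices are positions in the list of array 24. The predicate hides the
  list and the adjacency matrix, so that correctness is argued for \<open>N\<close> only.\<close>

definition nbhd_store :: "store \<Rightarrow> nat \<Rightarrow> (nat \<Rightarrow> nat set) \<Rightarrow> bool" where
  "nbhd_store s n N \<longleftrightarrow> s 18 0 = n \<and>
     (\<forall>i<n. \<forall>j<n. (i = j \<or> s 1 (s 20 (s 24 i) + s 24 j) \<noteq> 0) \<longleftrightarrow> j \<in> N i)"

lemma heval_eN:
  assumes "nbhd_store s n N" "heval a \<rho> s < n" "heval b \<rho> s < n"
  shows "heval (eN a b) \<rho> s = of_bool (heval b \<rho> s \<in> N (heval a \<rho> s))"
  using assms unfolding nbhd_store_def eN_def by (simp del: One_nat_def)

lemma nbhd_store_cong:
  assumes "nbhd_store s n N" "s' 18 = s 18" "s' 1 = s 1" "s' 20 = s 20" "s' 24 = s 24"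
  shows "nbhd_store s' n N"
  using assms unfolding nbhd_store_def by simp

lemma nbhd_storeD: "nbhd_store s n N \<Longrightarrow> s 18 0 = n"
  by (simp add: nbhd_store_def)

lemma xreads_eN [simp]: "xreads (eN a b) = {1, 20, 24} \<union> xreads a \<union> xreads b"
  by (auto simp: eN_def)

lemma xbounds_eN [simp]: "xbounds (eN a b) = xbounds a \<union> xbounds b"
  by (auto simp: eN_def)

lemma xdepth_eN [simp]: "xdepth (eN a b) = max (xdepth a) (xdepth b)"
  by (auto simp: eN_def)

definition Powers_of_two :: hc where
  "Powers_of_two = Sq (As 25 (Cn 0) (Cn 1)) (For 5 18 (As 25 (Pl (Vr 5) (Cn 1)) (Pl (Ld 25 (Vr 5)) (Ld 25 (Vr 5)))))"

definition Minimal_nbhds :: hc where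
  "Minimal_nbhds = Tab 26 1 18 (eAll 2 18 (eOr (eEx 3 18 (eAnd (eN (Vr 2) (Vr 3)) (eNot (eN (Vr 1) (Vr 3)))))
     (eNot (eEx 3 18 (eAnd (eN (Vr 1) (Vr 3)) (eNot (eN (Vr 2) (Vr 3))))))))"

definition Nbhd_codes :: hc where
  "Nbhd_codes = Tab 27 1 18 (Sm 3 18 (Ite (eN (Vr 1) (Vr 3)) (Ld 25 (Vr 3)) (Cn 0)))"

text \<open>The table is addressed by the codes themselves and must start out as zero, since only
  cells of occurring codes are written.\<close>

definition Code_table :: hc where
  "Code_table = For 1 18 (As 28 (Ld 27 (Vr 1)) (eOr (Ld 28 (Ld 27 (Vr 1))) (Ld 26 (Vr 1))))"

text \<open>
  A closed neighbourhood is coded as the sum of the powers \<open>2 ^ z\<close> of its elements, so exchanging \<open>u\<close> for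
  \<open>v\<close> adds \<open>2 ^ v - 2 ^ u\<close> to its code. Looking up codes in an array makes the twin test linear; without
  this the twin classes would take more than cubic time.
\<close>

definition eSwap :: "nat \<Rightarrow> nat \<Rightarrow> hx" where
  "eSwap u v = eOr (eNot (eN (Vr 1) (Vr u))) (eOr (eN (Vr 1) (Vr v))
     (Ld 28 (Mi (Pl (Ld 27 (Vr 1)) (Ld 25 (Vr v))) (Ld 25 (Vr u)))))"

text \<open>The criterion of \<open>twin_iff_swap\<close> for the vertices bound to variables 4 and
  5, in one pass over all neighbourhoods; testing all pairs is therefore cubic.\<close>

definition eTw :: hx where
  "eTw = eAll 1 18 (eOr (eNot (Ld 26 (Vr 1))) (eAnd (eSwap 4 5) (eSwap 5 4)))"

lemma xreads_eTw [simp]: "xreads eTw = {1, 18, 20, 24, 25, 26, 27, 28}"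
  by (auto simp: eTw_def eSwap_def)

lemma xbounds_eTw [simp]: "xbounds eTw = {18}"
  by (auto simp: eTw_def eSwap_def)

lemma xdepth_eTw [simp]: "xdepth eTw = 1"
  by (auto simp: eTw_def eSwap_def)

definition Twin_ranks :: hc where "Twin_ranks = Tab 32 5 18 (Sm 4 18 (eAnd (eLt (Vr 4) (Vr 5)) eTw))"
definition Rep_ids :: hc where "Rep_ids = Tab 30 5 18 (Sm 4 18 (eAnd (eLt (Vr 4) (Vr 5)) (eNot (Ld 32 (Vr 4)))))"
definition Twin_ids :: hc where
  "Twin_ids = Tab 31 5 18 (Sm 4 18 (Ite (eAnd (eNot (Ld 32 (Vr 4))) eTw) (Ld 30 (Vr 4)) (Cn 0)))"
definition Class_sizes :: hc where
  "Class_sizes = Tab 33 5 18 (Ite (eLt (Rg 13) (Sm 4 18 (eEq (Ld 31 (Vr 4)) (Ld 31 (Vr 5)))))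
     (Pl (Rg 13) (Cn 1)) (Sm 4 18 (eEq (Ld 31 (Vr 4)) (Ld 31 (Vr 5)))))"
text \<open>Twins are recognised by equal class numbers; evaluating \<open>eTw\<close> at this place
  would add a fourth nested loop.\<close>

definition Check_twins :: hc where
  "Check_twins = As 34 (Cn 0) (eAll 1 18 (eAll 4 18 (eOr (eNot (eAnd (Ld 26 (Vr 1)) (eN (Vr 1) (Vr 4))))
     (eLt (Sm 3 18 (eAnd (eEq (Ld 31 (Vr 4)) (Ld 31 (Vr 3))) (eNot (eN (Vr 1) (Vr 3))))) (Rg 13)))))"

definition Twin_tables :: hc where
  "Twin_tables = Sq Powers_of_two (Sq Minimal_nbhds (Sq Nbhd_codes (Sq Code_table (Sq Twin_ranks (Sq Rep_ids (Sq Twin_ids (Sq Class_sizes Check_twins)))))))"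

lemma hrun_Twin_tables:
  assumes \<sigma>: "\<sigma> = hrun Twin_tables \<rho> s" and st: "nbhd_store s n N" and nb: "neighbourhoods {..<n} N"
    and z: "s 28 = (\<lambda>_. 0)"
  shows "\<And>v. v < n \<Longrightarrow> \<sigma> 32 v = twin_rank {..<n} N v"
    "\<And>v. v < n \<Longrightarrow> \<sigma> 31 v = twin_id {..<n} N v"
    "\<And>v. v < n \<Longrightarrow> \<sigma> 33 v = min (s 13 0 + 1) (card (twin_class {..<n} N v))"
    "\<sigma> 34 0 \<noteq> 0 \<longleftrightarrow> twins_bounded {..<n} N (s 13 0)"
    "\<And>a. a \<notin> {25..34} \<Longrightarrow> \<sigma> a = s a"
proof -
  interpret neighbourhoods "{..<n}" N by fact
  let ?V = "{..<n}"
  have n: "s 18 0 = n" using nbhd_storeD[OF st] .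
  define s1 where "s1 = hrun Powers_of_two \<rho> s"
  have s1b: "s1 a = s a" if "a \<noteq> 25" for a
    unfolding s1_def by (rule hrun_frame) (use that in \<open>simp add: Powers_of_two_def\<close>)
  have "(\<forall>z\<le>n. s1 25 z = 2 ^ z)"
  proof -
    let ?f = "\<lambda>i. hrun (As 25 (Pl (Vr 5) (Cn 1)) (Pl (Ld 25 (Vr 5)) (Ld 25 (Vr 5)))) (\<rho>(5 := i))"
    have "\<forall>z\<le>n. forloop ?f n (s(25 := (s 25)(0 := 1))) 25 z = 2 ^ z"
    proof (rule forloop_invariant[where P = "\<lambda>i f. \<forall>z\<le>i. f 25 z = 2 ^ z"])
      fix i and f :: store assume "\<forall>z\<le>i. f 25 z = (2 :: nat) ^ z"
      then show "\<forall>z\<le>Suc i. ?f i f 25 z = 2 ^ z" by (auto simp: le_Suc_eq)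
    qed simp
    then show ?thesis by (simp add: s1_def Powers_of_two_def n)
  qed
  then have s1a: "s1 25 z = 2 ^ z" if "z < n" for z using that by simp
  have st1: "nbhd_store s1 n N" by (rule nbhd_store_cong[OF st]) (simp_all add: s1b)
  define s2 where "s2 = hrun Minimal_nbhds \<rho> s1"
  have s2b: "s2 a = s1 a" if "a \<noteq> 26" for a
    unfolding s2_def by (rule hrun_frame) (use that in \<open>simp add: Minimal_nbhds_def Tab_def\<close>)
  have s2a: "s2 26 p = of_bool (minimal_nbhd ?V N p)" if p: "p < n" for p
  proof -
    have "s2 26 p = of_bool (\<forall>q<n. (\<exists>z<n. z \<in> N q \<and> z \<notin> N p) \<or> \<not> (\<exists>z<n. z \<in> N p \<and> z \<notin> N q))"
      using p by (simp add: s2_def Minimal_nbhds_def hrun_Tab nbhd_storeD[OF st1] heval_eN[OF st1] cong: conj_cong)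
    also have "(\<forall>q<n. (\<exists>z<n. z \<in> N q \<and> z \<notin> N p) \<or> \<not> (\<exists>z<n. z \<in> N p \<and> z \<notin> N q)) \<longleftrightarrow> minimal_nbhd ?V N p"
    proof -
      have "N q \<subseteq> ?V" if "q < n" for q using N_subset that by simp
      then have "(\<exists>z<n. z \<in> N q \<and> z \<notin> N p) \<longleftrightarrow> \<not> N q \<subseteq> N p"
          "(\<exists>z<n. z \<in> N p \<and> z \<notin> N q) \<longleftrightarrow> \<not> N p \<subseteq> N q" if "q < n" for q
        using that p by blast+
      then show ?thesis using p unfolding minimal_nbhd_def by auto
    qed
    finally show ?thesis .
  qed
  have st2: "nbhd_store s2 n N" by (rule nbhd_store_cong[OF st1]) (simp_all add: s2b)
  have s2_25: "s2 25 z = 2 ^ z" if "z < n" for z using s1a[OF that] by (simp add: s2b)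
  define s3 where "s3 = hrun Nbhd_codes \<rho> s2"
  have s3b: "s3 a = s2 a" if "a \<noteq> 27" for a
    unfolding s3_def by (rule hrun_frame) (use that in \<open>simp add: Nbhd_codes_def Tab_def\<close>)
  have s3a: "s3 27 p = set_encode (N p)" if p: "p < n" for p
  proof -
    have "s3 27 p = (\<Sum>i<n. if i \<in> N p then 2 ^ i else 0)"
      using p by (simp add: s3_def Nbhd_codes_def hrun_Tab nbhd_storeD[OF st2] heval_eN[OF st2] s2_25 cong: sum.cong_simp if_cong)
    also have "\<dots> = sum ((^) 2) (?V \<inter> N p)" by (rule sum.inter_restrict[symmetric]) simp
    also have "?V \<inter> N p = N p" using N_subset[of p] p by auto
    finally show ?thesis by (simp add: set_encode_def)
  qed
  have st3: "nbhd_store s3 n N" by (rule nbhd_store_cong[OF st2]) (simp_all add: s3b)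
  define s4 where "s4 = hrun Code_table \<rho> s3"
  have s4b: "s4 a = s3 a" if "a \<noteq> 28" for a
    unfolding s4_def by (rule hrun_frame) (use that in \<open>simp add: Code_table_def\<close>)
  have s4a: "s4 28 c \<noteq> 0 \<longleftrightarrow> (\<exists>p. minimal_nbhd ?V N p \<and> set_encode (N p) = c)" for c
  proof -
    let ?P = "\<lambda>i f. (\<forall>a. a \<noteq> 28 \<longrightarrow> f a = s3 a) \<and> (\<forall>c. f 28 c \<noteq> 0 \<longleftrightarrow> (\<exists>p<i. minimal_nbhd ?V N p \<and> set_encode (N p) = c))"
    let ?f = "\<lambda>i. hrun (As 28 (Ld 27 (Vr 1)) (eOr (Ld 28 (Ld 27 (Vr 1))) (Ld 26 (Vr 1)))) (\<rho>(1 := i))"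
    have "?P n (forloop ?f n s3)"
    proof (rule forloop_invariant[where P = ?P])
      show "?P 0 s3" using z by (simp add: s3b s2b s1b)
      fix i f assume i: "i < n" and P: "?P i f"
      then have "f 27 i = set_encode (N i)" "f 26 i = of_bool (minimal_nbhd ?V N i)"
        using s3a[OF i] s3b[of 26] s2a[OF i] by auto
      then show "?P (Suc i) (?f i f)" using P by (auto simp: less_Suc_eq simp del: One_nat_def)
    qed
    moreover have "s4 = forloop ?f n s3" by (simp add: s4_def Code_table_def nbhd_storeD[OF st3])
    ultimately have "s4 28 c \<noteq> 0 \<longleftrightarrow> (\<exists>p<n. minimal_nbhd ?V N p \<and> set_encode (N p) = c)" by simp
    then show ?thesis using minimal_nbhdD(1) by auto
  qed
  have st4: "nbhd_store s4 n N" by (rule nbhd_store_cong[OF st3]) (simp_all add: s4b)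
  have swap: "s 28 (s 27 p + s 25 v - s 25 u) \<noteq> 0 \<longleftrightarrow> (\<exists>q. minimal_nbhd ?V N q \<and> N q = insert v (N p - {u}))"
    if "s 27 = s4 27" "s 25 = s4 25" "s 28 = s4 28" "p < n" "u < n" "v < n" "u \<in> N p" "v \<notin> N p" for s :: store and p u v
  proof -
    have "finite (N p)" using finite_N that by simp
    \<comment> \<open>Truncated subtraction is exact here, because \<open>2 ^ u\<close> is a summand
      of the code of \<open>N p\<close> and the addition is done first.\<close>
    then have "set_encode (N p) = 2 ^ u + set_encode (N p - {u})"
      using set_encode_insert[of "N p - {u}" u] that(7) by (simp add: insert_absorb)
    moreover have "set_encode (insert v (N p - {u})) = 2 ^ v + set_encode (N p - {u})"
      using \<open>finite (N p)\<close> that(8) by (intro set_encode_insert) auto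
    ultimately have "s 27 p + s 25 v - s 25 u = set_encode (insert v (N p - {u}))"
      using that s3a[of p] s1a[of u] s1a[of v] by (simp add: s4b s3b s2b)
    moreover have "set_encode (N q) = set_encode (insert v (N p - {u})) \<longleftrightarrow> N q = insert v (N p - {u})"
      if "minimal_nbhd ?V N q" for q
      using finite_N[OF minimal_nbhdD(1)[OF that]] \<open>finite (N p)\<close> by (intro set_encode_eq) auto
    ultimately show ?thesis using that(3) s4a by auto
  qed
  have tw: "heval eTw \<rho> s = of_bool (twin ?V N (\<rho> 4) (\<rho> 5))"
    if "nbhd_store s n N" "s 27 = s4 27" "s 25 = s4 25" "s 26 = s4 26" "s 28 = s4 28" "\<rho> 4 < n" "\<rho> 5 < n" for s \<rho>
  proof -
    have m: "s 26 p \<noteq> 0 \<longleftrightarrow> minimal_nbhd ?V N p" if "p < n" for p using s2a[OF that] \<open>s 26 = s4 26\<close> by (simp add: s4b s3b)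
    have sw: "heval (eSwap u v) (\<rho>(1 := p)) s = of_bool (\<rho> u \<in> N p \<longrightarrow> \<rho> v \<notin> N p \<longrightarrow>
      (\<exists>q. minimal_nbhd ?V N q \<and> N q = insert (\<rho> v) (N p - {\<rho> u})))"
      if "p < n" "u \<in> {4,5}" "v \<in> {4,5}" for p u v
    proof -
      have u: "\<rho> u < n" "\<rho> v < n" "u \<noteq> 1" "v \<noteq> 1" using that \<open>\<rho> 4 < n\<close> \<open>\<rho> 5 < n\<close> by auto
      have e: "heval (eN (Vr 1) (Vr u)) (\<rho>(1 := p)) s = of_bool (\<rho> u \<in> N p)"
        "heval (eN (Vr 1) (Vr v)) (\<rho>(1 := p)) s = of_bool (\<rho> v \<in> N p)"
        using u \<open>p < n\<close> by (simp_all add: heval_eN[OF \<open>nbhd_store s n N\<close>] del: One_nat_def)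
      have h: "heval (Ld 28 (Mi (Pl (Ld 27 (Vr 1)) (Ld 25 (Vr v))) (Ld 25 (Vr u)))) (\<rho>(1 := p)) s =
        s 28 (s 27 p + s 25 (\<rho> v) - s 25 (\<rho> u))" using u by simp
      have "\<rho> u \<in> N p \<Longrightarrow> \<rho> v \<notin> N p \<Longrightarrow> s 28 (s 27 p + s 25 (\<rho> v) - s 25 (\<rho> u)) \<noteq> 0 \<longleftrightarrow>
        (\<exists>q. minimal_nbhd ?V N q \<and> N q = insert (\<rho> v) (N p - {\<rho> u}))"
        by (rule swap) (use u \<open>p < n\<close> \<open>s 27 = s4 27\<close> \<open>s 25 = s4 25\<close> \<open>s 28 = s4 28\<close> in auto)
      then show ?thesis unfolding eSwap_def heval_e h e by auto
    qed
    have "heval eTw \<rho> s = of_bool (\<forall>p<n. s 26 p \<noteq> 0 \<longrightarrow> heval (eSwap 4 5) (\<rho>(1 := p)) s \<noteq> 0 \<and> heval (eSwap 5 4) (\<rho>(1 := p)) s \<noteq> 0)"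
      using nbhd_storeD[OF that(1)] by (auto simp: eTw_def simp del: One_nat_def)
    also have "(\<forall>p<n. s 26 p \<noteq> 0 \<longrightarrow> heval (eSwap 4 5) (\<rho>(1 := p)) s \<noteq> 0 \<and> heval (eSwap 5 4) (\<rho>(1 := p)) s \<noteq> 0) \<longleftrightarrow>
      (\<forall>p. minimal_nbhd ?V N p \<longrightarrow>
    (\<rho> 4 \<in> N p \<longrightarrow> \<rho> 5 \<notin> N p \<longrightarrow> (\<exists>q. minimal_nbhd ?V N q \<and> N q = insert (\<rho> 5) (N p - {\<rho> 4}))) \<and>
    (\<rho> 5 \<in> N p \<longrightarrow> \<rho> 4 \<notin> N p \<longrightarrow> (\<exists>q. minimal_nbhd ?V N q \<and> N q = insert (\<rho> 4) (N p - {\<rho> 5}))))"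
    proof -
      have mm: "(p < n \<and> s 26 p \<noteq> 0) \<longleftrightarrow> minimal_nbhd ?V N p" for p using m[of p] minimal_nbhdD(1)[of p] by auto
      have gen: "(\<forall>p<n. s 26 p \<noteq> 0 \<longrightarrow> H p) \<longleftrightarrow> (\<forall>p. minimal_nbhd ?V N p \<longrightarrow> B p)"
        if "\<And>p. p < n \<Longrightarrow> H p \<longleftrightarrow> B p" for H B using that mm by blast
      show ?thesis
      proof (rule gen)
        fix p assume "p < n"
        then show "(heval (eSwap 4 5) (\<rho>(1 := p)) s \<noteq> 0 \<and> heval (eSwap 5 4) (\<rho>(1 := p)) s \<noteq> 0) \<longleftrightarrow>
          (\<rho> 4 \<in> N p \<longrightarrow> \<rho> 5 \<notin> N p \<longrightarrow> (\<exists>q. minimal_nbhd ?V N q \<and> N q = insert (\<rho> 5) (N p - {\<rho> 4}))) \<and>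
          (\<rho> 5 \<in> N p \<longrightarrow> \<rho> 4 \<notin> N p \<longrightarrow> (\<exists>q. minimal_nbhd ?V N q \<and> N q = insert (\<rho> 4) (N p - {\<rho> 5})))"
          using sw[of p 4 5] sw[of p 5 4] by (simp add: disj_imp)
      qed
    qed
    also have "\<dots> \<longleftrightarrow> twin ?V N (\<rho> 4) (\<rho> 5)" by (rule twin_iff_swap[symmetric]) (use that in auto)
    finally show ?thesis .
  qed
  define s5 where "s5 = hrun Twin_ranks \<rho> s4"
  have s5b: "s5 a = s4 a" if "a \<noteq> 32" for a
    unfolding s5_def by (rule hrun_frame) (use that in \<open>simp add: Twin_ranks_def Tab_def\<close>)
  have s5a: "s5 32 v = twin_rank ?V N v" if v: "v < n" for v
  proof -
    have "s5 32 v = (\<Sum>u<n. of_bool (u < v \<and> twin ?V N u v))"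
      using v by (simp add: s5_def Twin_ranks_def hrun_Tab nbhd_storeD[OF st4] tw[OF st4] cong: sum.cong_simp conj_cong del: sum_of_bool_eq)
    also have "\<dots> = card {u. u < n \<and> (u < v \<and> twin ?V N u v)}" by (rule sum_of_bool_card)
    finally show ?thesis by (simp add: twin_rank_def)
  qed
  have st5: "nbhd_store s5 n N" by (rule nbhd_store_cong[OF st4]) (simp_all add: s5b)
  define s6 where "s6 = hrun Rep_ids \<rho> s5"
  have s6b: "s6 a = s5 a" if "a \<noteq> 30" for a
    unfolding s6_def by (rule hrun_frame) (use that in \<open>simp add: Rep_ids_def Tab_def\<close>)
  have s6a: "s6 30 v = card {u \<in> twin_reps ?V N. u < v}" if v: "v < n" for v
  proof -
    have "s6 30 v = (\<Sum>u<n. of_bool (u < v \<and> s5 32 u = 0))"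
      using v by (simp add: s6_def Rep_ids_def hrun_Tab nbhd_storeD[OF st5] del: sum_of_bool_eq)
    also have "\<dots> = card {u. u < n \<and> (u < v \<and> s5 32 u = 0)}" by (rule sum_of_bool_card)
    also have "{u. u < n \<and> (u < v \<and> s5 32 u = 0)} = {u \<in> twin_reps ?V N. u < v}" using s5a by (auto simp: twin_reps_def)
    finally show ?thesis .
  qed
  have st6: "nbhd_store s6 n N" by (rule nbhd_store_cong[OF st5]) (simp_all add: s6b)
  define s7 where "s7 = hrun Twin_ids \<rho> s6"
  have s7b: "s7 a = s6 a" if "a \<noteq> 31" for a
    unfolding s7_def by (rule hrun_frame) (use that in \<open>simp add: Twin_ids_def Tab_def\<close>)
  have tws6: "s6 27 = s4 27" "s6 25 = s4 25" "s6 26 = s4 26" "s6 28 = s4 28" by (simp_all add: s6b s5b)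
  have s7a: "s7 31 v = twin_id ?V N v" if v: "v < n" for v
  proof -
    have vV: "v \<in> ?V" using v by simp
    have "s7 31 v = (\<Sum>u<n. if s6 32 u = 0 \<and> twin ?V N u v then s6 30 u else 0)"
      using v by (simp add: s7_def Twin_ids_def hrun_Tab nbhd_storeD[OF st6] tw[OF st6] tws6 cong: sum.cong_simp conj_cong if_cong)
    also have "\<dots> = (\<Sum>u<n. if u = twin_rep ?V N v then s6 30 u else 0)"
    proof (intro sum.cong refl if_cong)
      fix u assume u: "u \<in> {..<n}"
      show "(s6 32 u = 0 \<and> twin ?V N u v) \<longleftrightarrow> u = twin_rep ?V N v"
      proof -
        have R: "s6 32 u = 0 \<longleftrightarrow> u \<in> twin_reps ?V N" using u s5a[of u] by (simp add: s6b twin_reps_def)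
        show ?thesis unfolding R
        proof
          assume "u \<in> twin_reps ?V N \<and> twin ?V N u v"
          then show "u = twin_rep ?V N v" by (elim conjE) (rule twin_rep(3)[OF nb vV])
        next
          assume "u = twin_rep ?V N v"
          then show "u \<in> twin_reps ?V N \<and> twin ?V N u v" using twin_rep(1,2)[OF nb vV] by (simp only:)
        qed
      qed
    qed
    also have "\<dots> = s6 30 (twin_rep ?V N v)" using twin_rep(1)[OF nb vV] by (simp add: twin_reps_def)
    finally show ?thesis using s6a twin_rep(1)[OF nb vV] by (simp add: twin_id_def twin_reps_def)
  qed
  have st7: "nbhd_store s7 n N" by (rule nbhd_store_cong[OF st6]) (simp_all add: s7b)
  define s8 where "s8 = hrun Class_sizes \<rho> s7"
  have s8b: "s8 a = s7 a" if "a \<noteq> 33" for a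
    unfolding s8_def by (rule hrun_frame) (use that in \<open>simp add: Class_sizes_def Tab_def\<close>)
  have s13: "s7 13 = s 13" by (simp add: s7b s6b s5b s4b s3b s2b s1b)
  have s8a: "s8 33 v = min (s 13 0 + 1) (card (twin_class ?V N v))" if v: "v < n" for v
  proof -
    let ?c = "\<Sum>u<n. of_bool (s7 31 u = s7 31 v)"
    have "s8 33 v = (if s7 13 0 < ?c then s7 13 0 + 1 else ?c)"
      using v by (simp add: s8_def Class_sizes_def hrun_Tab nbhd_storeD[OF st7] del: sum_of_bool_eq)
    moreover have "?c = card {u. u < n \<and> s7 31 u = s7 31 v}" by (rule sum_of_bool_card)
    moreover have "{u. u < n \<and> s7 31 u = s7 31 v} = twin_class ?V N v"
      using s7a twin_id(1)[OF nb] v twin_sym by (auto simp: twin_class_def)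
    ultimately show ?thesis by (simp add: s13)
  qed
  have st8: "nbhd_store s8 n N" by (rule nbhd_store_cong[OF st7]) (simp_all add: s8b)
  have \<sigma>8: "\<sigma> = hrun Check_twins \<rho> s8"
    unfolding \<sigma> Twin_tables_def s1_def s2_def s3_def s4_def s5_def s6_def s7_def s8_def by (simp only: hrun.simps)
  have s9b: "\<sigma> a = s8 a" if "a \<noteq> 34" for a
    unfolding \<sigma>8 by (rule hrun_frame) (use that in \<open>simp add: Check_twins_def\<close>)
  have "\<sigma> 34 0 = of_bool (\<forall>p<n. \<forall>u<n. minimal_nbhd ?V N p \<and> u \<in> N p \<longrightarrow>
      (\<Sum>z<n. of_bool (s8 31 u = s8 31 z \<and> z \<notin> N p)) < s8 13 0)"
  proof -
    have "heval (Sm 3 18 (eAnd (eEq (Ld 31 (Vr 4)) (Ld 31 (Vr 3))) (eNot (eN (Vr 1) (Vr 3))))) (\<rho>(1 := p, 4 := u)) s8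
      = (\<Sum>z<n. of_bool (s8 31 u = s8 31 z \<and> z \<notin> N p))" if "p < n" for p u
      unfolding heval.simps nbhd_storeD[OF st8]
    proof (rule sum.cong[OF refl])
      fix z assume "z \<in> {..<n}"
      then show "heval (eAnd (eEq (Ld 31 (Vr 4)) (Ld 31 (Vr 3))) (eNot (eN (Vr 1) (Vr 3)))) (\<rho>(1 := p, 4 := u, 3 := z)) s8
        = of_bool (s8 31 u = s8 31 z \<and> z \<notin> N p)" using that by (simp add: heval_eN[OF st8] del: One_nat_def)
    qed
    moreover have "s8 26 p \<noteq> 0 \<longleftrightarrow> minimal_nbhd ?V N p" if "p < n" for p using s2a[OF that] by (simp add: s8b s7b s6b s5b s4b s3b)
    ultimately show ?thesis
      by (auto simp: \<sigma>8 Check_twins_def nbhd_storeD[OF st8] heval_eN[OF st8] simp del: One_nat_def heval.simps(7))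
  qed
  also have "(\<forall>p<n. \<forall>u<n. minimal_nbhd ?V N p \<and> u \<in> N p \<longrightarrow>
      (\<Sum>z<n. of_bool (s8 31 u = s8 31 z \<and> z \<notin> N p)) < s8 13 0) \<longleftrightarrow> twins_bounded ?V N (s 13 0)"
  proof -
    have c: "(\<Sum>z<n. of_bool (s8 31 u = s8 31 z \<and> z \<notin> N p)) = card {z \<in> ?V. twin ?V N u z \<and> z \<notin> N p}" if "u < n" for u p
    proof -
      have "(\<Sum>z<n. of_bool (s8 31 u = s8 31 z \<and> z \<notin> N p)) = card {z. z < n \<and> (s8 31 u = s8 31 z \<and> z \<notin> N p)}"
        by (rule sum_of_bool_card)
      also have "{z. z < n \<and> (s8 31 u = s8 31 z \<and> z \<notin> N p)} = {z \<in> ?V. twin ?V N u z \<and> z \<notin> N p}"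
        using s7a twin_id(1)[OF nb] that by (auto simp: s8b)
      finally show ?thesis .
    qed
    have "u < n" if "minimal_nbhd ?V N p" "u \<in> N p" for p u using that N_subset[OF minimal_nbhdD(1)] by auto
    then show ?thesis unfolding twins_bounded_def using c minimal_nbhdD(1) by (auto simp: s8b s13 simp del: sum_of_bool_eq)
  qed
  finally have "\<sigma> 34 0 = of_bool (twins_bounded ?V N (s 13 0))" .
  then show "\<sigma> 34 0 \<noteq> 0 \<longleftrightarrow> twins_bounded ?V N (s 13 0)" by simp
  show "\<sigma> 32 v = twin_rank ?V N v" if "v < n" for v using s5a[OF that] by (simp add: s9b s8b s7b s6b)
  show "\<sigma> 31 v = twin_id ?V N v" if "v < n" for v using s7a[OF that] by (simp add: s9b s8b)
  show "\<sigma> 33 v = min (s 13 0 + 1) (card (twin_class ?V N v))" if "v < n" for v using s8a[OF that] by (simp add: s9b)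
  show "\<sigma> a = s a" if "a \<notin> {25..34}" for a
  proof -
    have "a \<noteq> 25" "a \<noteq> 26" "a \<noteq> 27" "a \<noteq> 28" "a \<noteq> 30" "a \<noteq> 31" "a \<noteq> 32" "a \<noteq> 33" "a \<noteq> 34"
      using that by auto
    then show ?thesis by (simp add: s9b s8b s7b s6b s5b s4b s3b s2b s1b)
  qed
qed

section \<open>The exhaustive search\<close>

lemma digits_surj:
  assumes "\<And>j. j < n \<Longrightarrow> f j < (B :: nat)"
  shows "\<exists>i<B ^ n. \<forall>j<n. i div B ^ j mod B = f j"
  using assms
proof (induction n arbitrary: f)
  case (Suc n)
  from Suc.IH[of "\<lambda>j. f (Suc j)"] Suc.prems obtain i where i: "i < B ^ n" "\<forall>j<n. i div B ^ j mod B = f (Suc j)"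
    by auto
  have f0: "f 0 < B" using Suc.prems[of 0] by simp
  have "f 0 + B * i < B * Suc i" using f0 by simp
  also have "\<dots> \<le> B * B ^ n" using i by (intro mult_le_mono2) simp
  finally have "f 0 + B * i < B ^ Suc n" by simp
  moreover have "(f 0 + B * i) div B ^ j mod B = f j" if "j < Suc n" for j
  proof (cases j)
    case 0
    then show ?thesis using f0 by simp
  next
    case (Suc j')
    have "(f 0 + B * i) div B = i" using f0 by simp
    then have "(f 0 + B * i) div B ^ j = i div B ^ j'" by (simp add: Suc div_mult2_eq)
    then show ?thesis using i that Suc by simp
  qed
  ultimately show ?case by blast
qed auto

text \<open>The machine has no division. Counting up once through all numbers tabulates quotients
  and remainders, after which splitting a number takes constant time per digit.\<close>

definition Digit_tables :: hc where
  "Digit_tables = Sq (As 35 (Cn 0) (Cn 0)) (Sq (As 36 (Cn 0) (Cn 0)) (For 8 16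
     (Sq (As 35 (Pl (Vr 8) (Cn 1)) (Ite (eEq (Pl (Ld 36 (Vr 8)) (Cn 1)) (Rg 14)) (Pl (Ld 35 (Vr 8)) (Cn 1)) (Ld 35 (Vr 8))))
         (As 36 (Pl (Vr 8) (Cn 1)) (Ite (eEq (Pl (Ld 36 (Vr 8)) (Cn 1)) (Rg 14)) (Cn 0) (Pl (Ld 36 (Vr 8)) (Cn 1)))))))"

lemma hrun_Digit_tables:
  assumes \<sigma>: "\<sigma> = hrun Digit_tables \<rho> s" and B: "s 14 0 = B" "2 \<le> B"
  shows "i \<le> s 16 0 \<Longrightarrow> \<sigma> 35 i = i div B" "i \<le> s 16 0 \<Longrightarrow> \<sigma> 36 i = i mod B" "a \<notin> {35,36} \<Longrightarrow> \<sigma> a = s a"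
proof -
  show "a \<notin> {35,36} \<Longrightarrow> \<sigma> a = s a" unfolding \<sigma> by (rule hrun_frame) (simp add: Digit_tables_def)
  define s1 where "s1 = s(35 := (s 35)(0 := 0), 36 := (s 36)(0 := 0))"
  let ?f = "\<lambda>i. hrun (Sq (As 35 (Pl (Vr 8) (Cn 1)) (Ite (eEq (Pl (Ld 36 (Vr 8)) (Cn 1)) (Rg 14)) (Pl (Ld 35 (Vr 8)) (Cn 1)) (Ld 35 (Vr 8))))
         (As 36 (Pl (Vr 8) (Cn 1)) (Ite (eEq (Pl (Ld 36 (Vr 8)) (Cn 1)) (Rg 14)) (Cn 0) (Pl (Ld 36 (Vr 8)) (Cn 1))))) (\<rho>(8 := i))"
  have eq: "\<sigma> = forloop ?f (s 16 0) s1" by (simp add: \<sigma> Digit_tables_def s1_def)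
  let ?P = "\<lambda>i (f :: store). f 14 0 = B \<and> (\<forall>j\<le>i. f 35 j = j div B \<and> f 36 j = j mod B)"
  have "?P (s 16 0) (forloop ?f (s 16 0) s1)"
  proof (rule forloop_invariant[where P = ?P])
    show "?P 0 s1" using B by (simp add: s1_def)
    fix i and f :: store assume P: "?P i f"
    have "?f i f 35 = (f 35)(Suc i := Suc i div B)" "?f i f 36 = (f 36)(Suc i := Suc i mod B)" "?f i f 14 0 = B"
      using P B by (auto simp: div_Suc mod_Suc)
    then show "?P (Suc i) (?f i f)" using P by (simp add: le_Suc_eq del: hrun.simps)
  qed
  then show "i \<le> s 16 0 \<Longrightarrow> \<sigma> 35 i = i div B" "i \<le> s 16 0 \<Longrightarrow> \<sigma> 36 i = i mod B" by (simp_all add: eq)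
qed

definition Digits :: "nat \<Rightarrow> nat \<Rightarrow> nat \<Rightarrow> hc" where
  "Digits A a x = Sq (As 39 (Cn 0) (Vr x)) (For 7 a (Sq (As A (Vr 7) (Ld 36 (Rg 39))) (As 39 (Cn 0) (Ld 35 (Rg 39)))))"

lemma hrun_Digits:
  assumes \<sigma>: "\<sigma> = hrun (Digits A a x) \<rho> s" and A: "A \<notin> {35,36,39}" "a \<noteq> 39"
    and QR: "\<And>i. i \<le> M \<Longrightarrow> s 35 i = i div B" "\<And>i. i \<le> M \<Longrightarrow> s 36 i = i mod B" and "\<rho> x \<le> M"
  shows "j < s a 0 \<Longrightarrow> \<sigma> A j = \<rho> x div B ^ j mod B" "b \<notin> {A,39} \<Longrightarrow> \<sigma> b = s b"
proof -
  show "b \<notin> {A,39} \<Longrightarrow> \<sigma> b = s b" unfolding \<sigma> by (rule hrun_frame) (simp add: Digits_def)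
  let ?f = "\<lambda>i. hrun (Sq (As A (Vr 7) (Ld 36 (Rg 39))) (As 39 (Cn 0) (Ld 35 (Rg 39)))) (\<rho>(7 := i))"
  define s1 where "s1 = s(39 := (s 39)(0 := \<rho> x))"
  have eq: "\<sigma> = forloop ?f (s a 0) s1" using A by (simp add: \<sigma> Digits_def s1_def)
  let ?P = "\<lambda>i (f :: store). f 35 = s 35 \<and> f 36 = s 36 \<and> f 39 0 = \<rho> x div B ^ i \<and> (\<forall>j<i. f A j = \<rho> x div B ^ j mod B)"
  have "?P (s a 0) (forloop ?f (s a 0) s1)"
  proof (rule forloop_invariant[where P = ?P])
    show "?P 0 s1" using A by (simp add: s1_def)
    fix i and f :: store assume P: "?P i f"
    have le: "\<rho> x div B ^ i \<le> M" using \<open>\<rho> x \<le> M\<close> div_le_dividend le_trans by blast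
    have "?f i f A = (f A)(i := \<rho> x div B ^ i mod B)" "?f i f 39 0 = \<rho> x div B ^ i div B" "?f i f 35 = f 35" "?f i f 36 = f 36"
      using P A QR[OF le] by auto
    then show "?P (Suc i) (?f i f)" using P by (simp add: less_Suc_eq div_mult2_eq[symmetric] mult.commute del: hrun.simps)
  qed
  then show "j < s a 0 \<Longrightarrow> \<sigma> A j = \<rho> x div B ^ j mod B" by (simp add: eq)
qed

definition Check_feasible :: hc where
  "Check_feasible = As 42 (Cn 0) (eAnd (eAnd (Ld 37 (Pl (Rg 11) (Rg 11))) (eNot (eLt (Rg 13) (Ld 37 (Pl (Rg 11) (Rg 11))))))
     (eAll 5 18 (eEq (Sm 6 11 (Ite (eEq (Ld 37 (Vr 6)) (Ld 31 (Vr 5))) (Ld 37 (Pl (Rg 11) (Vr 6))) (Cn 0))) (Ld 33 (Vr 5)))))"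

definition Build_set :: hc where
  "Build_set = Tab 40 5 18 (eLt (Ld 32 (Vr 5)) (Sm 6 11 (Ite (eEq (Ld 37 (Vr 6)) (Ld 31 (Vr 5))) (Ld 38 (Vr 6)) (Cn 0))))"

definition Cover_counts :: hc where
  "Cover_counts = Tab 41 5 18 (Sm 3 18 (eAnd (eN (Vr 5) (Vr 3)) (Ld 40 (Vr 3))))"

text \<open>A vertex of the set has a private neighbourhood iff some neighbourhood containing it is
  hit exactly once, so the precomputed table 41 keeps the test quadratic.\<close>

definition eMds :: hx where
  "eMds = eAnd (eAll 5 18 (Ld 41 (Vr 5)))
     (eAll 4 18 (eOr (eNot (Ld 40 (Vr 4))) (eEx 5 18 (eAnd (eN (Vr 5) (Vr 4)) (eEq (Ld 41 (Vr 5)) (Cn 1))))))"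

text \<open>Counts exceeding a multiplicity pass vacuously, as in \<open>passes\<close>. The double
  sum adds the count of index \<open>b\<close> once for every \<open>i \<le> b\<close>, which
  replaces multiplication by \<open>b + 1\<close>.\<close>

definition Check_set :: hc where
  "Check_set = As 42 (Cn 0) (eAnd (Rg 42) (eOr (eEx 6 11 (eLt (Ld 37 (Pl (Rg 11) (Vr 6))) (Ld 38 (Vr 6))))
     (eEq eMds (eEq (Sm 6 11 (Sm 7 11 (Ite (eLt (Vr 6) (Vr 7)) (Cn 0) (Ld 38 (Vr 6))))) (Ld 37 (Pl (Rg 11) (Rg 11)))))))"

definition Test_counts :: hc where "Test_counts = Sq (Digits 38 11 9) (Sq Build_set (Sq Cover_counts Check_set))"
definition Test_code :: hc where
  "Test_code = Sq (Sq (Digits 37 15 8) Check_feasible) (Sq (For 9 17 Test_counts) (As 43 (Cn 0) (eOr (Rg 43) (Rg 42))))"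
definition Search :: hc where "Search = Sq (As 43 (Cn 0) (Cn 0)) (For 8 16 Test_code)"
definition Write_answer :: hc where "Write_answer = As 0 (Cn 0) (eAnd (Rg 34) (Rg 43))"

definition feasible :: "nat \<Rightarrow> (nat \<Rightarrow> nat set) \<Rightarrow> nat \<Rightarrow> nat \<Rightarrow> (nat \<Rightarrow> nat) \<Rightarrow> bool" where
  "feasible n N k T X \<longleftrightarrow> 1 \<le> X (2 * k) \<and> X (2 * k) \<le> T \<and>
     (\<forall>v<n. (\<Sum>b<k. if X b = twin_id {..<n} N v then X (k + b) else 0) = min (T + 1) (card (twin_class {..<n} N v)))"

definition passes :: "nat \<Rightarrow> (nat \<Rightarrow> nat set) \<Rightarrow> nat \<Rightarrow> (nat \<Rightarrow> nat) \<Rightarrow> (nat \<Rightarrow> nat) \<Rightarrow> bool" where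
  "passes n N k X Y \<longleftrightarrow> (\<forall>b<k. Y b \<le> X (k + b)) \<longrightarrow>
     (mds {..<n} N {v \<in> {..<n}. twin_rank {..<n} N v < (\<Sum>b<k. if X b = twin_id {..<n} N v then Y b else 0)} \<longleftrightarrow>
      (\<Sum>b<k. (b + 1) * Y b) = X (2 * k))"

lemma passes_cong:
  assumes "\<And>b. b < k \<Longrightarrow> Y b = Y' b" "\<And>b. b < 2 * k + 1 \<Longrightarrow> X b = X' b"
  shows "passes n N k X Y \<longleftrightarrow> passes n N k X' Y'"
proof -
  have "(\<Sum>b<k. if X b = c then Y b else 0) = (\<Sum>b<k. if X' b = c then Y' b else 0)" for c
    using assms by (intro sum.cong) auto
  moreover have "(\<Sum>b<k. (b + 1) * Y b) = (\<Sum>b<k. (b + 1) * Y' b)" using assms by (intro sum.cong) auto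
  ultimately show ?thesis using assms by (simp add: passes_def)
qed

text \<open>Everything that the search relies on. No array from 37 to 43 occurs, and the search
  writes no others, so the property persists through all its loops.\<close>

definition search_ok :: "store \<Rightarrow> nat \<Rightarrow> (nat \<Rightarrow> nat set) \<Rightarrow> nat \<Rightarrow> nat \<Rightarrow> nat \<Rightarrow> bool" where
  "search_ok s n N k T B \<longleftrightarrow> nbhd_store s n N \<and> s 11 0 = k \<and> s 13 0 = T \<and> s 15 0 = 2 * k + 1 \<and>
     s 16 0 = B ^ (2 * k + 1) \<and> s 17 0 = B ^ k \<and>
     (\<forall>i\<le>B ^ (2 * k + 1). s 35 i = i div B \<and> s 36 i = i mod B) \<and>
     (\<forall>v<n. s 32 v = twin_rank {..<n} N v \<and> s 31 v = twin_id {..<n} N v \<and>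
       s 33 v = min (T + 1) (card (twin_class {..<n} N v)))"

lemma search_ok_cong:
  assumes "search_ok s n N k T B" "\<And>a. a \<notin> {37..43} \<Longrightarrow> s' a = s a"
  shows "search_ok s' n N k T B"
  using assms unfolding search_ok_def nbhd_store_def by simp

lemma hrun_Test_counts:
  assumes ok: "search_ok s n N k T B" and nb: "neighbourhoods {..<n} N" and B: "1 \<le> B" and i: "\<rho> 9 < B ^ k"
    and \<sigma>: "\<sigma> = hrun Test_counts \<rho> s"
  shows "\<sigma> 42 0 \<noteq> 0 \<longleftrightarrow> s 42 0 \<noteq> 0 \<and> passes n N k (s 37) (\<lambda>j. \<rho> 9 div B ^ j mod B)"
    "a \<notin> {38..42} \<Longrightarrow> \<sigma> a = s a"
proof -
  interpret neighbourhoods "{..<n}" N by fact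
  let ?V = "{..<n}"
  define Y where "Y = (\<lambda>j. \<rho> 9 div B ^ j mod B)"
  note okD = ok[unfolded search_ok_def]
  define s1 where "s1 = hrun (Digits 38 11 9) \<rho> s"
  have "B ^ k \<le> B ^ (2 * k + 1)" using B by (intro power_increasing) auto
  then have iM: "\<rho> 9 \<le> B ^ (2 * k + 1)" using i by linarith
  have s1b: "s1 a = s a" if "a \<notin> {38,39}" for a
    by (rule hrun_Digits(2)[OF s1_def, of "B ^ (2 * k + 1)" B]) (use okD iM that in auto)
  have s1a: "s1 38 j = Y j" if "j < k" for j
    unfolding Y_def by (rule hrun_Digits(1)[OF s1_def, of "B ^ (2 * k + 1)" B]) (use okD iM that in auto)
  have ok1: "search_ok s1 n N k T B" by (rule search_ok_cong[OF ok]) (auto intro: s1b)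
  define s2 where "s2 = hrun Build_set \<rho> s1"
  have s2b: "s2 a = s1 a" if "a \<noteq> 40" for a
    unfolding s2_def by (rule hrun_frame) (use that in \<open>simp add: Build_set_def Tab_def\<close>)
  define D where "D = {v \<in> ?V. twin_rank ?V N v < (\<Sum>b<k. if s 37 b = twin_id ?V N v then Y b else 0)}"
  note ok1D = ok1[unfolded search_ok_def]
  have n1: "s1 18 0 = n" "s1 11 0 = k" using ok1D nbhd_storeD by auto
  have s2a: "s2 40 v = of_bool (v \<in> D)" if v: "v < n" for v
  proof -
    have "s2 40 v = of_bool (s1 32 v < (\<Sum>b<k. if s1 37 b = s1 31 v then s1 38 b else 0))"
      using v by (simp add: s2_def Build_set_def hrun_Tab n1 cong: if_cong)
    also have "(\<Sum>b<k. if s1 37 b = s1 31 v then s1 38 b else 0) = (\<Sum>b<k. if s 37 b = twin_id ?V N v then Y b else 0)"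
      using s1a ok1D v by (intro sum.cong) (auto simp: s1b)
    finally show ?thesis using v ok1D by (simp add: D_def)
  qed
  have ok2: "search_ok s2 n N k T B" by (rule search_ok_cong[OF ok1]) (auto intro: s2b)
  have st2: "nbhd_store s2 n N" using ok2 by (simp add: search_ok_def)
  define s3 where "s3 = hrun Cover_counts \<rho> s2"
  have s3b: "s3 a = s2 a" if "a \<noteq> 41" for a
    unfolding s3_def by (rule hrun_frame) (use that in \<open>simp add: Cover_counts_def Tab_def\<close>)
  have s3a: "s3 41 v = card (N v \<inter> D)" if v: "v < n" for v
  proof -
    have "s3 41 v = (\<Sum>z<n. of_bool (z \<in> N v \<and> z \<in> D))"
      using v by (simp add: s3_def Cover_counts_def hrun_Tab nbhd_storeD[OF st2] heval_eN[OF st2] s2a cong: sum.cong_simp conj_cong del: sum_of_bool_eq)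
    also have "\<dots> = card {z. z < n \<and> (z \<in> N v \<and> z \<in> D)}" by (rule sum_of_bool_card)
    also have "{z. z < n \<and> (z \<in> N v \<and> z \<in> D)} = N v \<inter> D" by (auto simp: D_def)
    finally show ?thesis .
  qed
  have ok3: "search_ok s3 n N k T B" by (rule search_ok_cong[OF ok2]) (auto intro: s3b)
  have st3: "nbhd_store s3 n N" and k3: "s3 11 0 = k" using ok3 by (simp_all add: search_ok_def)
  have fD: "finite (N v \<inter> D)" for v by (simp add: D_def)
  have s3_40: "s3 40 v = of_bool (v \<in> D)" if "v < n" for v using s2a[OF that] by (simp add: s3b)
  have mds: "heval eMds \<rho> s3 = of_bool (mds ?V N D)"
  proof -
    have "heval eMds \<rho> s3 = of_bool ((\<forall>v<n. s3 41 v \<noteq> 0) \<and> (\<forall>u<n. u \<in> D \<longrightarrow> (\<exists>v<n. u \<in> N v \<and> s3 41 v = 1)))"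
      by (auto simp: eMds_def nbhd_storeD[OF st3] heval_eN[OF st3] s3_40 cong: conj_cong)
    also have "((\<forall>v<n. s3 41 v \<noteq> 0) \<and> (\<forall>u<n. u \<in> D \<longrightarrow> (\<exists>v<n. u \<in> N v \<and> s3 41 v = 1))) \<longleftrightarrow> mds ?V N D"
    proof -
      have "(\<forall>v<n. s3 41 v \<noteq> 0) \<longleftrightarrow> hit ?V N D" using s3a fD by (auto simp: hit_def)
      moreover have "u \<in> N v \<and> s3 41 v = 1 \<longleftrightarrow> N v \<inter> D = {u}" if "u \<in> D" "v < n" for u v
      proof -
        have "u \<in> N v \<and> (\<exists>x. N v \<inter> D = {x}) \<longleftrightarrow> N v \<inter> D = {u}"
          using that(1) by (metis IntD1 IntI insertI1 singletonD)
        then show ?thesis using s3a[OF that(2)] by (simp add: card_1_singleton_iff)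
      qed
      then have "(\<exists>v<n. u \<in> N v \<and> s3 41 v = 1) \<longleftrightarrow> (\<exists>v\<in>?V. N v \<inter> D = {u})" if "u \<in> D" for u using that by auto
      moreover have "D \<subseteq> ?V" by (auto simp: D_def)
      ultimately show ?thesis unfolding mds_def by blast
    qed
    finally show ?thesis .
  qed
  have tri: "heval (Sm 6 11 (Sm 7 11 (Ite (eLt (Vr 6) (Vr 7)) (Cn 0) (Ld 38 (Vr 6))))) \<rho> s3 = (\<Sum>b<k. (b + 1) * Y b)"
    unfolding heval.simps(7) k3
  proof (rule sum.cong[OF refl])
    fix b assume b: "b \<in> {..<k}"
    have "s3 38 b = Y b" using b s1a by (simp add: s3b s2b)
    then have "(\<Sum>i<k. heval (Ite (eLt (Vr 6) (Vr 7)) (Cn 0) (Ld 38 (Vr 6))) (\<rho>(6 := b, 7 := i)) s3) = (\<Sum>i<k. if i \<le> b then Y b else 0)"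
      by (intro sum.cong) auto
    also have "\<dots> = (\<Sum>i\<in>{..<k} \<inter> {i. i \<le> b}. Y b)" by (subst sum.inter_restrict) (auto intro: sum.cong)
    also have "{..<k} \<inter> {i. i \<le> b} = {..b}" using b by auto
    also have "(\<Sum>i\<in>{..b}. Y b) = (b + 1) * Y b" by simp
    finally show "(\<Sum>i<k. heval (Ite (eLt (Vr 6) (Vr 7)) (Cn 0) (Ld 38 (Vr 6))) (\<rho>(6 := b, 7 := i)) s3) = (b + 1) * Y b" .
  qed
  have \<sigma>4: "\<sigma> = hrun Check_set \<rho> s3"
    unfolding \<sigma> Test_counts_def s1_def s2_def s3_def by (simp only: hrun.simps)
  have s37: "s3 37 = s 37" "s3 42 = s 42" by (simp_all add: s3b s2b s1b)
  have "\<sigma> 42 0 \<noteq> 0 \<longleftrightarrow> s 42 0 \<noteq> 0 \<and> ((\<exists>b<k. s 37 (k + b) < Y b) \<or>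
    (mds ?V N D \<longleftrightarrow> (\<Sum>b<k. (b + 1) * Y b) = s 37 (2 * k)))"
  proof -
    have "(\<exists>b<k. s 37 (k + b) < s3 38 b) \<longleftrightarrow> (\<exists>b<k. s 37 (k + b) < Y b)" using s1a by (auto simp: s3b s2b)
    then show ?thesis unfolding \<sigma>4 Check_set_def by (simp add: mds tri k3 s37 mult_2 del: heval.simps(7))
  qed
  also have "\<dots> \<longleftrightarrow> s 42 0 \<noteq> 0 \<and> passes n N k (s 37) Y"
    unfolding passes_def D_def by (auto simp: not_le)
  finally show "\<sigma> 42 0 \<noteq> 0 \<longleftrightarrow> s 42 0 \<noteq> 0 \<and> passes n N k (s 37) (\<lambda>j. \<rho> 9 div B ^ j mod B)" by (simp add: Y_def)
  show "\<sigma> a = s a" if "a \<notin> {38..42}"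
    unfolding \<sigma> by (rule hrun_frame) (use that in \<open>auto simp: Test_counts_def Check_set_def Cover_counts_def Build_set_def Tab_def Digits_def\<close>)
qed

lemma hrun_Test_code:
  assumes ok: "search_ok s n N k T B" and nb: "neighbourhoods {..<n} N" and B: "1 \<le> B" and i: "\<rho> 8 < B ^ (2 * k + 1)"
    and \<sigma>: "\<sigma> = hrun Test_code \<rho> s"
  shows "\<sigma> 43 0 \<noteq> 0 \<longleftrightarrow> s 43 0 \<noteq> 0 \<or> (feasible n N k T (\<lambda>j. \<rho> 8 div B ^ j mod B) \<and>
     (\<forall>i<B ^ k. passes n N k (\<lambda>j. \<rho> 8 div B ^ j mod B) (\<lambda>j. i div B ^ j mod B)))"
    "a \<notin> {37..43} \<Longrightarrow> \<sigma> a = s a"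
proof -
  let ?V = "{..<n}"
  define X where "X = (\<lambda>j. \<rho> 8 div B ^ j mod B)"
  note okD = ok[unfolded search_ok_def]
  define s1 where "s1 = hrun (Digits 37 15 8) \<rho> s"
  have s1b: "s1 a = s a" if "a \<notin> {37,39}" for a
    by (rule hrun_Digits(2)[OF s1_def, of "B ^ (2 * k + 1)" B]) (use okD i that in auto)
  have s1a: "s1 37 j = X j" if "j < 2 * k + 1" for j
    unfolding X_def by (rule hrun_Digits(1)[OF s1_def, of "B ^ (2 * k + 1)" B]) (use okD i that in auto)
  have ok1: "search_ok s1 n N k T B" by (rule search_ok_cong[OF ok]) (auto intro: s1b)
  note ok1D = ok1[unfolded search_ok_def]
  have n1: "s1 18 0 = n" "s1 11 0 = k" "s1 13 0 = T" using ok1D nbhd_storeD by auto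
  define s2 where "s2 = hrun Check_feasible \<rho> s1"
  have s2b: "s2 a = s1 a" if "a \<noteq> 42" for a
    unfolding s2_def by (rule hrun_frame) (use that in \<open>simp add: Check_feasible_def\<close>)
  have s2a: "s2 42 0 \<noteq> 0 \<longleftrightarrow> feasible n N k T X"
  proof -
    have e: "(\<Sum>b<k. if s1 37 b = s1 31 v then s1 37 (k + b) else 0) = (\<Sum>b<k. if X b = twin_id ?V N v then X (k + b) else 0)"
      if "v < n" for v using s1a ok1D that by (intro sum.cong) auto
    have "s2 42 0 \<noteq> 0 \<longleftrightarrow> s1 37 (k + k) \<noteq> 0 \<and> s1 37 (k + k) \<le> T \<and>
        (\<forall>v<n. (\<Sum>b<k. if s1 37 b = s1 31 v then s1 37 (k + b) else 0) = s1 33 v)"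
      by (auto simp: s2_def Check_feasible_def n1 not_less cong: if_cong) (metis not_le)
    then show ?thesis using s1a[of "k + k"] e ok1D by (simp add: feasible_def mult_2 Suc_le_eq)
  qed
  have ok2: "search_ok s2 n N k T B" by (rule search_ok_cong[OF ok1]) (auto intro: s2b)
  define s3 where "s3 = hrun (For 9 17 Test_counts) \<rho> s2"
  let ?f = "\<lambda>i. hrun Test_counts (\<rho>(9 := i))"
  let ?P = "\<lambda>i (f :: store). (\<forall>a. a \<notin> {38..42} \<longrightarrow> f a = s2 a) \<and>
    (f 42 0 \<noteq> 0 \<longleftrightarrow> feasible n N k T X \<and> (\<forall>i'<i. passes n N k X (\<lambda>j. i' div B ^ j mod B)))"
  have s3: "?P (B ^ k) s3"
  proof -
    have "s3 = forloop ?f (B ^ k) s2" using ok2 by (simp add: s3_def search_ok_def)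
    moreover have "?P (B ^ k) (forloop ?f (B ^ k) s2)"
    proof (rule forloop_invariant[where P = ?P])
      show "?P 0 s2" using s2a by simp
      fix i and f :: store assume i: "i < B ^ k" and P: "?P i f"
      have okf: "search_ok f n N k T B" by (rule search_ok_cong[OF ok2]) (use P in auto)
      note b2 = hrun_Test_counts[OF okf nb B _ refl, of "\<rho>(9 := i)"]
      have "passes n N k (f 37) (\<lambda>j. i div B ^ j mod B) \<longleftrightarrow> passes n N k X (\<lambda>j. i div B ^ j mod B)"
        by (rule passes_cong) (use P s1a s2b in auto)
      then show "?P (Suc i) (?f i f)" using b2 i P by (simp add: less_Suc_eq) blast
    qed
    ultimately show ?thesis by simp
  qed
  have \<sigma>4: "\<sigma> = hrun (As 43 (Cn 0) (eOr (Rg 43) (Rg 42))) \<rho> s3"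
    unfolding \<sigma> Test_code_def s1_def s2_def s3_def by (simp only: hrun.simps(2))
  have "s3 43 = s 43" using s3 by (simp add: s2b s1b)
  then show "\<sigma> 43 0 \<noteq> 0 \<longleftrightarrow> s 43 0 \<noteq> 0 \<or> (feasible n N k T (\<lambda>j. \<rho> 8 div B ^ j mod B) \<and>
     (\<forall>i<B ^ k. passes n N k (\<lambda>j. \<rho> 8 div B ^ j mod B) (\<lambda>j. i div B ^ j mod B)))"
    using s3 unfolding \<sigma>4 X_def by simp
  show "\<sigma> a = s a" if "a \<notin> {37..43}"
    unfolding \<sigma> by (rule hrun_frame) (use that in \<open>auto simp: Test_code_def Check_feasible_def Test_counts_def Check_set_def Cover_counts_def Build_set_def Tab_def Digits_def\<close>)
qed

lemma hrun_Search:
  assumes ok: "search_ok s n N k T B" and nb: "neighbourhoods {..<n} N" and B: "B = T + 2"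
    and \<sigma>: "\<sigma> = hrun Search \<rho> s"
  shows "\<sigma> 43 0 \<noteq> 0 \<longleftrightarrow> (\<exists>c m t. (\<forall>b<k. c b < T + 2 \<and> m b < T + 2) \<and> 1 \<le> t \<and> t \<le> T \<and>
      code_ok {..<n} N (twin_id {..<n} N) k T c m t)" (is "_ \<longleftrightarrow> ?R")
    "a \<notin> {37..43} \<Longrightarrow> \<sigma> a = s a"
proof -
  have B1: "1 \<le> B" using B by simp
  define s1 where "s1 = s(43 := (s 43)(0 := 0))"
  have ok1: "search_ok s1 n N k T B" by (rule search_ok_cong[OF ok]) (auto simp: s1_def)
  let ?X = "\<lambda>i j. i div B ^ j mod B"
  let ?Q = "\<lambda>i. feasible n N k T (?X i) \<and> (\<forall>i'<B ^ k. passes n N k (?X i) (?X i'))"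
  let ?f = "\<lambda>i. hrun Test_code (\<rho>(8 := i))"
  let ?P = "\<lambda>i (f :: store). (\<forall>a. a \<notin> {37..43} \<longrightarrow> f a = s1 a) \<and> (f 43 0 \<noteq> 0 \<longleftrightarrow> (\<exists>i'<i. ?Q i'))"
  have "\<sigma> = forloop ?f (B ^ (2 * k + 1)) s1" using ok by (simp add: \<sigma> Search_def s1_def search_ok_def)
  moreover have "?P (B ^ (2 * k + 1)) (forloop ?f (B ^ (2 * k + 1)) s1)"
  proof (rule forloop_invariant[where P = ?P])
    show "?P 0 s1" by (simp add: s1_def)
    fix i and f :: store assume i: "i < B ^ (2 * k + 1)" and P: "?P i f"
    have okf: "search_ok f n N k T B" by (rule search_ok_cong[OF ok1]) (use P in auto)
    note b1 = hrun_Test_code[OF okf nb B1 _ refl, of "\<rho>(8 := i)"]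
    have f43: "?f i f 43 0 \<noteq> 0 \<longleftrightarrow> f 43 0 \<noteq> 0 \<or> ?Q i" using b1(1) i by simp
    have "(\<exists>i'<Suc i. ?Q i') \<longleftrightarrow> (\<exists>i'<i. ?Q i') \<or> ?Q i" using less_Suc_eq by blast
    then have "?f i f 43 0 \<noteq> 0 \<longleftrightarrow> (\<exists>i'<Suc i. ?Q i')" using f43 P by blast
    moreover have "\<forall>a. a \<notin> {37..43} \<longrightarrow> ?f i f a = s1 a" using b1(2) i P by simp
    ultimately show "?P (Suc i) (?f i f)" by blast
  qed
  ultimately have "\<sigma> 43 0 \<noteq> 0 \<longleftrightarrow> (\<exists>i<B ^ (2 * k + 1). ?Q i)" by simp
  also have "\<dots> \<longleftrightarrow> ?R"
  proof
    assume "\<exists>i<B ^ (2 * k + 1). ?Q i"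
    then obtain i where i: "?Q i" by blast
    let ?c = "?X i" and ?m = "\<lambda>b. ?X i (k + b)" and ?t = "?X i (2 * k)"
    have lt: "?X i j < T + 2" for j using B by simp
    have "mds {..<n} N {v \<in> {..<n}. twin_rank {..<n} N v < (\<Sum>b<k. if ?c b = twin_id {..<n} N v then x b else 0)} \<longleftrightarrow>
        (\<Sum>b<k. (b + 1) * x b) = ?t" if x: "\<forall>b<k. x b \<le> ?m b" for x
    proof -
      \<comment> \<open>Multiplicities are digits below \<open>B\<close>, hence so are admissible
        counts, and \<open>x\<close> is among the vectors enumerated by the inner loop.\<close>
      have "x b < B" if "b < k" for b using le_less_trans[OF x[rule_format, OF that] lt[of "k + b"]] B by simp
      then obtain i' where i': "i' < B ^ k" "\<forall>b<k. ?X i' b = x b" using digits_surj[of k x B] by blast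
      then have "passes n N k (?X i) (?X i')" using i by blast
      then have "passes n N k (?X i) x" using passes_cong[of k x "?X i'" "?X i" "?X i" n N] i'(2) by simp
      then show ?thesis using x by (simp add: passes_def)
    qed
    then have "code_ok {..<n} N (twin_id {..<n} N) k T ?c ?m ?t"
      using i unfolding code_ok_def feasible_def by simp
    moreover have "1 \<le> ?t" "?t \<le> T" using i by (simp_all add: feasible_def)
    ultimately show ?R using lt by (intro exI[of _ ?c] exI[of _ ?m] exI[of _ ?t]) simp
  next
    assume ?R
    then obtain c m t where c: "\<forall>b<k. c b < T + 2 \<and> m b < T + 2" "1 \<le> t" "t \<le> T"
      and code: "code_ok {..<n} N (twin_id {..<n} N) k T c m t" by blast
    let ?F = "\<lambda>j. if j < k then c j else if j < 2 * k then m (j - k) else t"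
    have "?F j < B" if "j < 2 * k + 1" for j using c that B by auto
    then obtain i where i: "i < B ^ (2 * k + 1)" "\<forall>j<2 * k + 1. ?X i j = ?F j"
      using digits_surj[of "2 * k + 1" ?F B] by blast
    have X: "?X i b = c b" "?X i (k + b) = m b" if "b < k" for b using i(2) that by simp_all
    have Xt: "?X i (2 * k) = t" using i(2) by simp
    have "(\<Sum>b<k. if ?X i b = j then ?X i (k + b) else 0) = (\<Sum>b<k. if c b = j then m b else 0)" for j
      using X by (intro sum.cong) auto
    then have "feasible n N k T (?X i)" using code c Xt by (simp add: feasible_def code_ok_def)
    moreover have "passes n N k (?X i) Y" for Y
    proof -
      have "(\<Sum>b<k. if ?X i b = j then Y b else 0) = (\<Sum>b<k. if c b = j then Y b else 0)" for j
        using X by (intro sum.cong) auto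
      then show ?thesis using code X Xt by (simp add: passes_def code_ok_def)
    qed
    ultimately show "\<exists>i<B ^ (2 * k + 1). ?Q i" using i(1) by blast
  qed
  finally show "\<sigma> 43 0 \<noteq> 0 \<longleftrightarrow> ?R" .
  show "\<sigma> a = s a" if "a \<notin> {37..43}"
    unfolding \<sigma> by (rule hrun_frame) (use that in \<open>auto simp: Search_def Test_code_def Check_feasible_def Test_counts_def Check_set_def Cover_counts_def Build_set_def Tab_def Digits_def\<close>)
qed

section \<open>From graphs to the search criterion\<close>

definition closed_nbhd :: "'a set \<Rightarrow> 'a set set \<Rightarrow> 'a \<Rightarrow> 'a set" where
  "closed_nbhd V E v = {u \<in> V. u = v \<or> {u, v} \<in> E}"

lemma neighbourhoods_closed_nbhd:
  assumes "simple_graph V E"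
  shows "neighbourhoods V (closed_nbhd V E)"
  using assms by unfold_locales (auto simp: simple_graph_def closed_nbhd_def insert_commute)

lemma dominating_iff_hit: "dominating V E D \<longleftrightarrow> D \<subseteq> V \<and> hit V (closed_nbhd V E) D"
  unfolding dominating_def hit_def closed_nbhd_def by auto

lemma minimal_dominating_iff_mds:
  assumes "simple_graph V E"
  shows "minimal_dominating V E D \<longleftrightarrow> mds V (closed_nbhd V E) D"
proof -
  interpret neighbourhoods V "closed_nbhd V E" by (rule neighbourhoods_closed_nbhd[OF assms])
  show ?thesis unfolding minimal_dominating_def mds_iff_minimal dominating_iff_hit by auto
qed

lemma k_equidominating_iff_keq:
  assumes "simple_graph V E"
  shows "k_equidominating k V E \<longleftrightarrow> keq k V (closed_nbhd V E)"
proof -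
  have "(t \<ge> 1 \<and> (\<forall>v\<in>V. w v \<ge> 1) \<and> X) \<and> (\<forall>v\<in>V. w v \<in> {1..k}) \<longleftrightarrow> t \<ge> 1 \<and> (\<forall>v\<in>V. w v \<in> {1..k}) \<and> X"
    for w :: "'a \<Rightarrow> nat" and t :: nat and X by auto
  then show ?thesis
    unfolding k_equidominating_def equidominating_structure_def keq_def mds_structure_def
      minimal_dominating_iff_mds[OF assms] by simp
qed

locale solver_graph =
  fixes n k :: nat and E :: "nat set set"
  assumes inst: "graph_instance n E k"
begin

abbreviation "V \<equiv> {..<n}"
abbreviation "N \<equiv> closed_nbhd V E"
definition "isol = {v. v < n \<and> (\<forall>u<n. {v, u} \<notin> E)}"
text \<open>\<open>J\<close> exceeds the threshold \<open>2 * k ^ 4\<close> of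
  \<open>keq_add_isolated\<close>, and \<open>T\<close> dominates the bound of
  \<open>target_le\<close> for this \<open>J\<close>, namely
  \<open>k * k * (3 * k ^ 4 + k ^ 3 + 3 * k + 3)\<close>.\<close>

definition "J = 3 * k ^ 4"
definition "T = 10 * k ^ 6"
definition "K = {v. v < n \<and> (v \<notin> isol \<or> card {u \<in> isol. u < v} < J)}"

lemma graph: "simple_graph V E" and k1: "1 \<le> k"
  using inst by (auto simp: graph_instance_def)

sublocale neighbourhoods V N by (rule neighbourhoods_closed_nbhd[OF graph])

lemma isol_eq: "isol = {v \<in> V. N v = {v}}"
proof -
  have loop: "{v, v} \<notin> E" for v using graph by (force simp: simple_graph_def)
  have "N v = {v} \<longleftrightarrow> (\<forall>u<n. {v, u} \<notin> E)" if "v < n" for v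
  proof
    assume e: "N v = {v}"
    show "\<forall>u<n. {v, u} \<notin> E"
    proof (intro allI impI notI)
      fix u assume u: "u < n" "{v, u} \<in> E"
      then have "u \<in> N v" by (simp add: closed_nbhd_def insert_commute)
      then have "u = v" using e by simp
      then show False using u(2) loop by simp
    qed
  next
    assume "\<forall>u<n. {v, u} \<notin> E"
    then show "N v = {v}" using that unfolding closed_nbhd_def by (auto simp: insert_commute)
  qed
  then show ?thesis by (auto simp: isol_def)
qed

lemma card_isol_K: "card {v \<in> K. N v = {v}} \<le> J" "K \<noteq> V \<Longrightarrow> card {v \<in> K. N v = {v}} = J"
proof -
  have f: "finite isol" by (simp add: isol_def)
  have e: "{v \<in> K. N v = {v}} = {v \<in> isol. card {u \<in> isol. u < v} < J}"
    unfolding K_def using isol_eq by auto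
  have lt: "card {u \<in> isol. u < v} < card isol" if "v \<in> isol" for v
    using that f by (intro psubset_card_mono) auto
  show "card {v \<in> K. N v = {v}} = J" if "K \<noteq> V"
  proof -
    obtain v where v: "v \<in> isol" "\<not> card {u \<in> isol. u < v} < J" using \<open>K \<noteq> V\<close> by (auto simp: K_def)
    then have "J \<le> card isol" using lt[OF v(1)] by simp
    then show ?thesis unfolding e by (rule card_rank_less[OF f])
  qed
  show "card {v \<in> K. N v = {v}} \<le> J"
  proof (cases "J \<le> card isol")
    case True
    then show ?thesis unfolding e using card_rank_less[OF f True] by simp
  next
    case False
    have "card {v \<in> isol. card {u \<in> isol. u < v} < J} \<le> card isol" using f by (intro card_mono) auto
    then show ?thesis unfolding e using False by simp
  qed
qed

lemma keq_K: "keq k V N \<longleftrightarrow> keq k K N"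
proof (cases "K = V")
  case False
  define I1 where "I1 = V - K"
  have I1: "I1 \<subseteq> V" "\<And>v. v \<in> I1 \<Longrightarrow> N v = {v}" "K = V - I1"
    using isol_eq by (auto simp: I1_def K_def)
  have c: "card {v \<in> K. N v = {v}} = J" by (rule card_isol_K(2)[OF False])
  have "2 * k ^ 4 < J" using k1 by (simp add: J_def)
  moreover from this have "{v \<in> K. N v = {v}} \<noteq> {}" using c by (metis card.empty not_less_zero)
  then obtain i where "i \<in> K" "N i = {i}" by auto
  ultimately show ?thesis
    using keq_remove_isolated[OF I1, of k i] keq_add_isolated[OF I1, of k] c by auto
qed simp

text \<open>Nonisolated vertices are endpoints of edges, at most two per edge; this is how the
  number of edges enters the running time.\<close>

lemma card_K: "card K \<le> card (\<Union>E) + J" "card (\<Union>E) \<le> n" "card (\<Union>E) \<le> 2 * card E"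
proof -
  have EV: "E \<subseteq> Pow V" "\<And>e. e \<in> E \<Longrightarrow> card e = 2" using graph by (auto simp: simple_graph_def)
  have fE: "finite (\<Union>E)" "\<Union>E \<subseteq> V" using EV finite_subset[of "\<Union>E" V] by auto
  have "K \<subseteq> \<Union>E \<union> {v \<in> K. N v = {v}}"
  proof
    fix v assume v: "v \<in> K"
    show "v \<in> \<Union>E \<union> {v \<in> K. N v = {v}}"
    proof (cases "v \<in> isol")
      case True
      then show ?thesis using v isol_eq by auto
    next
      case False
      then have "\<exists>u. {v, u} \<in> E" using v by (auto simp: isol_def K_def)
      then show ?thesis by auto
    qed
  qed
  moreover have "finite K" by (simp add: K_def)
  ultimately have "card K \<le> card (\<Union>E \<union> {v \<in> K. N v = {v}})" using fE by (intro card_mono) auto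
  also have "\<dots> \<le> card (\<Union>E) + card {v \<in> K. N v = {v}}" by (rule card_Un_le)
  finally show "card K \<le> card (\<Union>E) + J" using card_isol_K(1) by simp
  show "card (\<Union>E) \<le> n" using card_mono[OF _ fE(2)] by simp
  have "card (\<Union>E) \<le> sum card E" by (rule card_Union_le_sum_card)
  also have "\<dots> = 2 * card E" using EV(2) by simp
  finally show "card (\<Union>E) \<le> 2 * card E" .
qed

context
  fixes f :: "nat \<Rightarrow> nat"
  assumes f: "bij_betw f {..<card K} K"
begin

definition "N1 i = {j. j < card K \<and> (i = j \<or> {f i, f j} \<in> E)}"

lemma neighbourhoods_N1: "neighbourhoods {..<card K} N1"
  by unfold_locales (auto simp: N1_def insert_commute)

lemma N_f: "i < card K \<Longrightarrow> N (f i) = f ` N1 i"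
proof -
  assume i: "i < card K"
  have im: "f ` {..<card K} = K" and inj: "inj_on f {..<card K}" using f by (auto simp: bij_betw_def)
  have I1: "V - K \<subseteq> V" "\<And>v. v \<in> V - K \<Longrightarrow> N v = {v}" "K = V - (V - K)"
    using isol_eq by (auto simp: K_def)
  have fi: "f i \<in> K" using im i by auto
  have sub: "N (f i) \<subseteq> K" by (rule N_subset_K[OF I1(1) _ I1(3) fi]) (rule I1(2))
  show "N (f i) = f ` N1 i"
  proof
    show "N (f i) \<subseteq> f ` N1 i"
    proof
      fix u assume u: "u \<in> N (f i)"
      then have "u \<in> f ` {..<card K}" using sub im by auto
      then obtain j where j: "j < card K" "u = f j" by auto
      have "i = j \<or> {f i, f j} \<in> E"
        using u j i inj by (auto simp: closed_nbhd_def inj_on_def insert_commute)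
      then show "u \<in> f ` N1 i" using j by (auto simp: N1_def)
    qed
    show "f ` N1 i \<subseteq> N (f i)"
    proof
      fix u assume "u \<in> f ` N1 i"
      then obtain j where j: "j < card K" "u = f j" "i = j \<or> {f i, f j} \<in> E" by (auto simp: N1_def)
      have "f j \<in> K" using im j by auto
      then have "f j < n" by (simp add: K_def)
      then show "u \<in> N (f i)" using j by (auto simp: closed_nbhd_def insert_commute)
    qed
  qed
qed

lemma keq_N1: "keq k V N \<longleftrightarrow> keq k {..<card K} N1"
proof -
  have "keq k {..<card K} N1 \<longleftrightarrow> keq k K N"
    using N_f by (intro keq_bij[OF f]) (auto simp: N1_def)
  then show ?thesis using keq_K by simp
qed

lemma T_bound: "k * k * (J + k ^ 3 + 3 * k + 3) \<le> T"
proof -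
  have p: "k ^ i \<le> k ^ 4" if "i \<le> 4" for i using k1 that by (intro power_increasing) auto
  have "J + k ^ 3 + 3 * k + 3 \<le> 10 * k ^ 4" using p[of 3] p[of 1] p[of 0] by (simp add: J_def)
  then have "k * k * (J + k ^ 3 + 3 * k + 3) \<le> k * k * (10 * k ^ 4)" by (rule mult_le_mono2)
  also have "\<dots> = T" by (simp add: T_def power_numeral_reduce)
  finally show ?thesis .
qed

lemma keq_iff_search:
  "keq k V N \<longleftrightarrow> twins_bounded {..<card K} N1 T \<and>
    (\<exists>c m t. (\<forall>b<k. c b < T + 2 \<and> m b < T + 2) \<and> 1 \<le> t \<and> t \<le> T \<and>
      code_ok {..<card K} N1 (twin_id {..<card K} N1) k T c m t)"
proof -
  note nb = neighbourhoods_N1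
  interpret I: neighbourhoods "{..<card K}" N1 by (rule nb)
  have "k \<le> k ^ 6" using k1 by (simp add: self_le_power)
  then have "k \<le> T" by (simp add: T_def)
  then interpret I: index_neighbourhoods "{..<card K}" N1 "twin_id {..<card K} N1" k T
    using k1 twin_id[OF nb] by unfold_locales (auto simp: twin_reps_def)
  have im: "f ` {..<card K} = K" and inj: "inj_on f {..<card K}" using f by (auto simp: bij_betw_def)
  have "card {i \<in> {..<card K}. N1 i = {i}} \<le> card {v \<in> K. N v = {v}}"
  proof (rule card_inj_on_le[of f])
    show "inj_on f {i \<in> {..<card K}. N1 i = {i}}" using inj by (rule inj_on_subset) auto
    show "f ` {i \<in> {..<card K}. N1 i = {i}} \<subseteq> {v \<in> K. N v = {v}}" using im N_f by auto
    show "finite {v \<in> K. N v = {v}}" by (simp add: K_def)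
  qed
  then have iso: "card {i \<in> {..<card K}. N1 i = {i}} \<le> J" using card_isol_K(1) by simp
  have "t \<le> T" if "mds_structure k {..<card K} N1 w t" for w t
    using I.target_le[OF that k1 iso] T_bound by simp
  then show ?thesis unfolding keq_N1 by (rule I.keq_iff_code)
qed

end

end

text \<open>Nothing is promised about scratch arrays except cell 0 of array 100, which stays 0 and
  serves as the value of every free variable of a block.\<close>

definition runs :: "com \<Rightarrow> store \<Rightarrow> store \<Rightarrow> nat \<Rightarrow> bool" where
  "runs c \<sigma> \<sigma>' t \<longleftrightarrow> (\<forall>s. (\<forall>a<100. s a = \<sigma> a) \<longrightarrow> s 100 0 = 0 \<longrightarrow>
     (\<exists>u s'. exec c s u s' \<and> u \<le> t \<and> (\<forall>a<100. s' a = \<sigma>' a) \<and> s' 100 0 = 0))"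

definition blk :: "hc \<Rightarrow> com" where "blk c = ccompile c (\<lambda>_. 100) 101"

abbreviation \<rho>0 :: "nat \<Rightarrow> nat" where "\<rho>0 \<equiv> \<lambda>_. 0"

lemma runs_blk:
  assumes "creads c \<subseteq> {..<100}" "cbounds c \<inter> cwrites c = {}"
  shows "runs (blk c) \<sigma> (hrun c \<rho>0 \<sigma>) (ccost c (\<lambda>a. \<sigma> a 0))"
  unfolding runs_def
proof (intro allI impI)
  fix s assume s: "\<forall>a<100. s a = \<sigma> a" "s 100 0 = 0"
  have "\<exists>t s'. exec (ccompile c (\<lambda>_. 100) 101) s t s' \<and> t \<le> ccost c (\<lambda>a. \<sigma> a 0) \<and>
    (\<forall>a<100. s' a = hrun c \<rho>0 \<sigma> a) \<and> (\<forall>a. 100 \<le> a \<longrightarrow> a < 101 \<longrightarrow> s' a = s a)"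
    by (rule ccompile_correct) (use assms s in auto)
  then obtain t s' where "exec (blk c) s t s'" "t \<le> ccost c (\<lambda>a. \<sigma> a 0)" "\<forall>a<100. s' a = hrun c \<rho>0 \<sigma> a"
    "\<forall>a. 100 \<le> a \<longrightarrow> a < 101 \<longrightarrow> s' a = s a" unfolding blk_def by blast
  moreover from this(4) have "s' 100 0 = 0" using s(2) by simp
  ultimately show "\<exists>u s'. exec (blk c) s u s' \<and> u \<le> ccost c (\<lambda>a. \<sigma> a 0) \<and> (\<forall>a<100. s' a = hrun c \<rho>0 \<sigma> a) \<and> s' 100 0 = 0"
    by blast
qed

lemma runs_Seq:
  assumes "runs c \<sigma> \<sigma>' t" "runs d \<sigma>' \<sigma>'' u"
  shows "runs (Seq c d) \<sigma> \<sigma>'' (t + u)"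
  unfolding runs_def
proof (intro allI impI)
  fix s assume "\<forall>a<100. s a = \<sigma> a" "s 100 0 = 0"
  then obtain x s' where 1: "exec c s x s'" "x \<le> t" "\<forall>a<100. s' a = \<sigma>' a" "s' 100 0 = 0"
    using assms(1) unfolding runs_def by blast
  then obtain y s'' where 2: "exec d s' y s''" "y \<le> u" "\<forall>a<100. s'' a = \<sigma>'' a" "s'' 100 0 = 0"
    using assms(2) unfolding runs_def by blast
  show "\<exists>u' s'. exec (Seq c d) s u' s' \<and> u' \<le> t + u \<and> (\<forall>a<100. s' a = \<sigma>'' a) \<and> s' 100 0 = 0"
    using exec.Seq[OF 1(1) 2(1)] 1(2) 2 by (intro exI conjI) (assumption, auto)
qed

lemma runs_Cond:
  assumes "a < 100" "b < 100" "\<sigma> b 0 < \<sigma> a 0 \<Longrightarrow> runs c \<sigma> \<sigma>' t" "\<not> \<sigma> b 0 < \<sigma> a 0 \<Longrightarrow> runs d \<sigma> \<sigma>' t"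
  shows "runs (Cond (Minus (reg a) (reg b)) c d) \<sigma> \<sigma>' (t + 6)"
  unfolding runs_def
proof (intro allI impI)
  fix s assume s: "\<forall>a<100. s a = \<sigma> a" "s 100 0 = 0"
  show "\<exists>u s'. exec (Cond (Minus (reg a) (reg b)) c d) s u s' \<and> u \<le> t + 6 \<and> (\<forall>a<100. s' a = \<sigma>' a) \<and> s' 100 0 = 0"
  proof (cases "\<sigma> b 0 < \<sigma> a 0")
    case True
    then obtain x s' where 1: "exec c s x s'" "x \<le> t" "\<forall>a<100. s' a = \<sigma>' a" "s' 100 0 = 0"
      using assms(3) s unfolding runs_def by blast
    show ?thesis by (intro exI conjI, rule exec.CondTrue[OF _ 1(1)]) (use 1 True s assms in auto)
  next
    case False
    then obtain x s' where 1: "exec d s x s'" "x \<le> t" "\<forall>a<100. s' a = \<sigma>' a" "s' 100 0 = 0"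
      using assms(4) s unfolding runs_def by blast
    show ?thesis by (intro exI conjI, rule exec.CondFalse[OF _ 1(1)]) (use 1 False s assms in auto)
  qed
qed

section \<open>The solver\<close>

text \<open>The blocks are compiled separately because the scalars bounding the loops of one block
  are computed by earlier ones, while \<open>ccompile_correct\<close> forbids a block to write its
  own bounds.\<close>

definition Solver :: com where
  "Solver = Seq (blk Read_input) (Seq (blk Set_scalars) (Seq (blk Select_vertices) (Seq (blk Set_powers) (Seq (blk Twin_tables) (Seq (blk Digit_tables) (Seq (blk Search) (blk Write_answer)))))))"

lemmas Twin_tables_defs = Twin_tables_def Powers_of_two_def Minimal_nbhds_def Nbhd_codes_def Code_table_def Twin_ranks_def Rep_ids_def Twin_ids_def Class_sizes_def Check_twins_def Tab_def
lemmas Search_defs = Search_def Test_code_def Check_feasible_def Test_counts_def Check_set_def Cover_counts_def Build_set_def eMds_def Tab_def Digits_def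

lemma xreads_eKpow: "xreads (eKpow i c) \<subseteq> {11}" and xbounds_eKpow: "xbounds (eKpow i c) \<subseteq> {11}"
  and xdepth_eKpow: "xdepth (eKpow i c) = i"
  by (induction i) auto

lemma blocks_wf:
  "creads Read_input \<subseteq> {..<100}" "cbounds Read_input = {}" "cdepth Read_input = 0"
  "creads Set_scalars \<subseteq> {..<100}" "cbounds Set_scalars \<subseteq> {11}" "cbounds Set_scalars \<inter> cwrites Set_scalars = {}" "cdepth Set_scalars = 6"
  "creads Select_vertices \<subseteq> {..<100}" "cbounds Select_vertices \<subseteq> {10}" "cbounds Select_vertices \<inter> cwrites Select_vertices = {}" "cdepth Select_vertices = 2"
  "creads Set_powers \<subseteq> {..<100}" "cbounds Set_powers \<subseteq> {11,14,15}" "cbounds Set_powers \<inter> cwrites Set_powers = {}" "cdepth Set_powers = 2"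
  "creads Twin_tables \<subseteq> {..<100}" "cbounds Twin_tables \<subseteq> {18}" "cbounds Twin_tables \<inter> cwrites Twin_tables = {}" "cdepth Twin_tables = 3"
  "creads Digit_tables \<subseteq> {..<100}" "cbounds Digit_tables \<subseteq> {16}" "cbounds Digit_tables \<inter> cwrites Digit_tables = {}" "cdepth Digit_tables = 1"
  "creads Search \<subseteq> {..<100}" "cbounds Search \<inter> cwrites Search = {}"
  "creads Write_answer \<subseteq> {..<100}" "cbounds Write_answer = {}" "cdepth Write_answer = 0"
  using xreads_eKpow[of 4 3] xreads_eKpow[of 6 10] xbounds_eKpow[of 4 3] xbounds_eKpow[of 6 10]
  by (auto simp: Read_input_def Set_scalars_def Select_vertices_def Set_powers_def Twin_tables_defs Digit_tables_def Search_defs Write_answer_def xdepth_eKpow simp del: eKpow.simps)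

text \<open>\<open>ccost_le\<close> alone would raise a common maximum of the vertex number and the
  exponential bounds to the full nesting depth. Keeping cells 16 and 17 as single factors leaves a
  remainder that is only quadratic.\<close>

lemma Search_cost:
  assumes "\<beta> 18 + \<beta> 15 \<le> X" "\<beta> 11 \<le> X" "1 \<le> \<beta> 16 * \<beta> 17"
  shows "ccost Search \<beta> \<le> (4 * csize Search + 42) * (\<beta> 16 * \<beta> 17 * (X + 1) ^ 2)"
proof -
  define A where "A = csize Search"
  define Y where "Y = (X + 1) ^ 2"
  have Y: "1 \<le> Y" by (simp add: Y_def)
  have up: "m * (X + 1) ^ d \<le> A * Y" if "m \<le> A" "d \<le> 2" for m d
    unfolding Y_def using that by (intro mult_le_mono power_increasing) auto
  have bd: "ccost c \<beta> \<le> A * Y" if "cbounds c \<subseteq> {11,15,18}" "csize c \<le> A" "cdepth c \<le> 2" for c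
  proof -
    have "ccost c \<beta> \<le> csize c * (X + 1) ^ cdepth c"
      using ccost_le[of c \<beta> X] that(1) assms(1,2) by fastforce
    then show ?thesis using up[OF that(2,3)] by linarith
  qed
  have a: "ccost (Sq (Digits 37 15 8) Check_feasible) \<beta> \<le> A * Y"
    by (rule bd) (auto simp: A_def Search_def Test_code_def, auto simp: Search_defs)
  have b: "ccost Test_counts \<beta> \<le> A * Y"
    by (rule bd) (auto simp: A_def Search_def Test_code_def, auto simp: Search_defs)
  have c: "ccost (As 43 (Cn 0) (eOr (Rg 43) (Rg 42))) \<beta> \<le> A * Y"
    by (rule bd) (auto simp: A_def Search_def Test_code_def)
  have d: "ccost (As 43 (Cn 0) (Cn 0)) \<beta> \<le> A * Y"
    by (rule bd) (auto simp: A_def Search_def)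
  let ?P = "\<beta> 16" and ?R = "\<beta> 17"
  have P: "1 \<le> ?P" "1 \<le> ?R" using assms(3) by (cases ?P; cases ?R; simp)+
  have e: "ccost Test_code \<beta> = ccost (Sq (Digits 37 15 8) Check_feasible) \<beta> + (?R * (ccost Test_counts \<beta> + 12) + 9) + ccost (As 43 (Cn 0) (eOr (Rg 43) (Rg 42))) \<beta>"
    by (simp add: Test_code_def)
  have "?R * (ccost Test_counts \<beta> + 12) \<le> ?R * ((A + 12) * Y)"
    using b Y by (intro mult_le_mono2) (simp add: distrib_right)
  moreover have "A * Y \<le> ?R * (A * Y)" "Y \<le> ?R * Y" using P by simp_all
  ultimately have "ccost Test_code \<beta> + 12 \<le> ?R * ((A + 12) * Y) + 2 * (?R * (A * Y)) + 21 * (?R * Y)"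
    using a c Y unfolding e by linarith
  also have "\<dots> = ?R * Y * (3 * A + 33)" by (simp add: algebra_simps)
  finally have "?P * (ccost Test_code \<beta> + 12) \<le> ?P * (?R * Y * (3 * A + 33))" by (rule mult_le_mono2)
  moreover have "ccost Search \<beta> = ccost (As 43 (Cn 0) (Cn 0)) \<beta> + (?P * (ccost Test_code \<beta> + 12) + 9)"
    by (simp add: Search_def)
  moreover have "(A + 9) * Y \<le> ?P * ?R * ((A + 9) * Y)" using assms(3) by simp
  moreover have "A * Y + 9 \<le> (A + 9) * Y" using Y by (simp add: distrib_right)
  ultimately have "ccost Search \<beta> \<le> ?P * ?R * ((A + 9) * Y) + ?P * (?R * Y * (3 * A + 33))"
    using d by linarith
  also have "\<dots> = (4 * A + 42) * (?P * ?R * Y)" by (simp add: algebra_simps)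
  finally show ?thesis by (simp add: A_def Y_def)
qed

definition solver_size :: nat where
  "solver_size = csize Read_input + csize Set_scalars + csize Select_vertices + csize Set_powers + csize Twin_tables + csize Digit_tables + (4 * csize Search + 42) + csize Write_answer"

lemma solver_size_le:
  "csize Set_scalars \<le> solver_size" "csize Select_vertices \<le> solver_size" "csize Set_powers \<le> solver_size" "csize Twin_tables \<le> solver_size"
  "csize Digit_tables \<le> solver_size" "4 * csize Search + 42 \<le> solver_size"
  by (simp_all add: solver_size_def)

context solver_graph
begin

abbreviation "B \<equiv> T + 2"
abbreviation "n1 \<equiv> card K"

lemma solver_runs:
  assumes s: "s 0 0 = n" "s 0 1 = k" "\<And>u v. u < n \<Longrightarrow> v < n \<Longrightarrow> s 1 (u * n + v) \<noteq> 0 \<longleftrightarrow> {u, v} \<in> E" "s 28 = (\<lambda>_. 0)"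
  shows "\<exists>\<sigma> t. runs Solver s \<sigma> t \<and> \<sigma> 0 0 = of_bool (k_equidominating k {..<n} E) \<and>
    t \<le> solver_size * ((k + 1) ^ 6 + (n + 1) ^ 2 + (B + 2 * k + 2) ^ 2 + (n1 + 1) ^ 3 + (B ^ (2 * k + 1) + 1)
      + B ^ (2 * k + 1) * B ^ k * (n1 + 2 * k + 2) ^ 2 + 1)"
proof -
  define s1 where "s1 = hrun Read_input \<rho>0 s"
  define s2 where "s2 = hrun Set_scalars \<rho>0 s1"
  note s12 = hrun_Set_scalars[OF s2_def[unfolded s1_def] s(1,2)]
  have s1_11: "s1 11 0 = k" using s by (simp add: s1_def Read_input_def)
  have T: "s2 13 0 = T" "s2 14 0 = B" "s2 12 0 = J" using s12 by (simp_all add: T_def J_def)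
  define s3 where "s3 = hrun Select_vertices \<rho>0 s2"
  have adj: "s2 1 (u * n + v) \<noteq> 0 \<longleftrightarrow> {u, v} \<in> E" if "u < n" "v < n" for u v
    using s(3)[OF that] s12(7)[of 1] by simp
  note h = hrun_Select_vertices[OF s3_def s12(1), where adj = "\<lambda>u v. {u, v} \<in> E", folded isol_def, unfolded T(3), folded K_def]
  have s3: "\<And>v. v < n \<Longrightarrow> s3 20 v = v * n" "s3 18 0 = n1" "bij_betw (s3 24) {..<n1} K"
    "\<And>a. a \<notin> {18,20,21,22,23,24} \<Longrightarrow> s3 a = s2 a"
    by (rule h, rule adj, assumption+)+
  define f where "f = s3 24"
  have f: "bij_betw f {..<n1} K" using s3(3) by (simp add: f_def)
  have fn: "f i < n" if "i < n1" for i using f that by (auto simp: bij_betw_def K_def)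
  define s4 where "s4 = hrun Set_powers \<rho>0 s3"
  note s4 = hrun_Set_powers[OF s4_def]
  have s4a: "s4 18 0 = n1" "s4 24 = f" "s4 11 0 = k" "s4 13 0 = T" "s4 14 0 = B" "s4 15 0 = 2 * k + 1" "s4 1 = s 1" "s4 28 = s 28"
    "s4 16 0 = B ^ (2 * k + 1)" "s4 17 0 = B ^ k"
    using s4 s3(2) by (simp_all add: f_def s3(4) s12(1,2,6,7) T)
  have st4: "nbhd_store s4 n1 (N1 f)"
    unfolding nbhd_store_def
  proof (intro conjI allI impI)
    fix i j assume ij: "i < n1" "j < n1"
    have "s4 20 (f i) = f i * n" using s3(1)[OF fn[OF ij(1)]] s4(3)[of 20] by simp
    then show "(i = j \<or> s4 1 (s4 20 (s4 24 i) + s4 24 j) \<noteq> 0) \<longleftrightarrow> j \<in> N1 f i"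
      using s(3)[OF fn[OF ij(1)] fn[OF ij(2)]] ij by (simp add: s4a s4a(7)[unfolded One_nat_def] N1_def[OF f])
  qed (simp add: s4a)
  have nb: "neighbourhoods {..<n1} (N1 f)" by (rule neighbourhoods_N1[OF f])
  define s5 where "s5 = hrun Twin_tables \<rho>0 s4"
  note s5 = hrun_Twin_tables[OF s5_def st4 nb s4a(8)[unfolded s(4)]]
  define s6 where "s6 = hrun Digit_tables \<rho>0 s5"
  have s5_14: "s5 14 0 = B" "s5 16 0 = B ^ (2 * k + 1)" using s5(5)[of 14] s5(5)[of 16] by (simp_all add: s4a)
  note s6 = hrun_Digit_tables[OF s6_def s5_14(1)]
  have s56: "s6 a = s4 a" if "a \<notin> {25..36}" for a using s6(3)[of a] s5(5)[of a] that by auto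
  have st6: "nbhd_store s6 n1 (N1 f)" by (rule nbhd_store_cong[OF st4]) (simp_all add: s56)
  have ok: "search_ok s6 n1 (N1 f) k T B"
    unfolding search_ok_def using st6 s5(1,2,3) s6 s5_14 by (simp add: s56 s4a)
  define s7 where "s7 = hrun Search \<rho>0 s6"
  note s7 = hrun_Search[OF ok nb refl s7_def]
  define s8 where "s8 = hrun Write_answer \<rho>0 s7"
  have s34: "s7 34 = s5 34" using s7(2)[of 34] s6(3)[of 34] by simp
  have "s8 0 0 = of_bool (s5 34 0 \<noteq> 0 \<and> s7 43 0 \<noteq> 0)" by (simp add: s8_def Write_answer_def s34)
  also have "s5 34 0 \<noteq> 0 \<longleftrightarrow> twins_bounded {..<n1} (N1 f) T" using s5(4) by (simp add: s4a)
  finally have "s8 0 0 = of_bool (k_equidominating k {..<n} E)"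
    unfolding s7(1) keq_iff_search[OF f, symmetric] k_equidominating_iff_keq[OF graph] .
  moreover define t where "t = ccost Read_input (\<lambda>a. s a 0) + (ccost Set_scalars (\<lambda>a. s1 a 0) + (ccost Select_vertices (\<lambda>a. s2 a 0) +
    (ccost Set_powers (\<lambda>a. s3 a 0) + (ccost Twin_tables (\<lambda>a. s4 a 0) + (ccost Digit_tables (\<lambda>a. s5 a 0) + (ccost Search (\<lambda>a. s6 a 0) + ccost Write_answer (\<lambda>a. s7 a 0)))))))"
  have "runs Solver s s8 t"
  proof -
    have r: "runs (blk c) x (hrun c \<rho>0 x) (ccost c (\<lambda>a. x a 0))"
      if "creads c \<subseteq> {..<100}" "cbounds c \<inter> cwrites c = {}" for c x
      using runs_blk[OF that] .
    show ?thesis unfolding Solver_def t_def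
      by (rule runs_Seq[OF r[of Read_input s, folded s1_def] runs_Seq[OF r[of Set_scalars s1, folded s2_def]
        runs_Seq[OF r[of Select_vertices s2, folded s3_def] runs_Seq[OF r[of Set_powers s3, folded s4_def]
        runs_Seq[OF r[of Twin_tables s4, folded s5_def] runs_Seq[OF r[of Digit_tables s5, folded s6_def]
        runs_Seq[OF r[of Search s6, folded s7_def] r[of Write_answer s7, folded s8_def]]]]]]]])
        (simp_all add: blocks_wf)
  qed
  moreover have "t \<le> solver_size * ((k + 1) ^ 6 + (n + 1) ^ 2 + (B + 2 * k + 2) ^ 2 + (n1 + 1) ^ 3 + (B ^ (2 * k + 1) + 1)
      + B ^ (2 * k + 1) * B ^ k * (n1 + 2 * k + 2) ^ 2 + 1)"
  proof -
    have c: "ccost Read_input (\<lambda>a. s a 0) \<le> csize Read_input * 1"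
      using ccost_le[of Read_input "\<lambda>a. s a 0" 0] blocks_wf(2,3) by simp
    have c2: "ccost Set_scalars (\<lambda>a. s1 a 0) \<le> csize Set_scalars * (k + 1) ^ 6"
      using ccost_le[of Set_scalars "\<lambda>a. s1 a 0" k] blocks_wf(5,7) s1_11 by fastforce
    have c3: "ccost Select_vertices (\<lambda>a. s2 a 0) \<le> csize Select_vertices * (n + 1) ^ 2"
      using ccost_le[of Select_vertices "\<lambda>a. s2 a 0" n] blocks_wf(9,11) s12(1) by fastforce
    have s3v: "s3 11 0 = k" "s3 14 0 = B" "s3 15 0 = 2 * k + 1" by (simp_all add: s3(4) s12(1,2,6,7) T)
    have c4: "ccost Set_powers (\<lambda>a. s3 a 0) \<le> csize Set_powers * (B + 2 * k + 1 + 1) ^ 2"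
      using ccost_le[of Set_powers "\<lambda>a. s3 a 0" "B + 2 * k + 1"] blocks_wf(13,15) s3v by fastforce
    have c5: "ccost Twin_tables (\<lambda>a. s4 a 0) \<le> csize Twin_tables * (n1 + 1) ^ 3"
      using ccost_le[of Twin_tables "\<lambda>a. s4 a 0" n1] blocks_wf(17,19) s4a(1) by fastforce
    have c6: "ccost Digit_tables (\<lambda>a. s5 a 0) \<le> csize Digit_tables * (B ^ (2 * k + 1) + 1) ^ 1"
      using ccost_le[of Digit_tables "\<lambda>a. s5 a 0" "B ^ (2 * k + 1)"] blocks_wf(21,23) s5_14(2) by fastforce
    have c7: "ccost Search (\<lambda>a. s6 a 0) \<le> (4 * csize Search + 42) * (B ^ (2 * k + 1) * B ^ k * (n1 + 2 * k + 1 + 1) ^ 2)"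
    proof -
      have v: "s6 18 0 = n1" "s6 15 0 = 2 * k + 1" "s6 11 0 = k" "s6 16 0 = B ^ (2 * k + 1)" "s6 17 0 = B ^ k"
        by (simp_all add: s56 s4a)
      have "0 < B ^ (2 * k + 1) * B ^ k" by simp
      then have "1 \<le> B ^ (2 * k + 1) * B ^ k" by (simp only: Suc_le_eq One_nat_def)
      then show ?thesis
        using Search_cost[of "\<lambda>a. s6 a 0" "n1 + 2 * k + 1", unfolded v] by linarith
    qed
    have c8: "ccost Write_answer (\<lambda>a. s7 a 0) \<le> csize Write_answer * 1"
      using ccost_le[of Write_answer "\<lambda>a. s7 a 0" 0] blocks_wf(27,28) by simp
    have "B + 2 * k + 1 + 1 = B + 2 * k + 2" "n1 + 2 * k + 1 + 1 = n1 + 2 * k + 2" by simp_all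
    note c' = c2 c3 c4[unfolded this(1)] c5 c6[unfolded power_one_right] c7[unfolded this(2)]
    have m: "a \<le> solver_size * x" if "a \<le> b * x" "b \<le> solver_size" for a b x
      using that by (meson le_trans mult_le_mono1)
    have "ccost Read_input (\<lambda>a. s a 0) + ccost Write_answer (\<lambda>a. s7 a 0) \<le> solver_size * 1"
      using c c8 by (simp add: solver_size_def)
    then show ?thesis
      using m[OF c'(1) solver_size_le(1)] m[OF c'(2) solver_size_le(2)] m[OF c'(3) solver_size_le(3)]
        m[OF c'(4) solver_size_le(4)] m[OF c'(5) solver_size_le(5)] m[OF c'(6) solver_size_le(6)]
      unfolding t_def distrib_left by linarith
  qed
  ultimately show ?thesis by blast
qed

end

section \<open>Running time and kernel\<close>

text \<open>The product \<open>W * n0 ^ 2\<close> of the search has to become a sum. From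
  \<open>n0 ^ 2 \<le> n * (2 * m)\<close> and two uses of
  \<open>2 * (x * y) \<le> x ^ 2 + y ^ 2\<close> it is at most
  \<open>n * m ^ 2 + n ^ 2 + W ^ 4\<close>, and \<open>4 * (3 * k + 1) \<le> 16 * k\<close> explains
  the exponent. In \<open>n0 ^ 3\<close>, two factors are bounded by \<open>2 * m\<close> and one by
  \<open>n\<close>.\<close>

lemma solver_time_arith:
  fixes n m k n0 n1 B :: nat
  assumes k: "1 \<le> k" and B: "B = 10 * k ^ 6 + 2" and n1: "n1 \<le> n0 + 3 * k ^ 4" and n0: "n0 \<le> n" "n0 \<le> 2 * m"
  shows "(k + 1) ^ 6 + (n + 1) ^ 2 + (B + 2 * k + 2) ^ 2 + (n1 + 1) ^ 3 + (B ^ (2 * k + 1) + 1)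
      + B ^ (2 * k + 1) * B ^ k * (n1 + 2 * k + 2) ^ 2 + 1 \<le> 300 * (n * m ^ 2 + n ^ 2 + B ^ (16 * k))"
proof -
  define W where "W = B ^ (3 * k + 1)"
  have B1: "1 \<le> B" using B by simp
  have kp: "k ^ i \<le> k ^ 6" if "i \<le> 6" for i using k that by (intro power_increasing) auto
  have Bk: "3 * k ^ 4 + 2 * k + 2 \<le> B" using kp[of 4] kp[of 1] k B by simp
  have BW: "B ^ i \<le> W" if "i \<le> 4" for i unfolding W_def using B1 k that by (intro power_increasing) auto
  have W1: "1 \<le> W" using BW[of 0] by simp
  have W4: "W ^ 4 \<le> B ^ (16 * k)" unfolding W_def power_mult[symmetric] using B1 k by (intro power_increasing) auto
  have Wp: "W ^ i \<le> W ^ 4" if "i \<le> 4" for i using W1 that by (intro power_increasing) auto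
  have a1: "(k + 1) ^ 6 \<le> 64 * W"
  proof -
    have "(k + 1) ^ 6 \<le> (2 * k) ^ 6" using k by (intro power_mono) auto
    also have "\<dots> = 64 * k ^ 6" by (simp add: power_mult_distrib)
    also have "\<dots> \<le> 64 * B" using B by simp
    also have "\<dots> \<le> 64 * W" using BW[of 1] by simp
    finally show ?thesis .
  qed
  have sq: "2 * (x * y) \<le> x ^ 2 + y ^ 2" for x y :: nat
  proof -
    have "0 \<le> (int x - int y) ^ 2" by simp
    then have "int (2 * (x * y)) \<le> int (x ^ 2 + y ^ 2)" by (simp add: power2_diff)
    then show ?thesis by (simp only: of_nat_le_iff)
  qed
  have a2: "(n + 1) ^ 2 \<le> 2 * n ^ 2 + 2"
  proof -
    have "2 * n \<le> n ^ 2 + 1" using sq[of n 1] by simp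
    then show ?thesis by (simp add: power2_eq_square)
  qed
  have a3: "(B + 2 * k + 2) ^ 2 \<le> 4 * W"
  proof -
    have "(B + 2 * k + 2) ^ 2 \<le> (2 * B) ^ 2" using Bk by (intro power_mono) auto
    also have "\<dots> = 4 * B ^ 2" by (simp add: power_mult_distrib)
    finally show ?thesis using BW[of 2] by simp
  qed
  have mx: "(a + b) ^ i \<le> 2 ^ i * (a ^ i + b ^ i)" for a b i :: nat
  proof -
    have "(a + b) ^ i \<le> (2 * max a b) ^ i" by (intro power_mono) auto
    also have "\<dots> = 2 ^ i * max a b ^ i" by (simp add: power_mult_distrib)
    also have "max a b ^ i \<le> a ^ i + b ^ i" by (cases "a \<le> b") (auto simp: max_def)
    finally show ?thesis by simp
  qed
  have a4: "(n1 + 1) ^ 3 \<le> 8 * n0 ^ 3 + 8 * W"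
  proof -
    have "(n1 + 1) ^ 3 \<le> (n0 + B) ^ 3" using n1 Bk by (intro power_mono) auto
    also have "\<dots> \<le> 2 ^ 3 * (n0 ^ 3 + B ^ 3)" by (rule mx)
    finally show ?thesis using BW[of 3] by simp
  qed
  have a5: "B ^ (2 * k + 1) + 1 \<le> 2 * W"
  proof -
    have "B ^ (2 * k + 1) \<le> W" unfolding W_def using B1 by (intro power_increasing) auto
    then show ?thesis using W1 by simp
  qed
  have a6: "B ^ (2 * k + 1) * B ^ k * (n1 + 2 * k + 2) ^ 2 \<le> 4 * (W * n0 ^ 2) + 4 * W ^ 2"
  proof -
    have "B ^ (2 * k + 1) * B ^ k = W" unfolding W_def power_add[symmetric] by (simp add: algebra_simps)
    moreover have "(n1 + 2 * k + 2) ^ 2 \<le> (n0 + B) ^ 2" using n1 Bk by (intro power_mono) auto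
    moreover have "(n0 + B) ^ 2 \<le> 2 ^ 2 * (n0 ^ 2 + B ^ 2)" by (rule mx)
    moreover have "2 ^ 2 * (n0 ^ 2 + B ^ 2) \<le> 4 * n0 ^ 2 + 4 * W" using BW[of 2] by simp
    ultimately have "B ^ (2 * k + 1) * B ^ k * (n1 + 2 * k + 2) ^ 2 \<le> W * (4 * n0 ^ 2 + 4 * W)"
      by (metis le_trans mult_le_mono2)
    then show ?thesis by (simp add: algebra_simps power2_eq_square)
  qed
  have b1: "n0 ^ 3 \<le> 4 * (n * m ^ 2)"
  proof -
    have "n0 ^ 3 = n0 * n0 ^ 2" by (simp add: power_numeral_reduce)
    also have "\<dots> \<le> n * (2 * m) ^ 2" using n0 by (intro mult_le_mono power_mono) auto
    finally show ?thesis by (simp add: power_mult_distrib)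
  qed
  have b2: "W * n0 ^ 2 \<le> n * m ^ 2 + n ^ 2 + W ^ 4"
  proof -
    have "n0 ^ 2 \<le> n * (2 * m)" unfolding power2_eq_square using n0 by (intro mult_le_mono) auto
    then have "W * n0 ^ 2 \<le> n * (2 * (W * m))" by (metis mult.left_commute mult_le_mono2)
    also have "\<dots> \<le> n * (W ^ 2 + m ^ 2)" using sq[of W m] by (rule mult_le_mono2)
    also have "\<dots> = n * W ^ 2 + n * m ^ 2" by (simp add: algebra_simps)
    also have "n * W ^ 2 \<le> n ^ 2 + (W ^ 2) ^ 2" using sq[of n "W ^ 2"] by simp
    finally show ?thesis by simp
  qed
  have c: "W \<le> W ^ 4" "W ^ 2 \<le> W ^ 4" "1 \<le> W ^ 4" using Wp[of 1] Wp[of 2] Wp[of 0] by simp_all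
  show ?thesis unfolding distrib_left using a1 a2 a3 a4 a5 a6 b1 b2 c W4 by linarith
qed

text \<open>From \<open>k = 12\<close> on,
  \<open>10 * k ^ 6 + 2 \<le> 12 * k ^ 6 \<le> k ^ 7\<close>, and 112 is \<open>7 * 16\<close>; the
  finitely many smaller \<open>k\<close> go into the constant.\<close>

lemma B_power_bound: "\<exists>C. \<forall>k\<ge>1. (10 * k ^ 6 + 2) ^ (16 * k) \<le> C * (k ^ k) ^ 112"
proof -
  define C where "C = 1 + (\<Sum>j<12. (10 * j ^ 6 + 2) ^ (16 * j) :: nat)"
  have "(10 * k ^ 6 + 2) ^ (16 * k) \<le> C * (k ^ k) ^ 112" if k: "1 \<le> k" for k
  proof (cases "k < 12")
    case True
    have "(10 * k ^ 6 + 2) ^ (16 * k) \<le> (\<Sum>j<12. (10 * j ^ 6 + 2) ^ (16 * j))"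
      using True by (intro member_le_sum) auto
    then have "(10 * k ^ 6 + 2) ^ (16 * k) \<le> C * 1" by (simp add: C_def)
    also have "\<dots> \<le> C * (k ^ k) ^ 112" using k by (intro mult_le_mono2) simp
    finally show ?thesis .
  next
    case False
    have "1 \<le> k ^ 6" using k by simp
    then have "10 * k ^ 6 + 2 \<le> 12 * k ^ 6" by linarith
    also have "\<dots> \<le> k * k ^ 6" using False by (intro mult_le_mono1) simp
    also have "\<dots> = k ^ 7" by (simp add: power_numeral_reduce)
    finally have "(10 * k ^ 6 + 2) ^ (16 * k) \<le> (k ^ 7) ^ (16 * k)" by (intro power_mono) auto
    also have "\<dots> = 1 * (k ^ k) ^ 112" unfolding power_mult[symmetric] by (simp add: mult.commute)
    also have "\<dots> \<le> C * (k ^ k) ^ 112" by (intro mult_le_mono1) (simp add: C_def)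
    finally show ?thesis .
  qed
  then show ?thesis by blast
qed

text \<open>From \<open>k = 19\<close> on, the quadratic exponent wins because \<open>6 * 19\<close>
  is at least 112; smaller \<open>k\<close> go into the constant.\<close>

lemma power_112_bound: "\<exists>C. \<forall>k\<ge>1. ((k :: nat) ^ k) ^ 112 \<le> C * k ^ (6 * k ^ 2 + 7 * k + 1)"
proof -
  define C where "C = 1 + (\<Sum>j<19. (j ^ j) ^ 112 :: nat)"
  have "(k ^ k) ^ 112 \<le> C * k ^ (6 * k ^ 2 + 7 * k + 1)" if k: "1 \<le> k" for k
  proof (cases "k < 19")
    case True
    have "(k ^ k) ^ 112 \<le> (\<Sum>j<19. (j ^ j) ^ 112)"
      using True by (intro member_le_sum) auto
    then have "(k ^ k) ^ 112 \<le> C * 1" by (simp add: C_def)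
    also have "\<dots> \<le> C * k ^ (6 * k ^ 2 + 7 * k + 1)" using k by (intro mult_le_mono2) simp
    finally show ?thesis .
  next
    case False
    then have "19 * k \<le> k ^ 2" by (simp add: power2_eq_square)
    then have "k * 112 \<le> 6 * k ^ 2 + 7 * k + 1" by linarith
    then have "k ^ (k * 112) \<le> k ^ (6 * k ^ 2 + 7 * k + 1)" using k by (rule power_increasing)
    then have "(k ^ k) ^ 112 \<le> 1 * k ^ (6 * k ^ 2 + 7 * k + 1)" by (simp only: power_mult mult_1)
    also have "\<dots> \<le> C * k ^ (6 * k ^ 2 + 7 * k + 1)" by (intro mult_le_mono1) (simp add: C_def)
    finally show ?thesis .
  qed
  then show ?thesis by blast
qed

lemma runs_mono:
  assumes "runs c \<sigma> \<sigma>' t" "t \<le> u"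
  shows "runs c \<sigma> \<sigma>' u"
  unfolding runs_def
proof (intro allI impI)
  fix s assume "\<forall>a<100. s a = \<sigma> a" "s 100 0 = 0"
  then obtain x s' where 1: "exec c s x s'" "x \<le> t" "\<forall>a<100. s' a = \<sigma>' a" "s' 100 0 = 0"
    using assms(1) unfolding runs_def by blast
  from 1(2) assms(2) have "x \<le> u" by simp
  with 1 show "\<exists>x s'. exec c s x s' \<and> x \<le> u \<and> (\<forall>a<100. s' a = \<sigma>' a) \<and> s' 100 0 = 0"
    by (intro exI conjI)
qed

lemma (in solver_graph) solver_runs':
  assumes s: "s 0 0 = n" "s 0 1 = k" "\<And>u v. u < n \<Longrightarrow> v < n \<Longrightarrow> s 1 (u * n + v) \<noteq> 0 \<longleftrightarrow> {u, v} \<in> E" "s 28 = (\<lambda>_. 0)"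
  shows "\<exists>\<sigma>. runs Solver s \<sigma> (solver_size * (300 * (n * card E ^ 2 + n ^ 2 + (10 * k ^ 6 + 2) ^ (16 * k)))) \<and>
    \<sigma> 0 0 = of_bool (k_equidominating k {..<n} E)"
proof -
  obtain \<sigma> t where 1: "runs Solver s \<sigma> t" "\<sigma> 0 0 = of_bool (k_equidominating k {..<n} E)"
    "t \<le> solver_size * ((k + 1) ^ 6 + (n + 1) ^ 2 + (B + 2 * k + 2) ^ 2 + (n1 + 1) ^ 3 + (B ^ (2 * k + 1) + 1)
      + B ^ (2 * k + 1) * B ^ k * (n1 + 2 * k + 2) ^ 2 + 1)" using solver_runs[OF s] by blast
  note 1(3)
  also have "\<dots> \<le> solver_size * (300 * (n * card E ^ 2 + n ^ 2 + B ^ (16 * k)))"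
    using card_K by (intro mult_le_mono2 solver_time_arith k1) (auto simp: T_def J_def)
  finally have "t \<le> solver_size * (300 * (n * card E ^ 2 + n ^ 2 + (10 * k ^ 6 + 2) ^ (16 * k)))"
    unfolding T_def .
  from runs_mono[OF 1(1) this] 1(2) show ?thesis by (intro exI[of _ \<sigma>] conjI)
qed

lemma encode_graph_store:
  "encode_graph n E k 0 0 = n" "encode_graph n E k 0 1 = k"
  "u < n \<Longrightarrow> v < n \<Longrightarrow> encode_graph n E k 1 (u * n + v) \<noteq> 0 \<longleftrightarrow> {u, v} \<in> E"
  "2 \<le> a \<Longrightarrow> encode_graph n E k a = (\<lambda>_. 0)"
proof -
  assume uv: "u < n" "v < n"
  have "u * n + v < (u + 1) * n" using uv by simp
  also have "\<dots> \<le> n * n" using uv by (intro mult_le_mono1) simp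
  finally show "encode_graph n E k 1 (u * n + v) \<noteq> 0 \<longleftrightarrow> {u, v} \<in> E"
    using uv by (simp add: encode_graph_def)
qed (auto simp: encode_graph_def)

lemma solves_k_Equidomination:
  "\<exists>c C. solves_in_time c k_Equidomination (\<lambda>n m k. C * (n * m ^ 2 + n ^ 2 + k ^ (6 * k ^ 2 + 7 * k + 1)))"
proof -
  obtain C1 where C1: "\<And>k. 1 \<le> k \<Longrightarrow> (10 * k ^ 6 + 2) ^ (16 * k) \<le> C1 * (k ^ k) ^ 112"
    using B_power_bound by blast
  obtain C2 where C2: "\<And>k :: nat. 1 \<le> k \<Longrightarrow> (k ^ k) ^ 112 \<le> C2 * k ^ (6 * k ^ 2 + 7 * k + 1)"
    using power_112_bound by blast
  define C where "C = solver_size * 300 * (1 + C1 * C2)"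
  have "solves_in_time Solver k_Equidomination (\<lambda>n m k. C * (n * m ^ 2 + n ^ 2 + k ^ (6 * k ^ 2 + 7 * k + 1)))"
    unfolding solves_in_time_def
  proof (intro allI impI)
    fix n E k assume inst: "graph_instance n E k"
    then interpret solver_graph n k E by unfold_locales
    let ?s = "encode_graph n E k" and ?t = "solver_size * (300 * (n * card E ^ 2 + n ^ 2 + (10 * k ^ 6 + 2) ^ (16 * k)))"
    have "\<exists>\<sigma>. runs Solver ?s \<sigma> ?t \<and> \<sigma> 0 0 = of_bool (k_equidominating k {..<n} E)"
      by (rule solver_runs') (use encode_graph_store in auto)
    then obtain \<sigma> where \<sigma>: "runs Solver ?s \<sigma> ?t" "\<sigma> 0 0 = of_bool (k_equidominating k {..<n} E)" by blast
    have "?s 100 0 = 0" by (simp add: encode_graph_def)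
    then obtain u s' where r: "exec Solver ?s u s'" "u \<le> ?t" "\<forall>a<100. s' a = \<sigma> a"
      using \<sigma>(1) unfolding runs_def by blast
    have "(10 * k ^ 6 + 2) ^ (16 * k) \<le> C1 * C2 * k ^ (6 * k ^ 2 + 7 * k + 1)"
      using order_trans[OF C1[OF k1] mult_le_mono2[OF C2[OF k1]]] by (simp only: mult.assoc)
    also have "\<dots> \<le> (1 + C1 * C2) * k ^ (6 * k ^ 2 + 7 * k + 1)" by (intro mult_le_mono1) simp
    finally have "n * card E ^ 2 + n ^ 2 + (10 * k ^ 6 + 2) ^ (16 * k) \<le>
      (1 + C1 * C2) * (n * card E ^ 2) + (1 + C1 * C2) * n ^ 2 + (1 + C1 * C2) * k ^ (6 * k ^ 2 + 7 * k + 1)"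
      by (intro add_mono) auto
    also have "\<dots> = (1 + C1 * C2) * (n * card E ^ 2 + n ^ 2 + k ^ (6 * k ^ 2 + 7 * k + 1))"
      by (simp only: distrib_left)
    finally have "solver_size * (300 * (n * card E ^ 2 + n ^ 2 + (10 * k ^ 6 + 2) ^ (16 * k))) \<le>
      solver_size * (300 * ((1 + C1 * C2) * (n * card E ^ 2 + n ^ 2 + k ^ (6 * k ^ 2 + 7 * k + 1))))"
      by (intro mult_le_mono2)
    then have "u \<le> C * (n * card E ^ 2 + n ^ 2 + k ^ (6 * k ^ 2 + 7 * k + 1))"
      using r(2) unfolding C_def mult.assoc by (rule order_trans[rotated])
    moreover have "s' 0 0 = (if ((n, E), k) \<in> k_Equidomination then 1 else 0)"
      using r(3) \<sigma>(2) inst by (simp add: k_Equidomination_def)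
    ultimately show "\<exists>t s. exec Solver (encode_graph n E k) t s \<and> t \<le> C * (n * card E ^ 2 + n ^ 2 + k ^ (6 * k ^ 2 + 7 * k + 1)) \<and>
           s 0 0 = (if ((n, E), k) \<in> k_Equidomination then 1 else 0)"
      using r(1) by blast
  qed
  then show ?thesis by blast
qed

section \<open>The target problem and the kernelization\<close>

definition hits :: "'a set set \<Rightarrow> 'a set \<Rightarrow> bool" where
  "hits F D \<longleftrightarrow> (\<forall>B\<in>F. B \<inter> D \<noteq> {})"

definition minimal_hitting :: "'a set set \<Rightarrow> 'a set \<Rightarrow> bool" where
  "minimal_hitting F D \<longleftrightarrow> hits F D \<and> \<not> (\<exists>D'. D' \<subset> D \<and> hits F D')"

text \<open>The parameter \<open>0\<close> is used for instances that have been solved already.\<close>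

definition k_Equihitting :: param_problem where
  "k_Equihitting = {((n, F), k). if k = 0 then F \<noteq> {} else
     (\<exists>w t. t \<ge> 1 \<and> (\<forall>v<n. w v \<in> {1..k}) \<and>
       (\<forall>D. D \<subseteq> {..<n} \<longrightarrow> (minimal_hitting F D \<longleftrightarrow> sum w D = (t :: nat))))}"

lemma k_Equihitting_closed_nbhd:
  assumes inst: "graph_instance n E k"
  shows "((n, closed_nbhd {..<n} E ` {..<n}), k) \<in> k_Equihitting \<longleftrightarrow> ((n, E), k) \<in> k_Equidomination"
proof -
  interpret solver_graph n k E by unfold_locales (rule inst)
  have h: "hits (N ` V) D \<longleftrightarrow> hit V N D" for D by (simp add: hits_def hit_def)
  have "minimal_hitting (N ` V) D \<longleftrightarrow> mds V N D" if "D \<subseteq> V" for D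
    using that unfolding minimal_hitting_def mds_iff_minimal h by simp
  then have "((n, N ` V), k) \<in> k_Equihitting \<longleftrightarrow> keq k V N"
    using k1 by (simp add: k_Equihitting_def keq_def mds_structure_def Ball_def)
  then show ?thesis using inst k_equidominating_iff_keq[OF graph] by (simp add: k_Equidomination_def)
qed

definition Save_input :: hc where "Save_input = Sq (As 50 (Cn 0) (Ld 0 (Cn 0))) (As 51 (Cn 0) (Ld 0 (Cn 1)))"
definition Self_power :: hc where "Self_power = Sq (As 52 (Cn 0) (Cn 1)) (For 7 51 (As 52 (Cn 0) (Sm 3 51 (Rg 52))))"
text \<open>The answer bit becomes the number of listed sets. With 0 elements a listed set is empty,
  so the family is nonempty exactly for yes-instances.\<close>

definition Emit_answer :: hc where
  "Emit_answer = Sq (As 0 (Cn 1) (Ld 0 (Cn 0))) (Sq (As 0 (Cn 2) (Cn 0)) (As 0 (Cn 0) (Cn 0)))"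
text \<open>The adjacency matrix already lies in array 1 row by row; setting its diagonal turns it
  into the incidence matrix of the closed neighbourhoods.\<close>

definition Emit_nbhds :: hc where
  "Emit_nbhds = Sq (For 5 50 (As 1 (Pl (Sm 3 50 (Vr 5)) (Vr 5)) (Cn 1)))
     (Sq (As 0 (Cn 1) (Rg 50)) (As 0 (Cn 2) (Rg 51)))"

text \<open>
  The test \<open>k < n\<close> comes first because computing \<open>k ^ k\<close> takes quadratic time in \<open>k\<close>, which need not
  be polynomial in the length of the input.
\<close>

definition Kernel :: com where
  "Kernel = Seq (blk Save_input) (Cond (Minus (reg 50) (reg 51))
     (Seq (blk Self_power) (Cond (Minus (reg 50) (reg 52)) (Seq Solver (blk Emit_answer)) (blk Emit_nbhds)))
     (blk Emit_nbhds))"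

lemma kernel_wf:
  "creads Save_input \<subseteq> {..<100}" "cbounds Save_input = {}" "cdepth Save_input = 0"
  "creads Self_power \<subseteq> {..<100}" "cbounds Self_power \<inter> cwrites Self_power = {}" "cbounds Self_power = {51}" "cdepth Self_power = 2"
  "creads Emit_answer \<subseteq> {..<100}" "cbounds Emit_answer = {}" "cdepth Emit_answer = 0"
  "creads Emit_nbhds \<subseteq> {..<100}" "cbounds Emit_nbhds \<inter> cwrites Emit_nbhds = {}" "cbounds Emit_nbhds = {50}" "cdepth Emit_nbhds = 2"
  by (auto simp: Save_input_def Self_power_def Emit_answer_def Emit_nbhds_def)

lemma hrun_Self_power: "hrun Self_power \<rho> s = s(52 := (s 52)(0 := s 51 0 ^ s 51 0))"
proof -
  have "forloop (\<lambda>i. hrun (As 52 (Cn 0) (Sm 3 51 (Rg 52))) (\<rho>(7 := i))) m (s(52 := (s 52)(0 := 1)))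
    = s(52 := (s 52)(0 := s 51 0 ^ m))" for m
    by (induction m) (auto simp: fun_eq_iff)
  then show ?thesis by (simp add: Self_power_def)
qed

lemma hrun_Emit_nbhds:
  assumes \<sigma>: "\<sigma> = hrun Emit_nbhds \<rho> s" and s: "s 50 0 = n" "s 51 0 = k" "s 0 0 = n"
  shows "\<sigma> 0 0 = n" "\<sigma> 0 1 = n" "\<sigma> 0 2 = k"
    "u < n \<Longrightarrow> v < n \<Longrightarrow> \<sigma> 1 (u * n + v) \<noteq> 0 \<longleftrightarrow> u = v \<or> s 1 (u * n + v) \<noteq> 0"
proof -
  let ?f = "\<lambda>i. hrun (As 1 (Pl (Sm 3 50 (Vr 5)) (Vr 5)) (Cn 1)) (\<rho>(5 := i))"
  let ?P = "\<lambda>i (f :: store). (\<forall>a. a \<noteq> 1 \<longrightarrow> f a = s a) \<and> (\<forall>x. f 1 x \<noteq> 0 \<longleftrightarrow> (\<exists>j<i. x = n * j + j) \<or> s 1 x \<noteq> 0)"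
  define s1 where "s1 = forloop ?f n s"
  have s1: "?P n s1" unfolding s1_def
  proof (rule forloop_invariant[where P = ?P])
    fix i and f :: store assume i: "i < n" and P: "?P i f"
    have "f 50 0 = n" using P s by simp
    then have "?f i f = f(1 := (f 1)(n * i + i := 1))" by simp
    then show "?P (Suc i) (?f i f)" using P by (auto simp: less_Suc_eq simp del: hrun.simps)
  qed simp
  have \<sigma>1: "\<sigma> = s1(0 := (s1 0)(1 := n, 2 := k))" unfolding \<sigma> Emit_nbhds_def using s s1 by (simp add: s1_def[symmetric] del: One_nat_def)
  show "\<sigma> 0 0 = n" "\<sigma> 0 1 = n" "\<sigma> 0 2 = k" using s1 s by (simp_all add: \<sigma>1)
  have "(\<exists>j<n. u * n + v = n * j + j) \<longleftrightarrow> u = v" if "u < n" "v < n" for u v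
  proof
    assume "\<exists>j<n. u * n + v = n * j + j"
    then obtain j where j: "j < n" "u * n + v = j * n + j" by (auto simp: mult.commute)
    then have "(u * n + v) div n = (j * n + j) div n" "(u * n + v) mod n = (j * n + j) mod n" by simp_all
    then show "u = v" using that j(1) by simp
  qed (use that in \<open>auto simp: mult.commute\<close>)
  then show "\<sigma> 1 (u * n + v) \<noteq> 0 \<longleftrightarrow> u = v \<or> s 1 (u * n + v) \<noteq> 0" if "u < n" "v < n"
    using s1 that by (simp add: \<sigma>1)
qed

lemma computable_self_power: "computable (\<lambda>k. k ^ k)"
proof -
  define c where "c = Seq (blk (As 51 (Cn 0) (Ld 0 (Cn 0)))) (Seq (blk Self_power) (blk (As 0 (Cn 0) (Rg 52))))"
  have "\<exists>t s. exec c (\<lambda>a i. if a = 0 \<and> i = 0 then x else 0) t s \<and> s 0 0 = x ^ x" for x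
  proof -
    define s0 :: store where "s0 = (\<lambda>a i. if a = 0 \<and> i = 0 then x else 0)"
    have r: "runs (blk c) y (hrun c \<rho>0 y) (ccost c (\<lambda>a. y a 0))"
      if "creads c \<subseteq> {..<100}" "cbounds c \<inter> cwrites c = {}" for c y
      using runs_blk[OF that] .
    define \<sigma> where "\<sigma> = hrun (As 0 (Cn 0) (Rg 52)) \<rho>0 (hrun Self_power \<rho>0 (hrun (As 51 (Cn 0) (Ld 0 (Cn 0))) \<rho>0 s0))"
    have "\<exists>t. runs c s0 \<sigma> t" unfolding c_def \<sigma>_def
      by (rule exI, rule runs_Seq[OF r runs_Seq[OF r r]]) (auto simp: Self_power_def)
    then obtain t where "runs c s0 \<sigma> t" by blast
    moreover have "s0 100 0 = 0" by (simp add: s0_def)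
    ultimately obtain u s' where "exec c s0 u s'" "\<forall>a<100. s' a = \<sigma> a" unfolding runs_def by blast
    moreover have "\<sigma> 0 0 = x ^ x" by (simp add: \<sigma>_def hrun_Self_power s0_def)
    ultimately show ?thesis unfolding s0_def by (intro exI[of _ u] exI[of _ s']) simp
  qed
  then show ?thesis unfolding computable_def by blast
qed

lemma kernelization_k_Equidomination:
  "generalized_kernelization k_Equidomination k_Equihitting Kernel (\<lambda>k. k ^ k)"
proof -
  obtain C1 where C1: "\<And>k. 1 \<le> k \<Longrightarrow> (10 * k ^ 6 + 2) ^ (16 * k) \<le> C1 * (k ^ k) ^ 112"
    using B_power_bound by blast
  define A where "A = csize Save_input + csize Self_power + csize Emit_answer + csize Emit_nbhds + 12"
  define M where "M = A + solver_size * 300 * (2 + C1)"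
  \<comment> \<open>The degree comes from \<open>B_power_bound\<close>: the solver is only called if
    \<open>k ^ k < n\<close>, so its exponential term is at most a constant times
    \<open>n ^ 112\<close>.\<close>
  define p :: "nat poly" where "p = smult M ([:1, 1:] ^ 112)"
  have p: "poly p x = M * (x + 1) ^ 112" for x by (simp add: p_def poly_power add.commute)
  have "\<exists>t s n' F k'. exec Kernel (encode_graph n E k) t s \<and> t \<le> poly p (input_length n k) \<and>
           decode_instance s = ((n', F), k') \<and>
           (((n, E), k) \<in> k_Equidomination \<longleftrightarrow> ((n', F), k') \<in> k_Equihitting) \<and> n' \<le> k ^ k \<and> k' \<le> k"
    if inst: "graph_instance n E k" for n E k
  proof -
    interpret solver_graph n k E by unfold_locales (rule inst)
    have r: "runs (blk c) y (hrun c \<rho>0 y) (ccost c (\<lambda>a. y a 0))"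
      if "creads c \<subseteq> {..<100}" "cbounds c \<inter> cwrites c = {}" for c y
      using runs_blk[OF that] .
    note mono = runs_mono
    define s0 where "s0 = encode_graph n E k"
    define s1 where "s1 = hrun Save_input \<rho>0 s0"
    have s1: "s1 50 0 = n" "s1 51 0 = k" "\<And>a. a \<noteq> 50 \<Longrightarrow> a \<noteq> 51 \<Longrightarrow> s1 a = s0 a"
      using encode_graph_store(1,2)[of n E k] by (simp_all add: s1_def s0_def Save_input_def)
    have c0: "ccost Save_input (\<lambda>a. s0 a 0) \<le> csize Save_input"
      using ccost_le[of Save_input "\<lambda>a. s0 a 0" 0] kernel_wf(2,3) by simp
    define s2 where "s2 = hrun Self_power \<rho>0 s1"
    have s2: "s2 50 0 = n" "s2 51 0 = k" "s2 52 0 = k ^ k" "\<And>a. a < 50 \<Longrightarrow> s2 a = s0 a"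
      using s1 by (simp_all add: s2_def hrun_Self_power)
    have c2: "ccost Self_power (\<lambda>a. s1 a 0) \<le> csize Self_power * (n + 1) ^ 2" if "k < n"
      using ccost_le[of Self_power "\<lambda>a. s1 a 0" n] kernel_wf(6,7) s1(2) that by fastforce
    define good where "good = (\<lambda>\<sigma> :: store. \<exists>n' F k'. decode_instance \<sigma> = ((n', F), k') \<and>
           (((n, E), k) \<in> k_Equidomination \<longleftrightarrow> ((n', F), k') \<in> k_Equihitting) \<and> n' \<le> k ^ k \<and> k' \<le> k)"
    have copy: "runs (blk Emit_nbhds) s (hrun Emit_nbhds \<rho>0 s) (csize Emit_nbhds * (n + 1) ^ 2) \<and> good (hrun Emit_nbhds \<rho>0 s)"
      if s: "s 50 0 = n" "s 51 0 = k" "\<And>a. a < 50 \<Longrightarrow> s a = s0 a" and le: "n \<le> k ^ k" for s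
    proof
      have "ccost Emit_nbhds (\<lambda>a. s a 0) \<le> csize Emit_nbhds * (n + 1) ^ 2"
        using ccost_le[of Emit_nbhds "\<lambda>a. s a 0" n] kernel_wf(13,14) s(1) by fastforce
      then show "runs (blk Emit_nbhds) s (hrun Emit_nbhds \<rho>0 s) (csize Emit_nbhds * (n + 1) ^ 2)"
        using mono r kernel_wf(11,12) by blast
      define \<sigma> where "\<sigma> = hrun Emit_nbhds \<rho>0 s"
      have s00: "s 0 0 = n" using s(3)[of 0] encode_graph_store(1)[of n E k] by (simp add: s0_def)
      note cp = hrun_Emit_nbhds[OF \<sigma>_def s(1,2) s00]
      have adj: "\<sigma> 1 (u * n + v) \<noteq> 0 \<longleftrightarrow> v \<in> N u" if "u < n" "v < n" for u v
        using cp(4)[OF that] encode_graph_store(3)[OF that, of E k] s(3)[of 1] that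
        by (auto simp: s0_def closed_nbhd_def insert_commute)
      have "{v. v < n \<and> \<sigma> 1 (j * n + v) \<noteq> 0} = N j" if "j < n" for j
        using adj[OF that] N_subset[of j] that by auto
      then have "{{v. v < n \<and> \<sigma> 1 (j * n + v) \<noteq> 0} |j. j < n} = N ` V" by auto
      then have "decode_instance \<sigma> = ((n, N ` V), k)" unfolding decode_instance_def cp(1,2,3) by simp
      then show "good (hrun Emit_nbhds \<rho>0 s)"
        using k_Equihitting_closed_nbhd[OF inst] le unfolding good_def \<sigma>_def by blast
    qed
    have X: "1 \<le> (n + 1) ^ 112" "(n + 1) ^ 2 \<le> (n + 1) ^ 112"
      by (auto intro: power_increasing)
    moreover have "n ^ 2 \<le> (n + 1) ^ 2" by (intro power_mono) auto
    ultimately have X3: "n ^ 2 \<le> (n + 1) ^ 112" by linarith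
    have kk: "k \<le> k ^ k" using k1 by (simp add: self_le_power)
    have "\<exists>\<sigma> t. runs Kernel s0 \<sigma> t \<and> t \<le> M * (n + 1) ^ 112 \<and> good \<sigma>"
    proof (cases "k ^ k < n")
      case False
      then have le: "n \<le> k ^ k" by simp
      define \<sigma> where "\<sigma> = hrun Emit_nbhds \<rho>0 (if k < n then s2 else s1)"
      have cs: "runs (blk Emit_nbhds) (if k < n then s2 else s1) \<sigma> (csize Emit_nbhds * (n + 1) ^ 2)" "good \<sigma>"
        using copy[of "if k < n then s2 else s1"] s1 s2 le unfolding \<sigma>_def by auto
      let ?t = "(csize Self_power + csize Emit_nbhds) * (n + 1) ^ 2 + 6"
      have "runs (Seq (blk Self_power) (Cond (Minus (reg 50) (reg 52)) (Seq Solver (blk Emit_answer)) (blk Emit_nbhds))) s1 \<sigma> ?t" if "k < n"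
      proof -
        have "runs (Cond (Minus (reg 50) (reg 52)) (Seq Solver (blk Emit_answer)) (blk Emit_nbhds)) s2 \<sigma> (csize Emit_nbhds * (n + 1) ^ 2 + 6)"
          by (rule runs_Cond) (use cs that s2 False in auto)
        moreover have "runs (blk Self_power) s1 s2 (csize Self_power * (n + 1) ^ 2)"
          using mono[OF r[of Self_power s1] c2[OF that]] kernel_wf(4,5) by (simp add: s2_def)
        ultimately have "runs (Seq (blk Self_power) (Cond (Minus (reg 50) (reg 52)) (Seq Solver (blk Emit_answer)) (blk Emit_nbhds))) s1 \<sigma>
          (csize Self_power * (n + 1) ^ 2 + (csize Emit_nbhds * (n + 1) ^ 2 + 6))" by (rule runs_Seq[rotated])
        then show ?thesis by (rule runs_mono) (simp add: distrib_right)
      qed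
      moreover have "runs (blk Emit_nbhds) s1 \<sigma> ?t" if "\<not> k < n"
        by (rule runs_mono[where t = "csize Emit_nbhds * (n + 1) ^ 2"]) (use cs(1) that in \<open>auto simp: distrib_right\<close>)
      ultimately have "runs (Cond (Minus (reg 50) (reg 51))
         (Seq (blk Self_power) (Cond (Minus (reg 50) (reg 52)) (Seq Solver (blk Emit_answer)) (blk Emit_nbhds))) (blk Emit_nbhds)) s1 \<sigma> (?t + 6)"
        by (intro runs_Cond) (use s1 in auto)
      moreover have "runs (blk Save_input) s0 s1 (csize Save_input)"
        using mono[OF r[of Save_input s0] c0] kernel_wf(1,2) by (simp add: s1_def)
      ultimately have "runs Kernel s0 \<sigma> (csize Save_input + (?t + 6))" unfolding Kernel_def by (rule runs_Seq[rotated])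
      moreover have "csize Save_input + (?t + 6) \<le> M * (n + 1) ^ 112"
      proof -
        have "csize Save_input + (?t + 6) \<le> A * (n + 1) ^ 112"
        proof -
          have "(csize Save_input + 12) * 1 \<le> (csize Save_input + 12) * (n + 1) ^ 112" using X(1) by (rule mult_le_mono2)
          moreover have "(csize Self_power + csize Emit_nbhds) * (n + 1) ^ 2 \<le> (csize Self_power + csize Emit_nbhds) * (n + 1) ^ 112"
            using X(2) by (rule mult_le_mono2)
          ultimately have "csize Save_input + (?t + 6) \<le> (csize Save_input + 12 + (csize Self_power + csize Emit_nbhds)) * (n + 1) ^ 112"
            unfolding distrib_right by linarith
          also have "\<dots> \<le> A * (n + 1) ^ 112" by (intro mult_le_mono1) (simp add: A_def)
          finally show ?thesis .
        qed
        also have "\<dots> \<le> M * (n + 1) ^ 112" by (intro mult_le_mono1) (simp add: M_def)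
        finally show ?thesis .
      qed
      ultimately show ?thesis using cs(2) by blast
    next
      case True
      then have kn: "k < n" using kk by simp
      let ?S = "solver_size * (300 * (n * card E ^ 2 + n ^ 2 + (10 * k ^ 6 + 2) ^ (16 * k)))"
      \<comment> \<open>The preceding blocks write arrays 50 to 52 only, so the solver meets the
        original input and an array 28 that is still zero.\<close>
      have "\<exists>\<sigma>. runs Solver s2 \<sigma> ?S \<and> \<sigma> 0 0 = of_bool (k_equidominating k {..<n} E)"
        by (rule solver_runs') (use encode_graph_store[where n = n and E = E and k = k] s2(4)[of 0] s2(4)[of 1] s2(4)[of 28] in \<open>auto simp: s0_def\<close>)
      then obtain s3 where s3: "runs Solver s2 s3 ?S" "s3 0 0 = of_bool (k_equidominating k {..<n} E)" by blast
      define \<sigma> where "\<sigma> = hrun Emit_answer \<rho>0 s3"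
      have \<sigma>0: "\<sigma> 0 0 = 0" "\<sigma> 0 1 = of_bool (k_equidominating k {..<n} E)" "\<sigma> 0 2 = 0" by (simp_all add: \<sigma>_def Emit_answer_def s3(2))
      have "decode_instance \<sigma> = ((0, {{} |j. j < (of_bool (k_equidominating k {..<n} E) :: nat)}), 0)"
        unfolding decode_instance_def \<sigma>0 by simp
      moreover have "((0, {{} |j. j < (of_bool (k_equidominating k {..<n} E) :: nat)}), 0) \<in> k_Equihitting \<longleftrightarrow> ((n, E), k) \<in> k_Equidomination"
        using inst by (auto simp: k_Equihitting_def k_Equidomination_def)
      ultimately have g: "good \<sigma>" unfolding good_def by blast
      have "ccost Emit_answer (\<lambda>a. s3 a 0) \<le> csize Emit_answer"
        using ccost_le[of Emit_answer "\<lambda>a. s3 a 0" 0] kernel_wf(9,10) by simp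
      then have "runs (blk Emit_answer) s3 \<sigma> (csize Emit_answer)"
        using mono[OF r[of Emit_answer s3]] kernel_wf(8,9) by (simp add: \<sigma>_def)
      then have "runs (Seq Solver (blk Emit_answer)) s2 \<sigma> (?S + csize Emit_answer)" by (rule runs_Seq[OF s3(1)])
      then have "runs (Cond (Minus (reg 50) (reg 52)) (Seq Solver (blk Emit_answer)) (blk Emit_nbhds)) s2 \<sigma> (?S + csize Emit_answer + 6)"
        by (intro runs_Cond) (use s2 True in auto)
      moreover have "runs (blk Self_power) s1 s2 (csize Self_power * (n + 1) ^ 2)"
        using mono[OF r[of Self_power s1] c2[OF kn]] kernel_wf(4,5) by (simp add: s2_def)
      ultimately have "runs (Seq (blk Self_power) (Cond (Minus (reg 50) (reg 52)) (Seq Solver (blk Emit_answer)) (blk Emit_nbhds))) s1 \<sigma>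
        (csize Self_power * (n + 1) ^ 2 + (?S + csize Emit_answer + 6))" by (rule runs_Seq[rotated])
      then have "runs (Cond (Minus (reg 50) (reg 51))
         (Seq (blk Self_power) (Cond (Minus (reg 50) (reg 52)) (Seq Solver (blk Emit_answer)) (blk Emit_nbhds))) (blk Emit_nbhds)) s1 \<sigma>
         (csize Self_power * (n + 1) ^ 2 + (?S + csize Emit_answer + 6) + 6)"
        by (intro runs_Cond) (use s1 kn in auto)
      moreover have "runs (blk Save_input) s0 s1 (csize Save_input)"
        using mono[OF r[of Save_input s0] c0] kernel_wf(1,2) by (simp add: s1_def)
      ultimately have "runs Kernel s0 \<sigma> (csize Save_input + (csize Self_power * (n + 1) ^ 2 + (?S + csize Emit_answer + 6) + 6))"
        unfolding Kernel_def by (rule runs_Seq[rotated])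
      moreover have "csize Save_input + (csize Self_power * (n + 1) ^ 2 + (?S + csize Emit_answer + 6) + 6) \<le> M * (n + 1) ^ 112"
      proof -
        let ?Y = "(n + 1) ^ 112"
        have "card E \<le> n ^ 2"
        proof -
          have "E \<subseteq> (\<lambda>(u, v). {u, v}) ` (V \<times> V)"
          proof
            fix e assume "e \<in> E"
            then have "e \<subseteq> V" "card e = 2" using graph by (auto simp: simple_graph_def)
            then obtain u v where "e = {u, v}" "u \<in> V" "v \<in> V" by (auto simp: card_2_iff)
            then show "e \<in> (\<lambda>(u, v). {u, v}) ` (V \<times> V)" by auto
          qed
          then have "card E \<le> card (V \<times> V)" by (meson card_image_le card_mono finite_SigmaI finite_imageI finite_lessThan le_trans)
          then show ?thesis by (simp add: power2_eq_square)
        qed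
        then have "n * card E ^ 2 \<le> n * (n ^ 2) ^ 2" by (intro mult_le_mono2 power_mono) auto
        also have "\<dots> = n ^ 5" by (simp add: power_numeral_reduce)
        also have "\<dots> \<le> (n + 1) ^ 5" by (intro power_mono) auto
        also have "\<dots> \<le> ?Y" by (intro power_increasing) auto
        finally have 1: "n * card E ^ 2 \<le> ?Y" .
        have "(10 * k ^ 6 + 2) ^ (16 * k) \<le> C1 * (k ^ k) ^ 112" by (rule C1[OF k1])
        also have "\<dots> \<le> C1 * (n + 1) ^ 112" using True by (intro mult_le_mono2 power_mono) auto
        finally have "n * card E ^ 2 + n ^ 2 + (10 * k ^ 6 + 2) ^ (16 * k) \<le> (2 + C1) * ?Y"
          using 1 X3 by (simp add: distrib_right)
        then have S: "?S \<le> solver_size * 300 * (2 + C1) * ?Y"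
          by (metis mult.assoc mult_le_mono2)
        have fin: "csize Save_input + (x + (s + csize Emit_answer + 6) + 6) \<le> M * y"
          if x: "x \<le> csize Self_power * y" and s: "s \<le> solver_size * 300 * (2 + C1) * y" and y: "1 \<le> y" for x s y :: nat
        proof -
          have "csize Save_input + (x + (s + csize Emit_answer + 6) + 6) = (csize Save_input + csize Emit_answer + 12) * 1 + x + s" by simp
          also have "\<dots> \<le> (csize Save_input + csize Emit_answer + 12) * y + csize Self_power * y + solver_size * 300 * (2 + C1) * y"
            by (intro add_mono x s mult_le_mono2 y)
          also have "\<dots> = (csize Save_input + csize Emit_answer + 12 + csize Self_power + solver_size * 300 * (2 + C1)) * y"
            by (simp only: distrib_right)
          also have "\<dots> \<le> M * y" by (intro mult_le_mono1) (simp add: M_def A_def)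
          finally show ?thesis .
        qed
        show ?thesis by (rule fin[OF mult_le_mono2[OF X(2)] S X(1)])
      qed
      ultimately show ?thesis using g by blast
    qed
    then obtain \<sigma> t where \<sigma>: "runs Kernel s0 \<sigma> t" "t \<le> M * (n + 1) ^ 112" "good \<sigma>" by blast
    have "s0 100 0 = 0" by (simp add: s0_def encode_graph_def)
    then obtain u s' where e: "exec Kernel s0 u s'" "u \<le> t" "\<forall>a<100. s' a = \<sigma> a" using \<sigma>(1) unfolding runs_def by blast
    have "decode_instance s' = decode_instance \<sigma>" using e(3) by (simp add: decode_instance_def)
    moreover have "n + 1 \<le> input_length n k + 1"
      unfolding input_length_def by (cases n) auto
    then have "u \<le> poly p (input_length n k)"
      using e(2) \<sigma>(2) mult_le_mono2[OF power_mono[of "n + 1" "input_length n k + 1" 112], of M] unfolding p by linarith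
    moreover obtain n' F k' where "decode_instance \<sigma> = ((n', F), k')"
        "((n, E), k) \<in> k_Equidomination \<longleftrightarrow> ((n', F), k') \<in> k_Equihitting" "n' \<le> k ^ k" "k' \<le> k"
      using \<sigma>(3) unfolding good_def by blast
    ultimately show ?thesis using e(1)
      by (intro exI[of _ u] exI[of _ s'] exI[of _ n'] exI[of _ F] exI[of _ k']) (simp add: s0_def)
  qed
  then show ?thesis unfolding generalized_kernelization_def
    using computable_self_power by (intro conjI exI[of _ p] exI[of _ "\<lambda>k. k"]) simp_all
qed

theorem theorem7p1:
  shows "(\<exists>(Q :: param_problem) (c :: com) (g :: nat \<Rightarrow> nat).
            generalized_kernelization k_Equidomination Q c g \<and>
            (\<lambda>k. real (g k)) \<in> O(\<lambda>k. real k ^ (3 * k + 1)))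
       \<and> (\<exists>(c :: com) (C :: nat).
            solves_in_time c k_Equidomination
              (\<lambda>n m k. C * (n * m ^ 2 + n ^ 2 + k ^ (6 * k ^ 2 + 7 * k + 1))))"
proof
  have "(\<lambda>k. real (k ^ k)) \<in> O(\<lambda>k. real k ^ (3 * k + 1))"
  proof (rule bigoI[of _ 1])
    show "\<forall>\<^sub>F k in sequentially. norm (real (k ^ k)) \<le> 1 * norm (real k ^ (3 * k + 1))"
    proof (rule eventually_sequentiallyI)
      fix k :: nat assume "1 \<le> k"
      then have "real k ^ k \<le> real k ^ (3 * k + 1)" by (intro power_increasing) auto
      then show "norm (real (k ^ k)) \<le> 1 * norm (real k ^ (3 * k + 1))" by simp
    qed
  qed
  then show "\<exists>(Q :: param_problem) (c :: com) (g :: nat \<Rightarrow> nat).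
            generalized_kernelization k_Equidomination Q c g \<and>
            (\<lambda>k. real (g k)) \<in> O(\<lambda>k. real k ^ (3 * k + 1))"
    using kernelization_k_Equidomination by blast
qed (rule solves_k_Equidomination)

end
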